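(* There exist a complex Hilbert space $H$, positive integers $m,n$, and systems of bounded operators $\{E_i\}_{i=1}^m$ and $\{F_j\}_{j=1}^n$ in $B(H)$ such that (1) $E_iF_j=F_jE_i$ for all $1\leq i\leq m$ and $1\leq j\leq n$; (2) $\sum_{i=1}^m E_i^*E_i=\mathrm{Id}_H=\sum_{j=1}^n F_j^*F_j$; (3) $\Phi_1,\Phi_2:\mathcal{T}(H)\rightarrow \mathcal{T}(H)$ are the quantum channels given by $\Phi_1(\rho)=\sum_{i=1}^m E_i\rho E_i^*$ and $\Phi_2(\rho)=\sum_{j=1}^n F_j\rho F_j^*$; (4) $\overline{H}_{min}(\Phi_1\circ \Phi_2)<\overline{H}_{min}(\Phi_1)+\overline{H}_{min}(\Phi_2)$.
   Context: $B(H)$ denotes the bounded operators and $\mathcal{T}(H)$ the trace class operators on a Hilbert space $H$. A quantum channel is a completely positive trace preserving map between spaces of trace class operators. A state on $H$ is a positive element of $\mathcal{T}(H)$ of trace $1$. The von Neumann entropy of a state $\rho$ with eigenvalues $\lambda_1(\rho)\geq\lambda_2(\rho)\geq\cdots$ (counted with multiplicity) is $H(\rho)=-\sum_i\lambda_i(\rho)\log\lambda_i(\rho)$ (natural logarithm, $0\log 0=0$). For a quantum channel $\Phi:\mathcal{T}(H)\to\mathcal{T}(H)$ of the form $\Phi(\rho)=\sum_{i=1}^N A_i\rho A_i^*$ with $\sum_i A_i^*A_i=\mathrm{Id}_H$, its $k$-fold tensor power is the channel $\Phi^{\otimes k}:\mathcal{T}(H^{\otimes k})\to\mathcal{T}(H^{\otimes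 k})$, $\Phi^{\otimes k}(\rho)=\sum_{i_1,\dots,i_k=1}^N (A_{i_1}\otimes\cdots\otimes A_{i_k})\rho(A_{i_1}\otimes\cdots\otimes A_{i_k})^*$, where $H^{\otimes k}$ is the Hilbert space tensor product. The minimum output entropy (MOE) is $H_{min}(\Phi)=\inf_{\xi}H(\Phi(|\xi\rangle\langle\xi|))$, with the infimum over all unit vectors $\xi$ in the input Hilbert space, and the regularized MOE is $\overline{H}_{min}(\Phi)=\lim_{k\to\infty}\frac1k H_{min}(\Phi^{\otimes k})$. *)

theory Defs
  imports "HOL-Analysis.Analysis" "HOL-Algebra.Module"
begin

section \<open>Complex Hilbert spaces\<close>

text \<open>
  Hilbert spaces are given by explicit carriers, because the tensor powers of a space have to be
  indexed by a natural number inside a formula.  The underlying vector space is a module of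
  HOL-Algebra over the field of complex numbers; the fields \<open>mult\<close> and \<open>one\<close> that the record
  inherits from rings play no role.
\<close>

definition complex_field :: "complex ring" where
  "complex_field = \<lparr>carrier = UNIV, mult = (*), one = 1, zero = 0, add = (+)\<rparr>"

record 'a cinner_space = "(complex, 'a) module" +
  cinner :: "'a \<Rightarrow> 'a \<Rightarrow> complex"

definition cnorm :: "('a, 's) cinner_space_scheme \<Rightarrow> 'a \<Rightarrow> real" where
  "cnorm H x = sqrt (Re (cinner H x x))"

text \<open>The inner product is linear in its second argument.\<close>

locale complex_hilbert_space = Module.module complex_field H for H (structure) +
  assumes cinner_add_right: "\<lbrakk>x \<in> carrier H; y \<in> carrier H; z \<in> carrier H\<rbrakk>
      \<Longrightarrow> cinner H x (y \<oplus>\<^bsub>H\<^esub> z) = cinner H x y + cinner H x z"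
    and cinner_scale_right: "\<lbrakk>x \<in> carrier H; y \<in> carrier H\<rbrakk>
      \<Longrightarrow> cinner H x (c \<odot>\<^bsub>H\<^esub> y) = c * cinner H x y"
    and cinner_commute: "\<lbrakk>x \<in> carrier H; y \<in> carrier H\<rbrakk>
      \<Longrightarrow> cinner H x y = cnj (cinner H y x)"
    and cinner_ge_zero: "x \<in> carrier H \<Longrightarrow> 0 \<le> Re (cinner H x x)"
    and cinner_eq_zero: "\<lbrakk>x \<in> carrier H; cinner H x x = 0\<rbrakk> \<Longrightarrow> x = \<zero>\<^bsub>H\<^esub>"
    and complete: "Metric_space.mcomplete (carrier H) (\<lambda>x y. cnorm H (x \<ominus>\<^bsub>H\<^esub> y))"

definition orthonormal :: "('a, 's) cinner_space_scheme \<Rightarrow> 'a set \<Rightarrow> bool" where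
  "orthonormal H B \<longleftrightarrow>
     B \<subseteq> carrier H \<and> (\<forall>b\<in>B. \<forall>c\<in>B. cinner H b c = (if b = c then 1 else 0))"

definition orthonormal_basis :: "('a, 's) cinner_space_scheme \<Rightarrow> 'a set \<Rightarrow> bool" where
  "orthonormal_basis H B \<longleftrightarrow>
     orthonormal H B \<and> (\<forall>x\<in>carrier H. (\<forall>b\<in>B. cinner H b x = 0) \<longrightarrow> x = \<zero>\<^bsub>H\<^esub>)"


section \<open>Operators\<close>

text \<open>
  Operators are extensional functions on the carrier, so that equality of operators is equality
  in HOL.
\<close>

definition bounded_ops :: "('a, 's) cinner_space_scheme \<Rightarrow> ('a \<Rightarrow> 'a) set" where
  "bounded_ops H = {A \<in> carrier H \<rightarrow>\<^sub>E carrier H.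
     (\<forall>x\<in>carrier H. \<forall>y\<in>carrier H. A (x \<oplus>\<^bsub>H\<^esub> y) = A x \<oplus>\<^bsub>H\<^esub> A y) \<and>
     (\<forall>c. \<forall>x\<in>carrier H. A (c \<odot>\<^bsub>H\<^esub> x) = c \<odot>\<^bsub>H\<^esub> A x) \<and>
     (\<exists>C. \<forall>x\<in>carrier H. cnorm H (A x) \<le> C * cnorm H x)}"

definition op_id :: "('a, 's) cinner_space_scheme \<Rightarrow> 'a \<Rightarrow> 'a" where
  "op_id H = (\<lambda>x\<in>carrier H. x)"

definition op_mult ::
    "('a, 's) cinner_space_scheme \<Rightarrow> ('a \<Rightarrow> 'a) \<Rightarrow> ('a \<Rightarrow> 'a) \<Rightarrow> 'a \<Rightarrow> 'a" where
  "op_mult H A B = compose (carrier H) A B"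

definition op_sum ::
    "('a, 's) cinner_space_scheme \<Rightarrow> ('i \<Rightarrow> 'a \<Rightarrow> 'a) \<Rightarrow> 'i set \<Rightarrow> 'a \<Rightarrow> 'a" where
  "op_sum H A I = (\<lambda>x\<in>carrier H. finsum H (\<lambda>i. A i x) I)"

definition adjoint_op :: "('a, 's) cinner_space_scheme \<Rightarrow> ('a \<Rightarrow> 'a) \<Rightarrow> 'a \<Rightarrow> 'a" where
  "adjoint_op H A = (THE B. B \<in> bounded_ops H \<and>
     (\<forall>x\<in>carrier H. \<forall>y\<in>carrier H. cinner H (A x) y = cinner H x (B y)))"

definition positive_op :: "('a, 's) cinner_space_scheme \<Rightarrow> ('a \<Rightarrow> 'a) \<Rightarrow> bool" where
  "positive_op H P \<longleftrightarrow> P \<in> bounded_ops H \<and> (\<forall>x\<in>carrier H. cinner H x (P x) \<in> \<real>\<^sub>\<ge>\<^sub>0)"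

text \<open>
  The operator \<open>P\<close> is the absolute value \<open>(A\<^sup>*A)\<^sup>1\<^sup>/\<^sup>2\<close>, which exists and is unique, and the sum is its
  trace, which does not depend on the basis.
\<close>

definition trace_class :: "('a, 's) cinner_space_scheme \<Rightarrow> ('a \<Rightarrow> 'a) set" where
  "trace_class H = {A \<in> bounded_ops H.
     \<exists>P. positive_op H P \<and> op_mult H P P = op_mult H (adjoint_op H A) A \<and>
         (\<exists>B. orthonormal_basis H B \<and> (\<lambda>b. cinner H b (P b)) summable_on B)}"

text \<open>The rank one operator written \<open>|\<xi>\<rangle>\<langle>\<xi>|\<close> in bra-ket notation.\<close>

definition pure_state :: "('a, 's) cinner_space_scheme \<Rightarrow> 'a \<Rightarrow> 'a \<Rightarrow> 'a" where
  "pure_state H \<xi> = (\<lambda>x\<in>carrier H. cinner H \<xi> x \<odot>\<^bsub>H\<^esub> \<xi>)"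


section \<open>Hilbert space tensor powers\<close>

text \<open>
  The \<open>k\<close>-fold tensor power is realised as the space of square summable families indexed by the
  \<open>k\<close>-tuples of elements of an orthonormal basis; the elementary tensor of \<open>x\<^sub>1, \<dots>, x\<^sub>k\<close> is the
  family of products of the coordinates.  Changing the basis changes the realisation by a unitary
  that preserves elementary tensors.
\<close>

definition tuples :: "nat \<Rightarrow> 'b set \<Rightarrow> 'b list set" where
  "tuples k S = {bs. length bs = k \<and> set bs \<subseteq> S}"

definition some_onb :: "('a, 's) cinner_space_scheme \<Rightarrow> 'a set" where
  "some_onb H = (SOME B. orthonormal_basis H B)"

definition tensor_space ::
    "('a, 's) cinner_space_scheme \<Rightarrow> nat \<Rightarrow> ('a list \<Rightarrow> complex) cinner_space" where
  "tensor_space H k =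
     \<lparr>carrier = {f. (\<forall>bs. bs \<notin> tuples k (some_onb H) \<longrightarrow> f bs = 0) \<and>
                    (\<lambda>bs. (cmod (f bs))\<^sup>2) summable_on tuples k (some_onb H)},
      mult = undefined, one = undefined,
      zero = (\<lambda>bs. 0),
      add = (\<lambda>f g bs. f bs + g bs),
      smult = (\<lambda>c f bs. c * f bs),
      cinner = (\<lambda>f g. \<Sum>\<^sub>\<infinity>bs\<in>tuples k (some_onb H). cnj (f bs) * g bs)\<rparr>"

definition tensor_vec :: "('a, 's) cinner_space_scheme \<Rightarrow> 'a list \<Rightarrow> 'a list \<Rightarrow> complex" where
  "tensor_vec H xs = (\<lambda>bs. if bs \<in> tuples (length xs) (some_onb H)
     then \<Prod>i<length xs. cinner H (bs ! i) (xs ! i) else 0)"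

definition tensor_op ::
    "('a, 's) cinner_space_scheme \<Rightarrow> ('a \<Rightarrow> 'a) list
       \<Rightarrow> ('a list \<Rightarrow> complex) \<Rightarrow> ('a list \<Rightarrow> complex)" where
  "tensor_op H As = (THE T. T \<in> bounded_ops (tensor_space H (length As)) \<and>
     (\<forall>xs\<in>tuples (length As) (carrier H).
        T (tensor_vec H xs) = tensor_vec H (map2 (\<lambda>A x. A x) As xs)))"


section \<open>Quantum channels\<close>

text \<open>
  The formula makes sense for every bounded operator \<open>\<rho>\<close>; as a channel the map is considered on
  the trace class.  It is trace preserving if \<open>kraus_family H A I\<close> holds.
\<close>

definition kraus_family ::
    "('a, 's) cinner_space_scheme \<Rightarrow> ('i \<Rightarrow> 'a \<Rightarrow> 'a) \<Rightarrow> 'i set \<Rightarrow> bool" where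
  "kraus_family H A I \<longleftrightarrow> finite I \<and> (\<forall>i\<in>I. A i \<in> bounded_ops H) \<and>
     op_sum H (\<lambda>i. op_mult H (adjoint_op H (A i)) (A i)) I = op_id H"

definition kraus_map ::
    "('a, 's) cinner_space_scheme \<Rightarrow> ('i \<Rightarrow> 'a \<Rightarrow> 'a) \<Rightarrow> 'i set \<Rightarrow> ('a \<Rightarrow> 'a) \<Rightarrow> ('a \<Rightarrow> 'a)" where
  "kraus_map H A I \<rho> = op_sum H (\<lambda>i. op_mult H (A i) (op_mult H \<rho> (adjoint_op H (A i)))) I"

text \<open>
  The tensor power is a function of the channel: it does not depend on which Kraus family
  \<open>A\<^sub>1, \<dots>, A\<^sub>N\<close> representing \<open>\<Phi>\<close> on the trace class is chosen.
\<close>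

definition is_tensor_power ::
    "('a, 's) cinner_space_scheme \<Rightarrow> nat \<Rightarrow> (('a \<Rightarrow> 'a) \<Rightarrow> ('a \<Rightarrow> 'a)) \<Rightarrow>
     ((('a list \<Rightarrow> complex) \<Rightarrow> ('a list \<Rightarrow> complex)) \<Rightarrow>
      (('a list \<Rightarrow> complex) \<Rightarrow> ('a list \<Rightarrow> complex))) \<Rightarrow> bool" where
  "is_tensor_power H k \<Phi> \<Psi> \<longleftrightarrow>
     (\<exists>(N::nat) A. kraus_family H A {1..N} \<and>
        (\<forall>\<rho>\<in>trace_class H. \<Phi> \<rho> = kraus_map H A {1..N} \<rho>) \<and>
        \<Psi> = kraus_map (tensor_space H k) (\<lambda>is. tensor_op H (map A is)) (tuples k {1..N}))"

definition tensor_power ::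
    "('a, 's) cinner_space_scheme \<Rightarrow> nat \<Rightarrow> (('a \<Rightarrow> 'a) \<Rightarrow> ('a \<Rightarrow> 'a)) \<Rightarrow>
     (('a list \<Rightarrow> complex) \<Rightarrow> ('a list \<Rightarrow> complex)) \<Rightarrow>
     (('a list \<Rightarrow> complex) \<Rightarrow> ('a list \<Rightarrow> complex))" where
  "tensor_power H k \<Phi> = (SOME \<Psi>. is_tensor_power H k \<Phi> \<Psi>)"


section \<open>Entropy\<close>

definition eigenspace ::
    "('a, 's) cinner_space_scheme \<Rightarrow> ('a \<Rightarrow> 'a) \<Rightarrow> real \<Rightarrow> 'a set" where
  "eigenspace H \<rho> l = {x \<in> carrier H. \<rho> x = complex_of_real l \<odot>\<^bsub>H\<^esub> x}"

definition eigenvalues :: "('a, 's) cinner_space_scheme \<Rightarrow> ('a \<Rightarrow> 'a) \<Rightarrow> real set" where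
  "eigenvalues H \<rho> = {l. \<exists>x\<in>eigenspace H \<rho> l. x \<noteq> \<zero>\<^bsub>H\<^esub>}"

text \<open>The dimension of the eigenspace, as the largest size of an orthonormal system in it.\<close>

definition multiplicity ::
    "('a, 's) cinner_space_scheme \<Rightarrow> ('a \<Rightarrow> 'a) \<Rightarrow> real \<Rightarrow> ereal" where
  "multiplicity H \<rho> l =
     (SUP B \<in> {B. finite B \<and> B \<subseteq> eigenspace H \<rho> l \<and> orthonormal H B}. ereal (real (card B)))"

text \<open>
  All summands are nonnegative if \<open>\<rho>\<close> is a state, and the sum may be infinite.  The eigenvalue 0,
  even with infinite multiplicity, contributes 0, since \<open>ln 0 = 0\<close> and \<open>\<infinity> * 0 = 0\<close>.
\<close>

definition entropy :: "('a, 's) cinner_space_scheme \<Rightarrow> ('a \<Rightarrow> 'a) \<Rightarrow> ereal" where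
  "entropy H \<rho> = (\<Sum>\<^sub>\<infinity>l\<in>eigenvalues H \<rho>. multiplicity H \<rho> l * ereal (- (l * ln l)))"

definition min_output_entropy ::
    "('a, 's) cinner_space_scheme \<Rightarrow> (('a \<Rightarrow> 'a) \<Rightarrow> ('a \<Rightarrow> 'a)) \<Rightarrow> ereal" where
  "min_output_entropy H \<Phi> =
     (INF \<xi> \<in> {\<xi> \<in> carrier H. cnorm H \<xi> = 1}. entropy H (\<Phi> (pure_state H \<xi>)))"

definition regularized_moe ::
    "('a, 's) cinner_space_scheme \<Rightarrow> (('a \<Rightarrow> 'a) \<Rightarrow> ('a \<Rightarrow> 'a)) \<Rightarrow> ereal" where
  "regularized_moe H \<Phi> =
     lim (\<lambda>k. ereal (1 / real k) * min_output_entropy (tensor_space H k) (tensor_power H k \<Phi>))"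

end

theory Submission
  imports Defs
begin

text \<open>
  Consider the group generated by letters \<open>x\<^sub>0, x\<^sub>1, x\<^sub>2, \<dots>\<close> with the only relations \<open>x\<^sub>i\<^sup>2 = 1\<close>.
  Its elements are the words without equal neighbours.  Left multiplications commute with right
  multiplications, and \<open>E\<^sub>i\<close>, \<open>F\<^sub>j\<close> are the unitaries that permute the square summable families on the
  group by the left and the right multiplication with the letters 1, ..., n, divided by the square
  root of n.

  The composition has an output of low entropy: at the unit vector supported on the empty word, the
  n operators \<open>E\<^sub>iF\<^sub>i\<close> all return this vector (divided by n), because \<open>x\<^sub>ix\<^sub>i = 1\<close>, whereas the
  products with distinct indices give orthogonal vectors.  The output has the eigenvalue 1/n once
  and \<open>1/n\<^sup>2\<close> with multiplicity \<open>n\<^sup>2 - n\<close>, so that its entropy is \<open>2 ln n - (ln n)/n\<close>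
  (\<open>out_entropy_delta\<close>, \<open>average_log_multiplicity\<close>).

  Each of the two channels alone has nearly maximal output entropy, uniformly over tensor powers.
  The entropy of an output \<open>\<rho>\<close> is at least \<open>- ln tr \<rho>\<^sup>2\<close>, and for the k-fold tensor power \<open>tr \<rho>\<^sup>2\<close> is
  \<open>n\<close> to the power \<open>-2k\<close> times the sum of \<open>|\<langle>U\<^sub>I\<xi>, U\<^sub>J\<xi>\<rangle>|\<^sup>2\<close> over all pairs of index tuples.  A variant
  of Haagerup's inequality bounds this sum by \<open>(n + 9)\<close> to the power k: in each tensor position the
  diagonal pairs contribute n, and for \<open>i \<noteq> j\<close> the unitary of a letter is the sum of the operator that
  creates the letter at one end of a word and of the one that annihilates it, which leaves three
  kinds of products, each bounded by Cauchy-Schwarz (\<open>Haagerup_step\<close>, \<open>Haagerup_tuples\<close>).  Hence each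
  regularized minimum output entropy is at least \<open>ln (n\<^sup>2 / (n + 9)) \<ge> ln n - 9/n\<close>, and additivity
  fails as soon as \<open>ln n > 18\<close>.

  The regularization is a limit, and its existence has to be shown.  Product inputs make the minimum
  output entropies of the tensor powers a subadditive sequence, so that Fekete's lemma applies
  (\<open>regularized_moe_eq\<close>).  The entropies of outputs are handled through Gram matrices: the operator
  \<open>\<Sum>\<^sub>i |v\<^sub>i\<rangle>\<langle>v\<^sub>i|\<close> has the same nonzero spectrum as the Gram matrix of the \<open>v\<^sub>i\<close>, and Gram matrices of
  product vectors are Kronecker products (\<open>matrix_entropy_product\<close>).

  The tensor powers refer to an arbitrary orthonormal basis and to an arbitrary Kraus family of the
  channel.  A unitary, given by the products of the coordinates of the basis vectors, carries the
  tensor power to the square summable families on tuples of words.  Two Kraus families of the same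
  channel differ by an isometric matrix of coefficients, which does not change the output
  (\<open>kraus_freedom\<close>, \<open>tensor_power_pure_state\<close>).
\<close>

section \<open>Square summable families\<close>

definition ell2 :: "'x set \<Rightarrow> ('x \<Rightarrow> complex) set" where
  "ell2 S = {f. (\<forall>x. x \<notin> S \<longrightarrow> f x = 0) \<and> (\<lambda>x. (cmod (f x))\<^sup>2) summable_on S}"

definition ip :: "'x set \<Rightarrow> ('x \<Rightarrow> complex) \<Rightarrow> ('x \<Rightarrow> complex) \<Rightarrow> complex" where
  "ip S f g = (\<Sum>\<^sub>\<infinity>x\<in>S. cnj (f x) * g x)"

definition nsq :: "'x set \<Rightarrow> ('x \<Rightarrow> complex) \<Rightarrow> real" where
  "nsq S f = (\<Sum>\<^sub>\<infinity>x\<in>S. (cmod (f x))\<^sup>2)"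

definition delta :: "'x \<Rightarrow> 'x \<Rightarrow> complex" where
  "delta x = (\<lambda>y. if y = x then 1 else 0)"

lemma ell2_outside: "f \<in> ell2 S \<Longrightarrow> x \<notin> S \<Longrightarrow> f x = 0"
  by (auto simp: ell2_def)

lemma ell2_summable: "f \<in> ell2 S \<Longrightarrow> (\<lambda>x. (cmod (f x))\<^sup>2) summable_on S"
  by (auto simp: ell2_def)

lemma ell2_zero [simp]: "(\<lambda>x. 0) \<in> ell2 S"
  by (auto simp: ell2_def)

lemma ell2_scale: "f \<in> ell2 S \<Longrightarrow> (\<lambda>x. c * f x) \<in> ell2 S"
  by (auto simp: ell2_def norm_mult power_mult_distrib intro!: summable_on_cmult_right)

lemma ell2_add: 
  assumes "f \<in> ell2 S" "g \<in> ell2 S" shows "(\<lambda>x. f x + g x) \<in> ell2 S"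
proof -
  have le: "(cmod (a + b))\<^sup>2 \<le> 2 * (cmod a)\<^sup>2 + 2 * (cmod b)\<^sup>2" for a b :: complex
  proof -
    have "(cmod (a + b))\<^sup>2 \<le> (cmod a + cmod b)\<^sup>2"
      by (intro power_mono norm_triangle_ineq) auto
    also have "\<dots> \<le> 2 * (cmod a)\<^sup>2 + 2 * (cmod b)\<^sup>2"
      using zero_le_power2[of "cmod a - cmod b"] by (simp add: power2_sum power2_diff)
    finally show ?thesis .
  qed
  have "(\<lambda>x. 2 * (cmod (f x))\<^sup>2 + 2 * (cmod (g x))\<^sup>2) summable_on S"
    using assms by (intro summable_on_add summable_on_cmult_right ell2_summable)
  then have "(\<lambda>x. (cmod (f x + g x))\<^sup>2) summable_on S"
    by (rule summable_on_comparison_test) (auto intro: le)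
  then show ?thesis using assms by (auto simp: ell2_def)
qed

lemma ell2_uminus: "f \<in> ell2 S \<Longrightarrow> (\<lambda>x. - f x) \<in> ell2 S"
  by (auto simp: ell2_def)

lemma ell2_diff: "f \<in> ell2 S \<Longrightarrow> g \<in> ell2 S \<Longrightarrow> (\<lambda>x. f x - g x) \<in> ell2 S"
  using ell2_add[OF _ ell2_uminus] by fastforce

lemma ell2_sum: "(\<And>i. i \<in> I \<Longrightarrow> f i \<in> ell2 S) \<Longrightarrow> (\<lambda>x. \<Sum>i\<in>I. f i x) \<in> ell2 S"
  by (induction I rule: infinite_finite_induct) (auto intro!: ell2_add)

lemma ell2_comparison:
  assumes "g \<in> ell2 S" "\<And>x. x \<in> S \<Longrightarrow> cmod (f x) \<le> cmod (g x)" "\<And>x. x \<notin> S \<Longrightarrow> f x = 0"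
  shows "f \<in> ell2 S"
proof -
  have "(\<lambda>x. (cmod (f x))\<^sup>2) summable_on S"
    by (rule summable_on_comparison_test[OF ell2_summable[OF assms(1)]])
       (auto intro!: power_mono assms(2))
  then show ?thesis using assms by (auto simp: ell2_def)
qed

lemma ell2_bounded_sums:
  assumes "\<And>x. x \<notin> S \<Longrightarrow> f x = 0"
    and "\<And>F. finite F \<Longrightarrow> F \<subseteq> S \<Longrightarrow> (\<Sum>x\<in>F. (cmod (f x))\<^sup>2) \<le> C"
  shows "f \<in> ell2 S" "nsq S f \<le> C"
proof -
  have s: "(\<lambda>x. (cmod (f x))\<^sup>2) summable_on S"
    by (rule nonneg_bdd_above_summable_on) (auto intro!: bdd_aboveI2[where M = C] assms(2))
  then show "f \<in> ell2 S" using assms by (auto simp: ell2_def)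
  show "nsq S f \<le> C" unfolding nsq_def using s by (rule infsum_le_finite_sums) (use assms(2) in auto)
qed

lemma ell2_finite_support:
  assumes "finite F" "F \<subseteq> S" "\<And>x. x \<notin> F \<Longrightarrow> f x = 0"
  shows "f \<in> ell2 S" "nsq S f = (\<Sum>x\<in>F. (cmod (f x))\<^sup>2)"
proof -
  have "((\<lambda>x. (cmod (f x))\<^sup>2) has_sum (\<Sum>x\<in>F. (cmod (f x))\<^sup>2)) S"
    by (rule has_sum_finite_neutralI) (use assms in auto)
  then show "f \<in> ell2 S" "nsq S f = (\<Sum>x\<in>F. (cmod (f x))\<^sup>2)"
    using assms by (auto simp: ell2_def nsq_def summable_on_def dest: infsumI)
qed

lemma ip_abs_summable:
  assumes "f \<in> ell2 S" "g \<in> ell2 S"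
  shows "(\<lambda>x. norm (cnj (f x) * g x)) summable_on S"
  by (rule abs_summable_product) 
     (use assms in \<open>auto simp: ell2_def norm_mult power2_eq_square\<close>)

lemma ip_summable:
  assumes "f \<in> ell2 S" "g \<in> ell2 S"
  shows "(\<lambda>x. cnj (f x) * g x) summable_on S"
  using ip_abs_summable[OF assms] by (rule abs_summable_summable)

lemma ip_add_right:
  "f \<in> ell2 S \<Longrightarrow> g \<in> ell2 S \<Longrightarrow> h \<in> ell2 S \<Longrightarrow> ip S f (\<lambda>x. g x + h x) = ip S f g + ip S f h"
  by (simp add: ip_def ring_distribs infsum_add ip_summable)

lemma ip_scale_right: "ip S f (\<lambda>x. c * g x) = c * ip S f g"
proof -
  have "(\<lambda>x. cnj (f x) * (c * g x)) = (\<lambda>x. c * (cnj (f x) * g x))" by (auto simp: mult_ac)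
  then show ?thesis by (simp add: ip_def infsum_cmult_right')
qed

lemma ip_commute: "ip S f g = cnj (ip S g f)"
  unfolding ip_def by (subst infsum_cnj[symmetric]) (simp add: mult.commute)

lemma ip_add_left:
  "f \<in> ell2 S \<Longrightarrow> g \<in> ell2 S \<Longrightarrow> h \<in> ell2 S \<Longrightarrow> ip S (\<lambda>x. g x + h x) f = ip S g f + ip S h f"
  by (subst (1 2 3) ip_commute) (simp add: ip_add_right)

lemma ip_scale_left: "ip S (\<lambda>x. c * g x) f = cnj c * ip S g f"
  by (subst (1 2) ip_commute) (simp add: ip_scale_right)

lemma ip_zero [simp]: "ip S f (\<lambda>x. 0) = 0" "ip S (\<lambda>x. 0) f = 0"
  by (auto simp: ip_def)

lemma ip_uminus_right: "ip S f (\<lambda>x. - g x) = - ip S f g"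
  using ip_scale_right[of S f "-1" g] by simp

lemma ip_diff_right:
  "f \<in> ell2 S \<Longrightarrow> g \<in> ell2 S \<Longrightarrow> h \<in> ell2 S \<Longrightarrow> ip S f (\<lambda>x. g x - h x) = ip S f g - ip S f h"
  using ip_add_right[of f S g "\<lambda>x. - h x"] by (simp add: ell2_uminus ip_uminus_right)

lemma ip_sum_right:
  "f \<in> ell2 S \<Longrightarrow> (\<And>i. i \<in> I \<Longrightarrow> g i \<in> ell2 S) \<Longrightarrow> 
    ip S f (\<lambda>x. \<Sum>i\<in>I. g i x) = (\<Sum>i\<in>I. ip S f (g i))"
  by (induction I rule: infinite_finite_induct) (auto simp: ip_add_right ell2_sum)

lemma ip_sum_left:
  "f \<in> ell2 S \<Longrightarrow> (\<And>i. i \<in> I \<Longrightarrow> g i \<in> ell2 S) \<Longrightarrow> 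
    ip S (\<lambda>x. \<Sum>i\<in>I. g i x) f = (\<Sum>i\<in>I. ip S (g i) f)"
  by (induction I rule: infinite_finite_induct) (auto simp: ip_add_left ell2_sum)

lemma infsum_of_real_complex: "(\<Sum>\<^sub>\<infinity>x\<in>S. complex_of_real (h x)) = of_real (\<Sum>\<^sub>\<infinity>x\<in>S. h x)"
proof (cases "h summable_on S")
  case True
  show ?thesis by (rule infsumI[OF has_sum_of_real[OF has_sum_infsum[OF True]]])
next
  case False
  then have "\<not> (\<lambda>x. complex_of_real (h x)) summable_on S"
    using summable_on_Re[of "\<lambda>x. complex_of_real (h x)" S] by auto
  then show ?thesis using False by (simp add: infsum_not_exists)
qed

lemma cnj_mult_self: "cnj z * z = of_real ((cmod z)\<^sup>2)" for z :: complex
  by (metis complex_norm_square mult.commute of_real_power)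

lemma mult_cnj_self: "z * cnj z = of_real ((cmod z)\<^sup>2)" for z :: complex
  by (metis complex_norm_square of_real_power)

lemma ip_self: "ip S f f = of_real (nsq S f)"
proof -
  have "ip S f f = (\<Sum>\<^sub>\<infinity>x\<in>S. of_real ((cmod (f x))\<^sup>2))"
    unfolding ip_def by (intro infsum_cong cnj_mult_self)
  then show ?thesis unfolding nsq_def by (simp only: infsum_of_real_complex)
qed

lemma nsq_ip: "nsq S f = Re (ip S f f)"
  by (simp add: ip_self)

lemma nsq_nonneg [simp]: "0 \<le> nsq S f"
  by (auto simp: nsq_def intro!: infsum_nonneg)

lemma nsq_eq_0:
  assumes "f \<in> ell2 S" "nsq S f = 0" shows "f = (\<lambda>x. 0)"
proof
  fix x show "f x = 0"
  proof (cases "x \<in> S")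
    case True
    then have "(cmod (f x))\<^sup>2 = 0"
      using assms nonneg_infsum_le_0D[OF _ ell2_summable[OF assms(1)], of x]
      by (auto simp: nsq_def)
    then show ?thesis by simp
  qed (use ell2_outside[OF assms(1)] in auto)
qed

lemma nsq_zero [simp]: "nsq S (\<lambda>x. 0) = 0"
  by (simp add: nsq_def)

lemma nsq_scale: "nsq S (\<lambda>x. c * f x) = (cmod c)\<^sup>2 * nsq S f"
  by (simp add: nsq_def norm_mult power_mult_distrib infsum_cmult_right')

lemma finite_sum_le_nsq:
  assumes "f \<in> ell2 S" "finite F" "F \<subseteq> S"
  shows "(\<Sum>x\<in>F. (cmod (f x))\<^sup>2) \<le> nsq S f"
  unfolding nsq_def by (rule finite_sum_le_infsum[OF ell2_summable]) (use assms in auto)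

lemma cmod_le_nsq:
  assumes "f \<in> ell2 S" shows "(cmod (f x))\<^sup>2 \<le> nsq S f"
proof (cases "x \<in> S")
  case True then show ?thesis using finite_sum_le_nsq[OF assms, of "{x}"] by auto
qed (use ell2_outside[OF assms] in auto)

lemma nsq_mono_on:
  assumes "g \<in> ell2 S" "f \<in> ell2 S" "\<And>x. x \<in> S \<Longrightarrow> cmod (f x) \<le> cmod (g x)"
  shows "nsq S f \<le> nsq S g"
  unfolding nsq_def using assms by (intro infsum_mono ell2_summable power_mono) auto

lemma ip_Cauchy_Schwarz:
  assumes f: "f \<in> ell2 S" and g: "g \<in> ell2 S"
  shows "(cmod (ip S f g))\<^sup>2 \<le> nsq S f * nsq S g"
proof (cases "nsq S f = 0")
  case True
  then show ?thesis using nsq_eq_0[OF f] by simp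
next
  case False
  define c where "c = ip S f g / of_real (nsq S f)"
  have e: "(\<lambda>x. g x - c * f x) \<in> ell2 S" using assms by (intro ell2_diff ell2_scale)
  have o: "ip S f (\<lambda>x. g x - c * f x) = 0"
  proof -
    have "ip S f (\<lambda>x. g x - c * f x) = ip S f g - c * of_real (nsq S f)"
      by (simp add: ip_diff_right f g ell2_scale ip_scale_right ip_self)
    then show ?thesis using False by (simp add: c_def)
  qed
  have "ip S (\<lambda>x. g x - c * f x) g = ip S (\<lambda>x. g x - c * f x) (\<lambda>x. (g x - c * f x) + c * f x)"
    by simp
  also have "\<dots> = of_real (nsq S (\<lambda>x. g x - c * f x)) + c * ip S (\<lambda>x. g x - c * f x) f"
    by (subst ip_add_right[OF e e ell2_scale[OF f]]) (simp add: ip_scale_right ip_self)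
  also have "ip S (\<lambda>x. g x - c * f x) f = 0"
    by (subst ip_commute) (simp add: o)
  finally have 1: "ip S g (\<lambda>x. g x - c * f x) = of_real (nsq S (\<lambda>x. g x - c * f x))"
    by (subst ip_commute) simp
  have "ip S g (\<lambda>x. g x - c * f x) = of_real (nsq S g) - c * ip S g f"
    by (simp add: ip_diff_right f g ell2_scale ip_scale_right ip_self)
  also have "c * ip S g f = of_real ((cmod (ip S f g))\<^sup>2 / nsq S f)"
  proof -
    have "z * cnj z = of_real ((cmod z)\<^sup>2)" for z
      by (metis complex_norm_square of_real_power)
    then show ?thesis by (subst ip_commute[of S g f]) (simp add: c_def)
  qed
  finally have "of_real (nsq S g - (cmod (ip S f g))\<^sup>2 / nsq S f) = (of_real (nsq S (\<lambda>x. g x - c * f x)) :: complex)"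
    using 1 by simp
  then have "nsq S g - (cmod (ip S f g))\<^sup>2 / nsq S f = nsq S (\<lambda>x. g x - c * f x)"
    by (simp only: of_real_eq_iff)
  then have "(cmod (ip S f g))\<^sup>2 / nsq S f \<le> nsq S g"
    using nsq_nonneg[of S "\<lambda>x. g x - c * f x"] by linarith
  moreover have "0 < nsq S f" using False nsq_nonneg[of S f] by linarith
  ultimately show ?thesis by (simp add: field_simps)
qed

lemma ip_Cauchy_Schwarz':
  assumes f: "f \<in> ell2 S" and g: "g \<in> ell2 S"
  shows "cmod (ip S f g) \<le> sqrt (nsq S f) * sqrt (nsq S g)"
  using real_sqrt_le_mono[OF ip_Cauchy_Schwarz[OF assms]] by (simp add: real_sqrt_mult)

lemma delta_ell2 [simp]: "x \<in> S \<Longrightarrow> delta x \<in> ell2 S"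
  by (rule ell2_finite_support[of "{x}"]) (auto simp: delta_def)

lemma infsum_finite_support:
  assumes "finite F" "F \<subseteq> S" "\<And>x. x \<in> S - F \<Longrightarrow> h x = 0"
  shows "infsum h S = sum h F"
proof -
  have "infsum h S = infsum h F" by (rule infsum_cong_neutral) (use assms in auto)
  then show ?thesis using assms by simp
qed

lemma ip_delta_left [simp]: "x \<in> S \<Longrightarrow> ip S (delta x) f = f x"
  unfolding ip_def by (subst infsum_finite_support[of "{x}"]) (auto simp: delta_def)

lemma ip_delta_right [simp]: "x \<in> S \<Longrightarrow> ip S f (delta x) = cnj (f x)"
  by (subst ip_commute) simp

lemma nsq_delta [simp]: "x \<in> S \<Longrightarrow> nsq S (delta x) = 1"
  by (subst ell2_finite_support(2)[of "{x}"]) (auto simp: delta_def)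

lemma ell2_truncate:
  assumes f: "f \<in> ell2 S" and e: "0 < e"
  obtains F where "finite F" "F \<subseteq> S" "(\<lambda>x. if x \<in> F then 0 else f x) \<in> ell2 S"
    "nsq S (\<lambda>x. if x \<in> F then 0 else f x) < e"
proof -
  obtain F where F: "finite F" "F \<subseteq> S" "nsq S f - e < (\<Sum>x\<in>F. (cmod (f x))\<^sup>2)"
  proof -
    have "\<not> (\<forall>F. finite F \<and> F \<subseteq> S \<longrightarrow> (\<Sum>x\<in>F. (cmod (f x))\<^sup>2) \<le> nsq S f - e)"
      using ell2_bounded_sums(2)[of S f "nsq S f - e"] ell2_outside[OF f] e by fastforce
    then show ?thesis using that by force
  qed
  let ?g = "\<lambda>x. if x \<in> F then 0 else f x"
  have g: "?g \<in> ell2 S" by (rule ell2_comparison[OF f]) (use ell2_outside[OF f] in auto)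
  have "nsq S f = (\<Sum>\<^sub>\<infinity>x\<in>F. (cmod (f x))\<^sup>2) + (\<Sum>\<^sub>\<infinity>x\<in>S - F. (cmod (f x))\<^sup>2)"
    unfolding nsq_def using ell2_summable[OF f] F
    by (subst infsum_Un_disjoint[symmetric])
       (auto simp: Un_absorb1 intro: summable_on_subset_banach)
  also have "(\<Sum>\<^sub>\<infinity>x\<in>S - F. (cmod (f x))\<^sup>2) = nsq S ?g"
    unfolding nsq_def by (rule infsum_cong_neutral) (use F in auto)
  finally have "nsq S ?g < e" using F by simp
  then show ?thesis using that F g by blast
qed

text \<open>
  Finitely supported families are dense: up to a remainder of small norm, which contributes little
  by boundedness, every family is a finite combination of the \<open>delta x\<close>.
\<close>

lemma ell2_functional_eq_0:
  assumes add: "\<And>f g. f \<in> ell2 S \<Longrightarrow> g \<in> ell2 S \<Longrightarrow> \<phi> (\<lambda>x. f x + g x) = \<phi> f + \<phi> g"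
    and scale: "\<And>c f. f \<in> ell2 S \<Longrightarrow> \<phi> (\<lambda>x. c * f x) = c * \<phi> f"
    and bound: "\<And>f. f \<in> ell2 S \<Longrightarrow> cmod (\<phi> f) \<le> C * sqrt (nsq S f)"
    and basis: "\<And>x. x \<in> S \<Longrightarrow> \<phi> (delta x) = (0::complex)"
    and f: "f \<in> ell2 S"
  shows "\<phi> f = 0"
proof (rule ccontr)
  assume "\<phi> f \<noteq> 0"
  define D where "D = max C 1"
  have D: "0 < D" "cmod (\<phi> h) \<le> D * sqrt (nsq S h)" if "h \<in> ell2 S" for h
    using bound[OF that] mult_right_mono[of C D "sqrt (nsq S h)"] by (auto simp: D_def)
  define e where "e = (cmod (\<phi> f) / D)\<^sup>2"
  have "0 < e" using \<open>\<phi> f \<noteq> 0\<close> D(1)[OF f] by (auto simp: e_def)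
  then obtain F where F: "finite F" "F \<subseteq> S" "(\<lambda>x. if x \<in> F then 0 else f x) \<in> ell2 S"
    "nsq S (\<lambda>x. if x \<in> F then 0 else f x) < e" using ell2_truncate[OF f] by metis
  let ?g = "\<lambda>x. if x \<in> F then 0 else f x"
  have sum0: "finite G \<Longrightarrow> G \<subseteq> S \<Longrightarrow> \<phi> (\<lambda>x. \<Sum>y\<in>G. f y * delta y x) = 0" for G
  proof (induction G rule: finite_induct)
    case empty
    show ?case using scale[of "\<lambda>x. 0" 0] by simp
  next
    case (insert y G)
    have "\<phi> (\<lambda>x. f y * delta y x + (\<Sum>y\<in>G. f y * delta y x)) = 0"
      using insert by (subst add) (auto intro!: ell2_scale ell2_sum simp: scale basis)
    then show ?case using insert by simp
  qed
  have "f = (\<lambda>x. (\<Sum>y\<in>F. f y * delta y x) + ?g x)"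
    using F by (auto simp: fun_eq_iff delta_def if_distrib[of "\<lambda>z. _ * z"] cong: if_cong)
  then have "\<phi> f = \<phi> (\<lambda>x. (\<Sum>y\<in>F. f y * delta y x) + ?g x)" by simp
  also have "\<dots> = \<phi> ?g"
    using F by (subst add) (auto intro!: ell2_scale ell2_sum simp: sum0)
  finally have "cmod (\<phi> f) \<le> D * sqrt (nsq S ?g)" using D(2)[OF F(3)] by simp
  also have "\<dots> < D * sqrt e" using F(4) D(1)[OF f] by simp
  also have "\<dots> = cmod (\<phi> f)" using D(1)[OF f] by (simp add: e_def)
  finally show False by simp
qed

definition orthonormal_family :: "'x set \<Rightarrow> 'y set \<Rightarrow> ('y \<Rightarrow> 'x \<Rightarrow> complex) \<Rightarrow> bool" where
  "orthonormal_family X Y e \<longleftrightarrow> (\<forall>y\<in>Y. e y \<in> ell2 X) \<and>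
     (\<forall>y\<in>Y. \<forall>z\<in>Y. ip X (e y) (e z) = (if y = z then 1 else 0))"

lemma Bessel:
  assumes e: "orthonormal_family X Y e" and f: "f \<in> ell2 X" and Y: "finite G" "G \<subseteq> Y"
  shows "(\<Sum>y\<in>G. (cmod (ip X (e y) f))\<^sup>2) \<le> nsq X f"
proof -
  let ?c = "\<lambda>y. ip X (e y) f"
  let ?p = "\<lambda>x. \<Sum>y\<in>G. ?c y * e y x"
  have eG: "e y \<in> ell2 X" if "y \<in> G" for y using e Y that by (auto simp: orthonormal_family_def)
  have p: "?p \<in> ell2 X" by (intro ell2_sum ell2_scale eG)
  have ep: "ip X (e y) ?p = ?c y" if "y \<in> G" for y
  proof -
    have "ip X (e y) ?p = (\<Sum>z\<in>G. ?c z * ip X (e y) (e z))"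
      using that by (subst ip_sum_right) (auto intro: ell2_scale eG simp: ip_scale_right)
    also have "\<dots> = (\<Sum>z\<in>G. if z = y then ?c y else 0)"
    proof (rule sum.cong)
      fix z assume "z \<in> G"
      then have "y \<in> Y" "z \<in> Y" using Y that by auto
      then show "?c z * ip X (e y) (e z) = (if z = y then ?c y else 0)"
        using e by (auto simp: orthonormal_family_def)
    qed simp
    finally show ?thesis using Y that by simp
  qed
  note sq = cnj_mult_self
  have pg: "ip X ?p g = (\<Sum>y\<in>G. cnj (?c y) * ip X (e y) g)" if "g \<in> ell2 X" for g
    using that by (subst ip_sum_left) (auto intro: ell2_scale eG simp: ip_scale_left)
  have pf: "ip X ?p f = of_real (\<Sum>y\<in>G. (cmod (?c y))\<^sup>2)"
    by (simp only: pg[OF f] sq of_real_sum)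
  have "ip X ?p ?p = (\<Sum>y\<in>G. cnj (?c y) * ?c y)"
    unfolding pg[OF p] by (intro sum.cong refl) (simp only: ep)
  then have "ip X ?p ?p = of_real (\<Sum>y\<in>G. (cmod (?c y))\<^sup>2)"
    by (simp only: sq of_real_sum)
  then have pp: "nsq X ?p = (\<Sum>y\<in>G. (cmod (?c y))\<^sup>2)"
    unfolding ip_self of_real_eq_iff .
  have "(nsq X ?p)\<^sup>2 \<le> nsq X ?p * nsq X f"
    using ip_Cauchy_Schwarz[OF p f] unfolding pf pp norm_of_real by simp
  then have "nsq X ?p \<le> nsq X f"
    using nsq_nonneg[of X ?p] nsq_nonneg[of X f]
    by (cases "nsq X ?p = 0") (auto simp: power2_eq_square mult_le_cancel_left)
  then show ?thesis unfolding pp .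
qed

lemma Bessel_infinite:
  assumes e: "orthonormal_family X Y e" and f: "f \<in> ell2 X"
  shows "(\<lambda>y. if y \<in> Y then ip X (e y) f else 0) \<in> ell2 Y" 
    and "nsq Y (\<lambda>y. if y \<in> Y then ip X (e y) f else 0) \<le> nsq X f"
proof -
  have *: "(\<Sum>y\<in>G. (cmod (if y \<in> Y then ip X (e y) f else 0))\<^sup>2) \<le> nsq X f" if "finite G" "G \<subseteq> Y" for G
  proof -
    have "(\<Sum>y\<in>G. (cmod (if y \<in> Y then ip X (e y) f else 0))\<^sup>2) = (\<Sum>y\<in>G. (cmod (ip X (e y) f))\<^sup>2)"
      by (rule sum.cong) (use that in auto)
    then show ?thesis using Bessel[OF e f that] by simp
  qed
  show "(\<lambda>y. if y \<in> Y then ip X (e y) f else 0) \<in> ell2 Y" 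
    "nsq Y (\<lambda>y. if y \<in> Y then ip X (e y) f else 0) \<le> nsq X f"
    using ell2_bounded_sums[of Y "\<lambda>y. if y \<in> Y then ip X (e y) f else 0", OF _ *] by auto
qed

text \<open>
  The vector with coefficients \<open>c\<close> along the family \<open>e\<close>.  The sum is taken pointwise, so that no
  convergence of vectors is involved.  For orthonormal \<open>e\<close>, the function \<open>(x, y) \<mapsto> e y x\<close> acts as
  the kernel of an isometry, and two such kernels that are adjoint to each other give a unitary (\<open>synth_inverse\<close>).
\<close>

definition synth :: "'x set \<Rightarrow> 'y set \<Rightarrow> ('y \<Rightarrow> 'x \<Rightarrow> complex) \<Rightarrow> ('y \<Rightarrow> complex) \<Rightarrow> 'x \<Rightarrow> complex" where
  "synth X Y e c = (\<lambda>x. if x \<in> X then \<Sum>\<^sub>\<infinity>y\<in>Y. c y * e y x else 0)"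

context
  fixes X :: "'x set" and Y :: "'y set" and e
  assumes e: "orthonormal_family X Y e"
begin

lemma synth_rows: "x \<in> X \<Longrightarrow> (\<lambda>y. if y \<in> Y then cnj (e y x) else 0) \<in> ell2 Y"
  using Bessel_infinite(1)[OF e, of "delta x"] by (auto cong: if_cong)

lemma synth_eq_ip: "x \<in> X \<Longrightarrow> synth X Y e c x = ip Y (\<lambda>y. if y \<in> Y then cnj (e y x) else 0) c"
  unfolding synth_def ip_def by (auto intro!: infsum_cong)

text \<open>
  By duality with Bessel's inequality: the restriction \<open>g\<close> of the synthesized vector to a finite set
  satisfies \<open>nsq g = \<langle>g, synth c\<rangle>\<close>, which pairs \<open>c\<close> with the coefficients of \<open>g\<close>.
\<close>

lemma synth_contraction:
  assumes c: "c \<in> ell2 Y"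
  shows "synth X Y e c \<in> ell2 X" "nsq X (synth X Y e c) \<le> nsq Y c"
proof -
  let ?s = "synth X Y e c"
  have *: "(\<Sum>x\<in>F. (cmod (?s x))\<^sup>2) \<le> nsq Y c" if F: "finite F" "F \<subseteq> X" for F
  proof -
    define g where "g = (\<lambda>x. if x \<in> F then ?s x else 0)"
    define t where "t = (\<Sum>x\<in>F. (cmod (?s x))\<^sup>2)"
    have g: "g \<in> ell2 X" "nsq X g = t"
      using ell2_finite_support[OF F, of g] by (auto simp: g_def t_def)
    let ?b = "\<lambda>y. if y \<in> Y then ip X (e y) g else 0"
    have b: "?b \<in> ell2 Y" "nsq Y ?b \<le> t" using Bessel_infinite[OF e g(1)] g by auto
    note sq = cnj_mult_self[symmetric]
    have "of_real t = (\<Sum>x\<in>F. cnj (?s x) * ip Y (\<lambda>y. if y \<in> Y then cnj (e y x) else 0) c)"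
      using F synth_eq_ip[of _ c] by (auto simp: t_def sq simp del: of_real_power intro!: sum.cong)
    also have "\<dots> = (\<Sum>x\<in>F. ip Y (\<lambda>y. ?s x * (if y \<in> Y then cnj (e y x) else 0)) c)"
      by (simp add: ip_scale_left)
    also have "\<dots> = ip Y (\<lambda>y. \<Sum>x\<in>F. ?s x * (if y \<in> Y then cnj (e y x) else 0)) c"
      using F by (subst ip_sum_left) (auto intro!: ell2_scale synth_rows c)
    also have "(\<lambda>y. \<Sum>x\<in>F. ?s x * (if y \<in> Y then cnj (e y x) else 0)) = ?b"
    proof
      fix y
      have "ip X (e y) g = (\<Sum>x\<in>F. ?s x * cnj (e y x))"
        unfolding ip_def using F
        by (subst infsum_finite_support[of F]) (auto simp: g_def mult.commute intro!: sum.cong)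
      then show "(\<Sum>x\<in>F. ?s x * (if y \<in> Y then cnj (e y x) else 0)) = ?b y" by auto
    qed
    finally have "cmod (of_real t) \<le> sqrt (nsq Y ?b) * sqrt (nsq Y c)"
      using ip_Cauchy_Schwarz'[OF b(1) c] by simp
    moreover have "0 \<le> t" by (auto simp: t_def intro: sum_nonneg)
    ultimately have le: "t \<le> sqrt t * sqrt (nsq Y c)"
      using mult_right_mono[OF real_sqrt_le_mono[OF b(2)], of "sqrt (nsq Y c)"] by simp
    show ?thesis unfolding t_def[symmetric]
    proof (cases "t = 0")
      case False
      then have "sqrt t * sqrt t \<le> sqrt t * sqrt (nsq Y c)"
        using le \<open>0 \<le> t\<close> by simp
      then have "sqrt t \<le> sqrt (nsq Y c)"
        using False \<open>0 \<le> t\<close> by (simp only: mult_le_cancel_left_pos real_sqrt_gt_0_iff)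
      then show "t \<le> nsq Y c" by simp
    qed simp
  qed
  show "?s \<in> ell2 X" "nsq X ?s \<le> nsq Y c"
    using ell2_bounded_sums[of X ?s, OF _ *] by (auto simp: synth_def)
qed

lemma synth_add:
  assumes "c \<in> ell2 Y" "d \<in> ell2 Y"
  shows "synth X Y e (\<lambda>y. c y + d y) = (\<lambda>x. synth X Y e c x + synth X Y e d x)"
proof
  fix x show "synth X Y e (\<lambda>y. c y + d y) x = synth X Y e c x + synth X Y e d x"
  proof (cases "x \<in> X")
    case True
    then show ?thesis using assms by (simp add: synth_eq_ip ip_add_right synth_rows)
  qed (auto simp: synth_def)
qed

lemma synth_scale: "synth X Y e (\<lambda>y. k * c y) = (\<lambda>x. k * synth X Y e c x)"
proof
  fix x show "synth X Y e (\<lambda>y. k * c y) x = k * synth X Y e c x"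
    by (cases "x \<in> X") (simp_all add: synth_eq_ip ip_scale_right, simp add: synth_def)
qed

lemma synth_delta:
  assumes "y \<in> Y" shows "synth X Y e (delta y) = e y"
proof
  fix x show "synth X Y e (delta y) x = e y x"
  proof (cases "x \<in> X")
    case False
    then show ?thesis using assms e by (auto simp: orthonormal_family_def synth_def ell2_outside)
  qed (use assms in \<open>simp add: synth_eq_ip\<close>)
qed

text \<open>
  Both sides are bounded linear functionals of \<open>c\<close> and agree on the canonical basis.
\<close>

lemma ip_synth_right:
  assumes f: "f \<in> ell2 X" and c: "c \<in> ell2 Y"
  shows "ip X f (synth X Y e c) = ip Y (\<lambda>y. if y \<in> Y then ip X (e y) f else 0) c"
proof -
  let ?b = "\<lambda>y. if y \<in> Y then ip X (e y) f else 0"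
  have b: "?b \<in> ell2 Y" by (rule Bessel_infinite[OF e f])
  let ?\<phi> = "\<lambda>c. ip X f (synth X Y e c) - ip Y ?b c"
  have "?\<phi> c = 0"
  proof (rule ell2_functional_eq_0[where C = "sqrt (nsq X f) + sqrt (nsq Y ?b)", OF _ _ _ _ c])
    fix d assume d: "d \<in> ell2 Y"
    have "cmod (?\<phi> d) \<le> cmod (ip X f (synth X Y e d)) + cmod (ip Y ?b d)"
      by (rule norm_triangle_ineq4)
    also have "cmod (ip X f (synth X Y e d)) \<le> sqrt (nsq X f) * sqrt (nsq X (synth X Y e d))"
      by (rule ip_Cauchy_Schwarz'[OF f synth_contraction(1)[OF d]])
    also have "\<dots> \<le> sqrt (nsq X f) * sqrt (nsq Y d)"
      by (intro mult_left_mono) (auto simp: synth_contraction d)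
    also have "cmod (ip Y ?b d) \<le> sqrt (nsq Y ?b) * sqrt (nsq Y d)"
      by (rule ip_Cauchy_Schwarz'[OF b d])
    finally show "cmod (?\<phi> d) \<le> (sqrt (nsq X f) + sqrt (nsq Y ?b)) * sqrt (nsq Y d)"
      by (simp add: algebra_simps)
  next
    fix y assume y: "y \<in> Y"
    have "ip Y ?b (delta y) = cnj (?b y)" using y by (rule ip_delta_right)
    then show "?\<phi> (delta y) = 0" using y by (simp add: synth_delta ip_commute[of X f])
  qed (simp_all add: synth_add synth_scale ip_add_right ip_scale_right f b synth_contraction algebra_simps)
  then show ?thesis by simp
qed

lemma ip_synth_basis:
  assumes "y \<in> Y" "c \<in> ell2 Y" shows "ip X (e y) (synth X Y e c) = c y"
proof -
  have "ip X (e y) (synth X Y e c) = ip Y (\<lambda>z. if z \<in> Y then ip X (e z) (e y) else 0) c"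
    using assms e by (intro ip_synth_right) (auto simp: orthonormal_family_def)
  also have "(\<lambda>z. if z \<in> Y then ip X (e z) (e y) else 0) = delta y"
    using assms e by (auto simp: orthonormal_family_def delta_def)
  finally show ?thesis using assms by simp
qed

lemma synth_isometry:
  assumes "c \<in> ell2 Y" "d \<in> ell2 Y"
  shows "ip X (synth X Y e c) (synth X Y e d) = ip Y c d"
proof -
  have "ip X (synth X Y e c) (synth X Y e d)
      = ip Y (\<lambda>y. if y \<in> Y then ip X (e y) (synth X Y e c) else 0) d"
    using assms by (intro ip_synth_right synth_contraction)
  also have "(\<lambda>y. if y \<in> Y then ip X (e y) (synth X Y e c) else 0) = c"
    using assms ell2_outside[OF assms(1)] by (auto simp: ip_synth_basis)
  finally show ?thesis .
qed

end

text \<open>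
  The limit exists pointwise, and the bounds on finite partial sums pass to the limit.
\<close>

lemma ell2_complete:
  fixes s :: "nat \<Rightarrow> 'x \<Rightarrow> complex"
  assumes s: "\<And>n. s n \<in> ell2 S"
    and cau: "\<And>\<epsilon>. 0 < \<epsilon> \<Longrightarrow> \<exists>N. \<forall>m\<ge>N. \<forall>n\<ge>N. nsq S (\<lambda>x. s m x - s n x) < \<epsilon>"
  obtains f where "f \<in> ell2 S" "\<And>\<epsilon>. 0 < \<epsilon> \<Longrightarrow> \<exists>N. \<forall>n\<ge>N. nsq S (\<lambda>x. s n x - f x) < \<epsilon>"
proof -
  have pw: "Cauchy (\<lambda>n. s n x)" for x
  proof (rule metric_CauchyI)
    fix \<epsilon> :: real assume "0 < \<epsilon>"
    then obtain N where N: "\<forall>m\<ge>N. \<forall>n\<ge>N. nsq S (\<lambda>x. s m x - s n x) < \<epsilon>\<^sup>2"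
      using cau[of "\<epsilon>\<^sup>2"] by auto
    have "dist (s m x) (s n x) < \<epsilon>" if "m \<ge> N" "n \<ge> N" for m n
    proof -
      have "(cmod (s m x - s n x))\<^sup>2 < \<epsilon>\<^sup>2"
        using cmod_le_nsq[OF ell2_diff[OF s s]] N[rule_format, OF that] by (rule le_less_trans)
      then show ?thesis using \<open>0 < \<epsilon>\<close> by (simp add: dist_norm power2_less_imp_less)
    qed
    then show "\<exists>M. \<forall>m\<ge>M. \<forall>n\<ge>M. dist (s m x) (s n x) < \<epsilon>" by blast
  qed
  have "\<exists>l. (\<lambda>n. s n x) \<longlonglongrightarrow> l" for x
    using pw by (simp add: Cauchy_convergent_iff convergent_def)
  then obtain f where f: "\<And>x. (\<lambda>n. s n x) \<longlonglongrightarrow> f x" by metis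
  have f0: "f x = 0" if "x \<notin> S" for x
    using f[of x] ell2_outside[OF s that] by (simp add: LIMSEQ_const_iff)
  have lim: "(\<lambda>x. s n x - f x) \<in> ell2 S \<and> nsq S (\<lambda>x. s n x - f x) \<le> \<epsilon>"
    if b: "\<forall>m\<ge>N. \<forall>n\<ge>N. nsq S (\<lambda>x. s m x - s n x) < \<epsilon>" and nN: "n \<ge> N" for N n \<epsilon>
  proof -
    have "(\<Sum>x\<in>F. (cmod (s n x - f x))\<^sup>2) \<le> \<epsilon>" if F: "finite F" "F \<subseteq> S" for F
    proof (rule LIMSEQ_le_const2)
      show "(\<lambda>m. \<Sum>x\<in>F. (cmod (s n x - s m x))\<^sup>2) \<longlonglongrightarrow> (\<Sum>x\<in>F. (cmod (s n x - f x))\<^sup>2)"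
        by (intro tendsto_intros f)
      show "\<exists>N. \<forall>m\<ge>N. (\<Sum>x\<in>F. (cmod (s n x - s m x))\<^sup>2) \<le> \<epsilon>"
      proof (intro exI allI impI)
        fix m assume m: "N \<le> m"
        have "nsq S (\<lambda>x. s n x - s m x) < \<epsilon>" using b nN m by blast
        then show "(\<Sum>x\<in>F. (cmod (s n x - s m x))\<^sup>2) \<le> \<epsilon>"
          using finite_sum_le_nsq[OF ell2_diff[OF s s] F, of n m] by linarith
      qed
    qed
    then show ?thesis
      using ell2_bounded_sums[of S "\<lambda>x. s n x - f x" \<epsilon>] f0 ell2_outside[OF s] by auto
  qed
  obtain N where N: "\<forall>m\<ge>N. \<forall>n\<ge>N. nsq S (\<lambda>x. s m x - s n x) < 1" using cau[of 1] by auto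
  have "f \<in> ell2 S" using ell2_diff[OF s[of N] conjunct1[OF lim[OF N order_refl]]] by simp
  moreover have "\<exists>N. \<forall>n\<ge>N. nsq S (\<lambda>x. s n x - f x) < \<epsilon>" if "0 < \<epsilon>" for \<epsilon>
  proof -
    from cau[OF half_gt_zero[OF that]] obtain N 
      where N: "\<forall>m\<ge>N. \<forall>n\<ge>N. nsq S (\<lambda>x. s m x - s n x) < \<epsilon> / 2" ..
    have "nsq S (\<lambda>x. s n x - f x) < \<epsilon>" if "n \<ge> N" for n
      using conjunct2[OF lim[OF N that]] \<open>0 < \<epsilon>\<close> by linarith
    then show ?thesis by blast
  qed
  ultimately show ?thesis using that by blast
qed

section \<open>Diagonalization of Hermitian matrices\<close>

definition herm_form :: "'i set \<Rightarrow> ('i \<Rightarrow> 'i \<Rightarrow> complex) \<Rightarrow> ('i \<Rightarrow> complex) \<Rightarrow> ('i \<Rightarrow> complex) \<Rightarrow> complex" where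
  "herm_form I G x y = (\<Sum>i\<in>I. \<Sum>j\<in>I. cnj (x i) * G i j * y j)"

text \<open>
  The columns of \<open>U\<close> diagonalize the form \<open>G\<close>.  Orthonormality of the rows is the part of unitarity
  that keeps \<open>\<Sum>\<^sub>i |v\<^sub>i\<rangle>\<langle>v\<^sub>i|\<close> unchanged when the vectors are mixed by \<open>U\<close>.
\<close>

definition diagonalizes :: 
    "'i set \<Rightarrow> ('i \<Rightarrow> 'i \<Rightarrow> complex) \<Rightarrow> ('i \<Rightarrow> 'i \<Rightarrow> complex) \<Rightarrow> ('i \<Rightarrow> real) \<Rightarrow> bool" where
  "diagonalizes I G U p \<longleftrightarrow> 
     (\<forall>i\<in>I. \<forall>k\<in>I. (\<Sum>j\<in>I. U i j * cnj (U k j)) = (if i = k then 1 else 0)) \<and>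
     (\<forall>j\<in>I. \<forall>k\<in>I. herm_form I G (\<lambda>i. U i j) (\<lambda>i. U i k) = (if j = k then of_real (p j) else 0))"

lemma herm_form_add_right: "herm_form I G x (\<lambda>i. y i + z i) = herm_form I G x y + herm_form I G x z"
  by (simp add: herm_form_def algebra_simps sum.distrib)

lemma herm_form_add_left: "herm_form I G (\<lambda>i. y i + z i) x = herm_form I G y x + herm_form I G z x"
  by (simp add: herm_form_def algebra_simps sum.distrib)

lemma herm_form_scale_right: "herm_form I G x (\<lambda>i. c * y i) = c * herm_form I G x y"
  by (simp add: herm_form_def sum_distrib_left mult_ac)

lemma herm_form_scale_left: "herm_form I G (\<lambda>i. c * y i) x = cnj c * herm_form I G y x"
  by (simp add: herm_form_def sum_distrib_left mult_ac)

lemma herm_form_commute: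
  assumes "\<And>i j. i \<in> I \<Longrightarrow> j \<in> I \<Longrightarrow> G i j = cnj (G j i)"
  shows "herm_form I G x y = cnj (herm_form I G y x)"
proof -
  have "cnj (herm_form I G y x) = (\<Sum>i\<in>I. \<Sum>j\<in>I. y i * cnj (G i j) * cnj (x j))"
    by (simp add: herm_form_def)
  also have "\<dots> = (\<Sum>i\<in>I. \<Sum>j\<in>I. y i * G j i * cnj (x j))"
    by (intro sum.cong refl) (metis assms complex_cnj_cnj)
  also have "\<dots> = (\<Sum>j\<in>I. \<Sum>i\<in>I. y i * G j i * cnj (x j))" by (rule sum.swap)
  also have "\<dots> = herm_form I G x y" by (simp add: herm_form_def mult_ac)
  finally show ?thesis by simp
qed

definition unitaries :: "'i set \<Rightarrow> ('i \<times> 'i \<Rightarrow> complex) set" where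
  "unitaries I = {U. (\<forall>q. q \<notin> I \<times> I \<longrightarrow> U q = 0) \<and>
     (\<forall>i\<in>I. \<forall>k\<in>I. (\<Sum>j\<in>I. U (i, j) * cnj (U (k, j))) = (if i = k then 1 else 0))}"

text \<open>
  A closed subset of a product of discs, because the entries of an orthonormal row are bounded by 1.
\<close>

lemma compact_unitaries:
  assumes "finite I" shows "compact (unitaries I)"
proof -
  let ?P = "Pi\<^sub>E UNIV (\<lambda>q. if q \<in> I \<times> I then cball 0 1 else {0::complex})"
  have "compactin (product_topology (\<lambda>q. euclidean) UNIV) ?P"
    by (subst compactin_PiE) auto
  then have P: "compact ?P" by (simp add: euclidean_product_topology)
  have cont: "continuous_on UNIV (\<lambda>U. \<Sum>j\<in>I. U (i, j) * cnj (U (k, j)))" for i k :: 'i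
    by (intro continuous_intros continuous_on_product_coordinates)
  have "closed {U. (\<Sum>j\<in>I. U (i, j) * cnj (U (k, j))) = (if i = k then 1 else 0)}" for i k :: 'i
    by (intro closed_Collect_eq cont continuous_intros)
  then have cl: "closed (\<Inter>i\<in>I. \<Inter>k\<in>I. {U. (\<Sum>j\<in>I. U (i, j) * cnj (U (k, j))) = (if i = k then 1 else 0)})"
    by (intro closed_INT ballI)
  have "unitaries I = ?P \<inter> (\<Inter>i\<in>I. \<Inter>k\<in>I. {U. (\<Sum>j\<in>I. U (i, j) * cnj (U (k, j))) = (if i = k then 1 else 0)})"
  proof (intro equalityI subsetI)
    fix U assume U: "U \<in> unitaries I"
    have "cmod (U (i, j)) \<le> 1" if "i \<in> I" "j \<in> I" for i j
    proof -
      note sq = mult_cnj_self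
      have "of_real (\<Sum>j\<in>I. (cmod (U (i, j)))\<^sup>2) = (1 :: complex)"
        using U that by (simp add: unitaries_def sq[symmetric] del: of_real_power)
      then have "(\<Sum>j\<in>I. (cmod (U (i, j)))\<^sup>2) = 1" by (simp only: of_real_eq_1_iff)
      moreover have "(cmod (U (i, j)))\<^sup>2 \<le> (\<Sum>j\<in>I. (cmod (U (i, j)))\<^sup>2)"
        using that assms by (intro member_le_sum) auto
      ultimately show ?thesis using abs_square_le_1[of "cmod (U (i, j))"] by simp
    qed
    then show "U \<in> ?P \<inter> (\<Inter>i\<in>I. \<Inter>k\<in>I. {U. (\<Sum>j\<in>I. U (i, j) * cnj (U (k, j))) = (if i = k then 1 else 0)})"
      using U by (auto simp: unitaries_def PiE_def Pi_def)
  next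
    fix U assume U: "U \<in> ?P \<inter> (\<Inter>i\<in>I. \<Inter>k\<in>I. {U. (\<Sum>j\<in>I. U (i, j) * cnj (U (k, j))) = (if i = k then 1 else 0)})"
    have "U q = 0" if "q \<notin> I \<times> I" for q
    proof -
      from U have "U \<in> ?P" by (rule IntD1)
      then have "U q \<in> (if q \<in> I \<times> I then cball 0 1 else {0})" by (rule PiE_mem) simp
      then show ?thesis using that by simp
    qed
    then show "U \<in> unitaries I" using U by (auto simp: unitaries_def)
  qed
  then show ?thesis using compact_Int_closed[OF P cl] by simp
qed

text \<open>
  A variational proof: the diagonal entries of \<open>U\<^sup>*GU\<close> are weighted with distinct numbers \<open>w\<close>, and \<open>U\<close>
  maximizes the weighted sum over the compact set of unitary matrices.  If an entry \<open>z\<close> outside the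
  diagonal were nonzero, then a small rotation of the two columns would increase the sum.
\<close>

lemma Hermitian_diagonalization:
  fixes I :: "'i set"
  assumes I: "finite I" and herm: "\<And>i j. i \<in> I \<Longrightarrow> j \<in> I \<Longrightarrow> G i j = cnj (G j i)"
  obtains U p where "diagonalizes I G U p"
proof -
  let ?Q = "\<lambda>U j k. herm_form I G (\<lambda>i. U (i, j)) (\<lambda>i. U (i, k))"
  obtain w :: "'i \<Rightarrow> nat" where w: "inj_on w I" using finite_imp_inj_to_nat_seg[OF I] by (elim exE conjE) (rule that)
  define \<Phi> where "\<Phi> = (\<lambda>U. \<Sum>j\<in>I. real (w j) * Re (?Q U j j))"
  have coord: "continuous_on (unitaries I) (\<lambda>U. U q)" for q
    by (rule continuous_on_subset[OF continuous_on_product_coordinates subset_UNIV])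
  have "continuous_on (unitaries I) \<Phi>"
    unfolding \<Phi>_def herm_form_def by (intro continuous_intros coord)
  moreover have "unitaries I \<noteq> {}"
  proof -
    let ?D = "\<lambda>(i, j). if i \<in> I \<and> i = j then 1 else 0"
    have "(\<Sum>j\<in>I. ?D (i, j) * cnj (?D (k, j))) = (if i = k then 1 else 0)" if "i \<in> I" "k \<in> I" for i k
    proof -
      have "(\<Sum>j\<in>I. ?D (i, j) * cnj (?D (k, j))) = (\<Sum>j\<in>I. if j = i then if i = k then 1 else 0 else 0)"
        using that by (intro sum.cong) auto
      then show ?thesis using I that by simp
    qed
    moreover have "?D q = 0" if "q \<notin> I \<times> I" for q using that by (cases q) auto
    ultimately have "?D \<in> unitaries I" unfolding unitaries_def by blast
    then show ?thesis by blast
  qed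
  ultimately obtain U where U: "U \<in> unitaries I" and max: "\<And>V. V \<in> unitaries I \<Longrightarrow> \<Phi> V \<le> \<Phi> U"
    using continuous_attains_sup[OF compact_unitaries[OF I], of \<Phi>] by blast
  have real: "?Q V j j = of_real (Re (?Q V j j))" for V j
  proof -
    have "?Q V j j = cnj (?Q V j j)" by (rule herm_form_commute[OF herm])
    then show ?thesis by (simp add: complex_eq_iff)
  qed
  have zero: "?Q U j k = 0" if jk: "j \<in> I" "k \<in> I" "w k < w j" for j k
  proof (rule ccontr)
    define z where "z = ?Q U j k"
    define a b where "a = Re (?Q U j j)" and "b = Re (?Q U k k)"
    assume "?Q U j k \<noteq> 0"
    then have z: "z \<noteq> 0" by (simp add: z_def)
    \<comment> \<open>The phase that makes e * z positive.\<close>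
    define e where "e = cnj z / of_real (cmod z)"
    have e: "e * cnj e = 1" "e * z = of_real (cmod z)" "cnj e * cnj z = of_real (cmod z)"
    proof -
      have "cnj z * z = of_real (cmod z) * of_real (cmod z)"
        using complex_norm_square[of z] by (simp add: power2_eq_square mult.commute)
      then show "e * cnj e = 1" "e * z = of_real (cmod z)" "cnj e * cnj z = of_real (cmod z)"
        using z by (simp_all add: e_def mult.commute[of z "cnj z"])
    qed
    have kj: "?Q U k j = cnj z" unfolding z_def by (rule herm_form_commute[OF herm])
    have ne: "j \<noteq> k" using jk by auto
    \<comment> \<open>The rotation has tangent t; the gain is of first order in t, the loss of second order.\<close>
    define t where "t = cmod z / (\<bar>b - a\<bar> + 1)"
    define c s where "c = 1 / sqrt (1 + t\<^sup>2)" and "s = t / sqrt (1 + t\<^sup>2)"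
    have t: "0 < t" using z by (simp add: t_def)
    have pos: "0 < 1 + t\<^sup>2" by (simp add: add_pos_nonneg)
    have cs: "c\<^sup>2 + s\<^sup>2 = 1" "c * s = t / (1 + t\<^sup>2)" "s\<^sup>2 = t\<^sup>2 / (1 + t\<^sup>2)"
      using pos by (auto simp: c_def s_def power_divide add_divide_distrib[symmetric])
    let ?c = "complex_of_real c" and ?s = "complex_of_real s"
    have cs': "?c * ?c + ?s * ?s = 1" using cs(1) by (metis of_real_1 of_real_add of_real_mult power2_eq_square)
    define V where "V = (\<lambda>(i, l). if l = j then ?c * U (i, j) + (e * ?s) * U (i, k)
       else if l = k then (- cnj e * ?s) * U (i, j) + ?c * U (i, k) else U (i, l))"
    have VU: "V \<in> unitaries I"
    proof -
      have "(\<Sum>l\<in>I. V (i, l) * cnj (V (i', l))) = (\<Sum>l\<in>I. U (i, l) * cnj (U (i', l)))" for i i'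
      proof -
        have split: "sum h I = h j + h k + sum h (I - {j, k})" for h :: "'i \<Rightarrow> complex"
          using I jk ne by (simp add: sum.subset_diff[of "{j, k}" I] add.commute)
        have "V (i, j) * cnj (V (i', j)) + V (i, k) * cnj (V (i', k)) =
          (?c * ?c + (e * cnj e) * (?s * ?s)) * (U (i, j) * cnj (U (i', j))) +
          ((e * cnj e) * (?s * ?s) + ?c * ?c) * (U (i, k) * cnj (U (i', k)))"
          using ne by (simp add: V_def algebra_simps)
        also have "\<dots> = U (i, j) * cnj (U (i', j)) + U (i, k) * cnj (U (i', k))"
          using cs' by (simp add: e add.commute)
        finally show ?thesis
          unfolding split[of "\<lambda>l. V (i, l) * cnj (V (i', l))"] split[of "\<lambda>l. U (i, l) * cnj (U (i', l))"]
          by (auto intro!: arg_cong2[where f = "(+)"] sum.cong simp: V_def)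
      qed
      then show ?thesis using U jk by (auto simp: unitaries_def V_def)
    qed
    have Vj: "(\<lambda>i. V (i, j)) = (\<lambda>i. ?c * U (i, j) + (e * ?s) * U (i, k))"
      by (simp add: V_def)
    have Vk: "(\<lambda>i. V (i, k)) = (\<lambda>i. (- cnj e * ?s) * U (i, j) + ?c * U (i, k))"
      using ne by (simp add: V_def)
    have Qj: "?Q V j j = (?c * ?c) * of_real a + (?s * ?s) * (e * cnj e) * of_real b + ?c * ?s * (e * z + cnj e * cnj z)"
    proof -
      have "?Q V j j = (?c * ?c) * ?Q U j j + (?s * ?s) * (e * cnj e) * ?Q U k k + ?c * ?s * (e * ?Q U j k + cnj e * ?Q U k j)"
        unfolding Vj herm_form_add_left herm_form_add_right herm_form_scale_left herm_form_scale_right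
        by (simp add: distrib_left mult_ac)
      then show ?thesis unfolding kj a_def b_def z_def[symmetric] real[symmetric] .
    qed
    have Qk: "?Q V k k = (?s * ?s) * (e * cnj e) * of_real a + (?c * ?c) * of_real b - ?c * ?s * (e * z + cnj e * cnj z)"
    proof -
      have "?Q V k k = (?s * ?s) * (e * cnj e) * ?Q U j j + (?c * ?c) * ?Q U k k - ?c * ?s * (e * ?Q U j k + cnj e * ?Q U k j)"
        unfolding Vk herm_form_add_left herm_form_add_right herm_form_scale_left herm_form_scale_right
        by (simp add: distrib_left mult_ac)
      then show ?thesis unfolding kj a_def b_def z_def[symmetric] real[symmetric] .
    qed
    have Rj: "Re (?Q V j j) = c\<^sup>2 * a + s\<^sup>2 * b + 2 * (c * s) * cmod z"
      unfolding Qj e by (simp add: power2_eq_square)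
    have Rk: "Re (?Q V k k) = s\<^sup>2 * a + c\<^sup>2 * b - 2 * (c * s) * cmod z"
      unfolding Qk e by (simp add: power2_eq_square)
    have split: "sum h I = h j + h k + sum h (I - {j, k})" for h :: "'i \<Rightarrow> real"
      using I jk ne by (simp add: sum.subset_diff[of "{j, k}" I] add.commute)
    have rest: "(\<Sum>l\<in>I - {j, k}. real (w l) * Re (?Q V l l)) = (\<Sum>l\<in>I - {j, k}. real (w l) * Re (?Q U l l))"
      by (intro sum.cong refl) (auto simp: V_def)
    have "\<Phi> V - \<Phi> U = real (w j) * (Re (?Q V j j) - a) + real (w k) * (Re (?Q V k k) - b)"
      unfolding \<Phi>_def split[of "\<lambda>l. real (w l) * Re (?Q V l l)"] split[of "\<lambda>l. real (w l) * Re (?Q U l l)"] rest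
      by (simp add: a_def b_def algebra_simps)
    also have "Re (?Q V j j) - a = s\<^sup>2 * (b - a) + 2 * (c * s) * cmod z"
    proof -
      have c2: "c\<^sup>2 = 1 - s\<^sup>2" using cs(1) by linarith
      show ?thesis unfolding Rj c2 by (simp add: algebra_simps)
    qed
    also have "Re (?Q V k k) - b = - (s\<^sup>2 * (b - a) + 2 * (c * s) * cmod z)"
    proof -
      have c2: "c\<^sup>2 = 1 - s\<^sup>2" using cs(1) by linarith
      show ?thesis unfolding Rk c2 by (simp add: algebra_simps)
    qed
    finally have "(real (w j) - real (w k)) * (s\<^sup>2 * (b - a) + 2 * (c * s) * cmod z) \<le> 0"
      using max[OF VU] by (simp add: algebra_simps)
    then have "s\<^sup>2 * (b - a) + 2 * (c * s) * cmod z \<le> 0"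
      using jk by (simp add: mult_le_0_iff)
    also have "s\<^sup>2 * (b - a) + 2 * (c * s) * cmod z = (t / (1 + t\<^sup>2)) * (t * (b - a) + 2 * cmod z)"
      unfolding cs by (simp add: algebra_simps power2_eq_square add_divide_distrib diff_divide_distrib)
    finally have "t * (b - a) + 2 * cmod z \<le> 0"
      using t pos by (simp add: mult_le_0_iff divide_le_0_iff)
    moreover have "- cmod z \<le> t * (b - a)"
    proof -
      have "t * \<bar>b - a\<bar> \<le> cmod z"
        unfolding t_def by (simp add: divide_le_eq add_pos_nonneg mult_left_mono)
      moreover have "- (t * \<bar>b - a\<bar>) \<le> t * (b - a)" using t
        mult_left_mono[of "- \<bar>b - a\<bar>" "b - a" t] by simp
      ultimately show ?thesis by linarith
    qed
    moreover have "0 < cmod z" using z by simp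
    ultimately show False by linarith
  qed
  have "diagonalizes I G (\<lambda>i j. U (i, j)) (\<lambda>j. Re (?Q U j j))"
    unfolding diagonalizes_def
  proof (intro conjI ballI)
    fix j k assume jk: "j \<in> I" "k \<in> I"
    show "?Q U j k = (if j = k then complex_of_real (Re (?Q U j j)) else 0)"
    proof (cases "j = k")
      case False
      then have "w j \<noteq> w k" using w jk by (auto simp: inj_on_def)
      then have "?Q U j k = 0"
      proof (cases "w k < w j")
        case False
        then have "?Q U k j = 0" using \<open>w j \<noteq> w k\<close> jk by (intro zero) auto
        then show ?thesis
          by (subst herm_form_commute[OF herm]) simp_all
      qed (use zero jk in auto)
      then show ?thesis using False by simp
    qed (use real in auto)
  qed (use U in \<open>auto simp: unitaries_def\<close>)
  then show ?thesis using that by blast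
qed

lemma diagonalizes_trace:
  assumes I: "finite I" and d: "diagonalizes I G U p"
  shows "of_real (\<Sum>j\<in>I. p j) = (\<Sum>i\<in>I. G i i)"
proof -
  have "of_real (\<Sum>j\<in>I. p j) = (\<Sum>j\<in>I. \<Sum>i\<in>I. \<Sum>k\<in>I. cnj (U i j) * G i k * U k j)"
    using d by (auto simp: diagonalizes_def herm_form_def intro!: sum.cong)
  also have "\<dots> = (\<Sum>i\<in>I. \<Sum>j\<in>I. \<Sum>k\<in>I. cnj (U i j) * G i k * U k j)" by (rule sum.swap)
  also have "\<dots> = (\<Sum>i\<in>I. \<Sum>k\<in>I. \<Sum>j\<in>I. cnj (U i j) * G i k * U k j)" 
    by (rule sum.cong[OF refl], rule sum.swap)
  also have "\<dots> = (\<Sum>i\<in>I. \<Sum>k\<in>I. G i k * (\<Sum>j\<in>I. U k j * cnj (U i j)))"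
    by (simp add: sum_distrib_left mult_ac)
  also have "\<dots> = (\<Sum>i\<in>I. \<Sum>k\<in>I. if k = i then G i i else 0)"
    using d by (intro sum.cong refl) (auto simp: diagonalizes_def)
  also have "\<dots> = (\<Sum>i\<in>I. G i i)" using I by simp
  finally show ?thesis .
qed

lemma diagonalizes_Kronecker:
  assumes I: "finite I" "finite I'" and d: "diagonalizes I G U p" and d': "diagonalizes I' G' U' p'"
  shows "diagonalizes (I \<times> I') (\<lambda>(i, i') (j, j'). G i j * G' i' j')
           (\<lambda>(i, i') (j, j'). U i j * U' i' j') (\<lambda>(i, i'). p i * p' i')"
  unfolding diagonalizes_def
proof (intro conjI ballI)
  let ?U = "\<lambda>(i, i') (j, j'). U i j * U' i' j'"
  let ?G = "\<lambda>(i, i') (j, j'). G i j * G' i' j'"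
  fix q r assume "q \<in> I \<times> I'" "r \<in> I \<times> I'"
  then obtain i i' k k' where q: "q = (i, i')" "r = (k, k')" 
    and i: "i \<in> I" "k \<in> I" "i' \<in> I'" "k' \<in> I'" by auto
  have "(\<Sum>j\<in>I \<times> I'. ?U q j * cnj (?U r j))
     = (\<Sum>j\<in>I. \<Sum>j'\<in>I'. (U i j * cnj (U k j)) * (U' i' j' * cnj (U' k' j')))"
    unfolding sum.cartesian_product' q by (simp add: mult_ac)
  also have "\<dots> = (\<Sum>j\<in>I. U i j * cnj (U k j)) * (\<Sum>j'\<in>I'. U' i' j' * cnj (U' k' j'))"
    by (simp add: sum_product)
  also have "\<dots> = (if q = r then 1 else 0)"
    using d d' i by (auto simp: diagonalizes_def q)
  finally show "(\<Sum>j\<in>I \<times> I'. ?U q j * cnj (?U r j)) = (if q = r then 1 else 0)" .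
  have "herm_form (I \<times> I') ?G (\<lambda>l. ?U l q) (\<lambda>l. ?U l r) =
     (\<Sum>m\<in>I. \<Sum>m'\<in>I'. \<Sum>l\<in>I. \<Sum>l'\<in>I'. (cnj (U m i) * G m l * U l k) * (cnj (U' m' i') * G' m' l' * U' l' k'))"
    unfolding herm_form_def sum.cartesian_product' q by (simp add: mult_ac)
  also have "\<dots> = (\<Sum>m\<in>I. \<Sum>m'\<in>I'. (\<Sum>l\<in>I. cnj (U m i) * G m l * U l k) * (\<Sum>l'\<in>I'. cnj (U' m' i') * G' m' l' * U' l' k'))"
    by (simp add: sum_product)
  also have "\<dots> = herm_form I G (\<lambda>l. U l i) (\<lambda>l. U l k) * herm_form I' G' (\<lambda>l. U' l i') (\<lambda>l. U' l k')"
    by (simp add: herm_form_def sum_product)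
  also have "\<dots> = (if q = r then of_real (p i * p' i') else 0)"
    using d d' i by (auto simp: diagonalizes_def q)
  finally show "herm_form (I \<times> I') ?G (\<lambda>l. ?U l q) (\<lambda>l. ?U l r) =
      (if q = r then of_real (case q of (i, i') \<Rightarrow> p i * p' i') else 0)"
    by (simp add: q)
qed

lemma diagonalizes_reindex:
  assumes b: "bij_betw h I' I" and d: "diagonalizes I G U p"
    and G: "\<And>i j. i \<in> I' \<Longrightarrow> j \<in> I' \<Longrightarrow> G' i j = G (h i) (h j)"
  shows "diagonalizes I' G' (\<lambda>i j. U (h i) (h j)) (\<lambda>j. p (h j))"
  unfolding diagonalizes_def
proof (intro conjI ballI)
  have h: "h i \<in> I" if "i \<in> I'" for i using b that by (auto simp: bij_betw_def)
  have inj: "h i = h k \<longleftrightarrow> i = k" if "i \<in> I'" "k \<in> I'" for i k 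
    using b that by (auto simp: bij_betw_def inj_on_def)
  fix i k assume i: "i \<in> I'" "k \<in> I'"
  show "(\<Sum>j\<in>I'. U (h i) (h j) * cnj (U (h k) (h j))) = (if i = k then 1 else 0)"
    using sum.reindex_bij_betw[OF b, of "\<lambda>j. U (h i) j * cnj (U (h k) j)"] d h inj i
    by (simp add: diagonalizes_def)
  have "herm_form I' G' (\<lambda>j. U (h j) (h i)) (\<lambda>j. U (h j) (h k)) =
    (\<Sum>j\<in>I'. \<Sum>l\<in>I'. cnj (U (h j) (h i)) * G (h j) (h l) * U (h l) (h k))"
    unfolding herm_form_def by (simp add: G cong: sum.cong)
  also have "\<dots> = (\<Sum>j\<in>I'. \<Sum>l\<in>I. cnj (U (h j) (h i)) * G (h j) l * U l (h k))"
    by (intro sum.cong refl sum.reindex_bij_betw[OF b])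
  also have "\<dots> = (\<Sum>j\<in>I. \<Sum>l\<in>I. cnj (U j (h i)) * G j l * U l (h k))"
    by (rule sum.reindex_bij_betw[OF b])
  finally show "herm_form I' G' (\<lambda>j. U (h j) (h i)) (\<lambda>j. U (h j) (h k)) =
     (if i = k then of_real (p (h i)) else 0)"
    using d h inj i by (simp add: diagonalizes_def herm_form_def)
qed

text \<open>
  The logarithm lies below its tangent at \<open>s\<close>, that is \<open>ln p \<le> p/s - 1 + ln s\<close>; averaging over \<open>p\<close> bounds
  the Shannon entropy by the Renyi entropy of order 2.
\<close>

lemma sum_entropy_lower_bound:
  fixes p :: "'j \<Rightarrow> real"
  assumes p: "\<And>j. j \<in> J \<Longrightarrow> 0 \<le> p j" "(\<Sum>j\<in>J. p j) = 1" 
    and s: "0 < s" "(\<Sum>j\<in>J. (p j)\<^sup>2) \<le> s"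
  shows "- ln s \<le> (\<Sum>j\<in>J. - (p j * ln (p j)))"
proof -
  have "p j * ln (p j) \<le> p j * (p j / s - 1 + ln s)" if "j \<in> J" for j
  proof (cases "p j = 0")
    case False
    then have pj: "0 < p j" using p(1)[OF that] by simp
    have "ln (p j / s) \<le> p j / s - 1" using pj s by (intro ln_le_minus_one) auto
    then have "ln (p j) \<le> p j / s - 1 + ln s" using pj s by (simp add: ln_div)
    then show ?thesis using pj by (simp add: mult_left_mono)
  qed simp
  then have "(\<Sum>j\<in>J. p j * ln (p j)) \<le> (\<Sum>j\<in>J. p j * (p j / s - 1 + ln s))" by (rule sum_mono)
  also have "\<dots> = (\<Sum>j\<in>J. (p j)\<^sup>2) / s - (\<Sum>j\<in>J. p j) + ln s * (\<Sum>j\<in>J. p j)"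
    by (simp add: algebra_simps sum.distrib sum_subtractf sum_divide_distrib sum_distrib_left power2_eq_square)
  also have "\<dots> \<le> ln s" using s p(2) by (simp add: divide_le_eq)
  finally show ?thesis by (simp add: sum_negf)
qed

lemma sum_entropy_product:
  fixes p :: "'i \<Rightarrow> real" and q :: "'j \<Rightarrow> real"
  assumes "\<And>i. i \<in> I \<Longrightarrow> 0 \<le> p i" "\<And>j. j \<in> J \<Longrightarrow> 0 \<le> q j" "(\<Sum>i\<in>I. p i) = 1" "(\<Sum>j\<in>J. q j) = 1"
  shows "(\<Sum>(i, j)\<in>I \<times> J. - (p i * q j * ln (p i * q j))) = (\<Sum>i\<in>I. - (p i * ln (p i))) + (\<Sum>j\<in>J. - (q j * ln (q j)))"
proof -
  have "(\<Sum>(i, j)\<in>I \<times> J. - (p i * q j * ln (p i * q j))) = 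
     (\<Sum>i\<in>I. \<Sum>j\<in>J. - (p i * ln (p i)) * q j + p i * - (q j * ln (q j)))"
    unfolding sum.cartesian_product[symmetric]
  proof (intro sum.cong refl)
    fix i j assume "i \<in> I" "j \<in> J"
    then show "- (p i * q j * ln (p i * q j)) = - (p i * ln (p i)) * q j + p i * - (q j * ln (q j))"
      using assms(1)[of i] assms(2)[of j] by (cases "p i = 0"; cases "q j = 0") (auto simp: ln_mult algebra_simps)
  qed
  also have "\<dots> = (\<Sum>i\<in>I. - (p i * ln (p i))) * (\<Sum>j\<in>J. q j) + (\<Sum>i\<in>I. p i) * (\<Sum>j\<in>J. - (q j * ln (q j)))"
    by (simp only: sum.distrib sum_product)
  finally show ?thesis using assms by simp
qed

section \<open>Operators and Kraus maps on square summable families\<close>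

lemma nsq_triangle:
  assumes f: "f \<in> ell2 S" and g: "g \<in> ell2 S"
  shows "sqrt (nsq S (\<lambda>x. f x + g x)) \<le> sqrt (nsq S f) + sqrt (nsq S g)"
proof -
  have "of_real (nsq S (\<lambda>x. f x + g x)) = ip S f f + ip S f g + (ip S g f + ip S g g)"
    unfolding ip_self[symmetric] by (simp add: ip_add_left ip_add_right f g ell2_add)
  then have "nsq S (\<lambda>x. f x + g x) = Re (ip S f f + ip S f g + (ip S g f + ip S g g))"
    by (metis Re_complex_of_real)
  also have "\<dots> = nsq S f + Re (ip S f g) + (Re (ip S f g) + nsq S g)"
    by (simp add: ip_self ip_commute[of S g f])
  also have "\<dots> \<le> nsq S f + 2 * (sqrt (nsq S f) * sqrt (nsq S g)) + nsq S g"
    using complex_Re_le_cmod[of "ip S f g"] ip_Cauchy_Schwarz'[OF f g] by linarith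
  also have "\<dots> = (sqrt (nsq S f) + sqrt (nsq S g))\<^sup>2" by (simp add: power2_sum)
  finally have "sqrt (nsq S (\<lambda>x. f x + g x)) \<le> sqrt ((sqrt (nsq S f) + sqrt (nsq S g))\<^sup>2)"
    by (rule real_sqrt_le_mono)
  then show ?thesis by simp
qed

lemma nsq_uminus: "nsq S (\<lambda>x. - f x) = nsq S f"
  by (simp add: nsq_def)

lemma ell2_eqI:
  assumes "f \<in> ell2 S" "g \<in> ell2 S" "\<And>x. x \<in> S \<Longrightarrow> f x = g x" shows "f = g"
proof
  fix x show "f x = g x" 
    by (cases "x \<in> S") (use assms(3) ell2_outside[OF assms(1)] ell2_outside[OF assms(2)] in auto)
qed

lemma delta_inject: "delta x = delta y \<longleftrightarrow> x = y"
  by (metis delta_def zero_neq_one)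

text \<open>
  The operator \<open>\<Sum>\<^sub>i |v\<^sub>i\<rangle>\<langle>v\<^sub>i|\<close>.  The output of a channel with Kraus operators \<open>A\<^sub>i\<close> at the pure state of
  \<open>\<xi>\<close> has this form with \<open>v\<^sub>i = A\<^sub>i \<xi>\<close>.
\<close>

definition frame_op :: "'x set \<Rightarrow> 'i set \<Rightarrow> ('i \<Rightarrow> 'x \<Rightarrow> complex) \<Rightarrow> ('x \<Rightarrow> complex) \<Rightarrow> ('x \<Rightarrow> complex)" where
  "frame_op S I v = (\<lambda>f\<in>ell2 S. \<lambda>x. \<Sum>i\<in>I. ip S (v i) f * v i x)"

lemma ell2_frame_sum: "(\<And>i. i \<in> I \<Longrightarrow> v i \<in> ell2 S) \<Longrightarrow> (\<lambda>x. \<Sum>i\<in>I. c i * v i x) \<in> ell2 S"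
  by (intro ell2_sum ell2_scale)

text \<open>
  The spaces in the proof are all square summable families on some set, but as records they are
  distinct: the tensor powers come with operations that are prescribed for all functions, and the
  base space is given an addition that differs outside the carrier (\<open>l2_space\<close>).  The locale keeps
  what both have in common.
\<close>

locale ell2_model =
  fixes H :: "('x \<Rightarrow> complex) cinner_space" and S :: "'x set"
  assumes carrier_eq [simp]: "carrier H = ell2 S"
    and zero_eq [simp]: "\<zero>\<^bsub>H\<^esub> = (\<lambda>x. 0)"
    and add_eq: "f \<in> ell2 S \<Longrightarrow> g \<in> ell2 S \<Longrightarrow> f \<oplus>\<^bsub>H\<^esub> g = (\<lambda>x. f x + g x)"
    and smult_eq: "f \<in> ell2 S \<Longrightarrow> c \<odot>\<^bsub>H\<^esub> f = (\<lambda>x. c * f x)"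
    and cinner_eq [simp]: "cinner H f g = ip S f g"
begin

lemma cnorm_eq: "cnorm H f = sqrt (nsq S f)"
  by (simp add: cnorm_def ip_self)

lemma abelian_monoid_H: "abelian_monoid H"
  by (rule abelian_monoidI) (auto simp: add_eq ell2_add add.assoc add.commute)

lemma finsum_eq:
  assumes "finite I" "\<And>i. i \<in> I \<Longrightarrow> f i \<in> ell2 S"
  shows "finsum H f I = (\<lambda>x. \<Sum>i\<in>I. f i x)"
  using assms
proof (induction I rule: finite_induct)
  case empty
  then show ?case by (simp add: abelian_monoid.finsum_empty[OF abelian_monoid_H])
next
  case (insert i I)
  then show ?case
    by (subst abelian_monoid.finsum_insert[OF abelian_monoid_H]) (auto simp: add_eq ell2_sum)
qed

lemma bounded_opsI:
  assumes "\<And>f. f \<in> ell2 S \<Longrightarrow> A f \<in> ell2 S" "A \<in> extensional (ell2 S)"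
    "\<And>f g. f \<in> ell2 S \<Longrightarrow> g \<in> ell2 S \<Longrightarrow> A (\<lambda>x. f x + g x) = (\<lambda>x. A f x + A g x)"
    "\<And>c f. f \<in> ell2 S \<Longrightarrow> A (\<lambda>x. c * f x) = (\<lambda>x. c * A f x)"
    "\<And>f. f \<in> ell2 S \<Longrightarrow> sqrt (nsq S (A f)) \<le> C * sqrt (nsq S f)"
  shows "A \<in> bounded_ops H"
  using assms by (auto simp: bounded_ops_def PiE_def add_eq smult_eq cnorm_eq intro!: exI[of _ C])

lemma bounded_opsD:
  assumes "A \<in> bounded_ops H"
  shows "f \<in> ell2 S \<Longrightarrow> A f \<in> ell2 S" "A \<in> extensional (ell2 S)"
    "f \<in> ell2 S \<Longrightarrow> g \<in> ell2 S \<Longrightarrow> A (\<lambda>x. f x + g x) = (\<lambda>x. A f x + A g x)"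
    "f \<in> ell2 S \<Longrightarrow> A (\<lambda>x. c * f x) = (\<lambda>x. c * A f x)"
    "\<exists>C\<ge>0. \<forall>f\<in>ell2 S. sqrt (nsq S (A f)) \<le> C * sqrt (nsq S f)"
proof -
  note D = assms[unfolded bounded_ops_def PiE_def, simplified]
  show *: "A f \<in> ell2 S" if "f \<in> ell2 S" for f using D that by auto
  show "A \<in> extensional (ell2 S)" using D by auto
  show "A (\<lambda>x. f x + g x) = (\<lambda>x. A f x + A g x)" if "f \<in> ell2 S" "g \<in> ell2 S"
  proof -
    have "A (f \<oplus>\<^bsub>H\<^esub> g) = A f \<oplus>\<^bsub>H\<^esub> A g" using D that by auto
    then show ?thesis using that * by (simp add: add_eq)
  qed
  show "A (\<lambda>x. c * f x) = (\<lambda>x. c * A f x)" if "f \<in> ell2 S"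
  proof -
    have "A (c \<odot>\<^bsub>H\<^esub> f) = c \<odot>\<^bsub>H\<^esub> A f" using D that by auto
    then show ?thesis using that * by (simp add: smult_eq)
  qed
  obtain C where C: "\<forall>f\<in>ell2 S. sqrt (nsq S (A f)) \<le> C * sqrt (nsq S f)"
    using D by (auto simp: cnorm_eq)
  have "sqrt (nsq S (A f)) \<le> max C 0 * sqrt (nsq S f)" if "f \<in> ell2 S" for f
    using C[rule_format, OF that] mult_right_mono[of C "max C 0" "sqrt (nsq S f)"] by simp
  then show "\<exists>C\<ge>0. \<forall>f\<in>ell2 S. sqrt (nsq S (A f)) \<le> C * sqrt (nsq S f)"
    by (intro exI[of _ "max C 0"]) auto
qed

lemma bounded_op_sum:
  assumes A: "A \<in> bounded_ops H" and f: "\<And>i. i \<in> I \<Longrightarrow> f i \<in> ell2 S"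
  shows "A (\<lambda>x. \<Sum>i\<in>I. c i * f i x) = (\<lambda>x. \<Sum>i\<in>I. c i * A (f i) x)"
  using f
proof (induction I rule: infinite_finite_induct)
  case (insert i I)
  have "A (\<lambda>x. c i * f i x + (\<Sum>i\<in>I. c i * f i x)) = (\<lambda>x. c i * A (f i) x + (\<Sum>i\<in>I. c i * A (f i) x))"
    using insert by (subst bounded_opsD(3)[OF A]) (auto intro!: ell2_scale ell2_frame_sum simp: bounded_opsD(4)[OF A])
  then show ?case using insert by simp
qed (use bounded_opsD(4)[OF A, of "\<lambda>x. 0" 0] in simp_all)

text \<open>
  Each coordinate of the difference is a bounded linear functional that vanishes on the canonical
  basis.
\<close>

lemma bounded_ops_eqI:
  assumes A: "A \<in> bounded_ops H" and B: "B \<in> bounded_ops H"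
    and eq: "\<And>s. s \<in> S \<Longrightarrow> A (delta s) = B (delta s)"
  shows "A = B"
proof (rule extensionalityI[OF bounded_opsD(2)[OF A] bounded_opsD(2)[OF B]])
  fix f assume f: "f \<in> ell2 S"
  obtain C where C: "\<forall>f\<in>ell2 S. sqrt (nsq S (A f)) \<le> C * sqrt (nsq S f)"
    using bounded_opsD(5)[OF A] by auto
  obtain D where D: "\<forall>f\<in>ell2 S. sqrt (nsq S (B f)) \<le> D * sqrt (nsq S f)"
    using bounded_opsD(5)[OF B] by auto
  show "A f = B f"
  proof
    fix x
    have "A f x - B f x = 0"
    proof (rule ell2_functional_eq_0[where \<phi> = "\<lambda>f. A f x - B f x" and C = "C + D", OF _ _ _ _ f])
      fix g assume g: "g \<in> ell2 S"
      have "cmod (A g x) \<le> sqrt (nsq S (A g))" "cmod (B g x) \<le> sqrt (nsq S (B g))"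
        by (intro real_le_rsqrt cmod_le_nsq bounded_opsD(1)[OF A g] bounded_opsD(1)[OF B g])+
      then have "cmod (A g x - B g x) \<le> C * sqrt (nsq S g) + D * sqrt (nsq S g)"
        using C[rule_format, OF g] D[rule_format, OF g] norm_triangle_ineq4[of "A g x" "B g x"] by linarith
      then show "cmod (A g x - B g x) \<le> (C + D) * sqrt (nsq S g)" by (simp add: distrib_right)
    qed (simp_all add: bounded_opsD[OF A] bounded_opsD[OF B] eq algebra_simps)
    then show "A f x = B f x" by simp
  qed
qed

text \<open>
  The coordinates of the adjoint are \<open>(A\<^sup>*g)(s) = \<langle>A (delta s), g\<rangle>\<close>.  Applying \<open>A\<close> to the restriction of
  \<open>A\<^sup>*g\<close> to a finite set shows that they are square summable.
\<close>

lemma adjoint_exists: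
  assumes A: "A \<in> bounded_ops H"
  obtains B where "B \<in> bounded_ops H" "\<And>f g. f \<in> ell2 S \<Longrightarrow> g \<in> ell2 S \<Longrightarrow> ip S (A f) g = ip S f (B g)"
proof -
  obtain C where C0: "0 \<le> C" and C: "\<And>f. f \<in> ell2 S \<Longrightarrow> sqrt (nsq S (A f)) \<le> C * sqrt (nsq S f)"
    using bounded_opsD(5)[OF A] by auto
  define B where "B = (\<lambda>g\<in>ell2 S. \<lambda>s. if s \<in> S then ip S (A (delta s)) g else 0)"
  note sq = cnj_mult_self
  have fin: "(\<Sum>s\<in>F. (cmod (ip S (A (delta s)) g))\<^sup>2) \<le> C\<^sup>2 * nsq S g"
    if F: "finite F" "F \<subseteq> S" and g: "g \<in> ell2 S" for F g
  proof -
    let ?c = "\<lambda>s. ip S (A (delta s)) g"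
    define t where "t = (\<Sum>s\<in>F. (cmod (?c s))\<^sup>2)"
    let ?h = "\<lambda>x. \<Sum>s\<in>F. ?c s * delta s x"
    have h_eq: "?h x = (if x \<in> F then ?c x else 0)" for x
      using F by (simp add: delta_def if_distrib[of "\<lambda>z. _ * z"] cong: if_cong)
    have h: "?h \<in> ell2 S" "nsq S ?h = t"
      using ell2_finite_support[OF F, of ?h] unfolding h_eq t_def by auto
    have t0: "0 \<le> t" by (simp add: t_def sum_nonneg)
    then have "t = cmod (of_real t)" by simp
    also have "of_real t = ip S (A ?h) g"
    proof -
      have "A ?h = (\<lambda>x. \<Sum>s\<in>F. ?c s * A (delta s) x)"
        by (rule bounded_op_sum[OF A]) (use F in auto)
      then have "ip S (A ?h) g = ip S (\<lambda>x. \<Sum>s\<in>F. ?c s * A (delta s) x) g" by (rule arg_cong)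
      also have "\<dots> = (\<Sum>s\<in>F. cnj (?c s) * ?c s)"
        using F by (subst ip_sum_left[OF g]) (auto intro!: ell2_scale bounded_opsD(1)[OF A] simp: ip_scale_left)
      finally show ?thesis unfolding t_def sq of_real_sum by (rule sym)
    qed
    also have "cmod (ip S (A ?h) g) \<le> sqrt (nsq S (A ?h)) * sqrt (nsq S g)"
      by (intro ip_Cauchy_Schwarz' bounded_opsD(1)[OF A] h g)
    also have "\<dots> \<le> (C * sqrt t) * sqrt (nsq S g)"
      using C[OF h(1)] h(2) by (intro mult_right_mono) auto
    finally have le: "t \<le> (C * sqrt t) * sqrt (nsq S g)" .
    show ?thesis unfolding t_def[symmetric]
    proof (cases "t = 0")
      case False
      then have "sqrt t * sqrt t \<le> sqrt t * (C * sqrt (nsq S g))" using le t0 by (simp add: mult_ac)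
      then have "sqrt t \<le> C * sqrt (nsq S g)" 
        using False t0 by (simp only: mult_le_cancel_left_pos real_sqrt_gt_0_iff)
      then have "(sqrt t)\<^sup>2 \<le> (C * sqrt (nsq S g))\<^sup>2" using t0 by (intro power_mono) auto
      then show "t \<le> C\<^sup>2 * nsq S g" using t0 by (simp add: power_mult_distrib)
    qed simp
  qed
  have B: "B g \<in> ell2 S" "nsq S (B g) \<le> C\<^sup>2 * nsq S g" if g: "g \<in> ell2 S" for g
  proof -
    have *: "(\<Sum>x\<in>F. (cmod (B g x))\<^sup>2) \<le> C\<^sup>2 * nsq S g" if F: "finite F" "F \<subseteq> S" for F
    proof -
      have "(\<Sum>x\<in>F. (cmod (B g x))\<^sup>2) = (\<Sum>s\<in>F. (cmod (ip S (A (delta s)) g))\<^sup>2)"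
        using F g by (intro sum.cong) (auto simp: B_def)
      then show ?thesis using fin[OF F g] by simp
    qed
    show "B g \<in> ell2 S" "nsq S (B g) \<le> C\<^sup>2 * nsq S g"
      using ell2_bounded_sums[of S "B g", OF _ *] g by (auto simp: B_def)
  qed
  have Bop: "B \<in> bounded_ops H"
  proof (rule bounded_opsI[where C = C])
    fix f g assume fg: "f \<in> ell2 S" "g \<in> ell2 S"
    show "B (\<lambda>x. f x + g x) = (\<lambda>x. B f x + B g x)"
      using fg by (auto simp: B_def ell2_add ip_add_right bounded_opsD(1)[OF A])
  next
    fix c f assume f: "f \<in> ell2 S"
    show "B (\<lambda>x. c * f x) = (\<lambda>x. c * B f x)"
      using f by (auto simp: B_def ell2_scale ip_scale_right)
    show "sqrt (nsq S (B f)) \<le> C * sqrt (nsq S f)"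
      using real_sqrt_le_mono[OF B(2)[OF f]] C0 by (simp add: real_sqrt_mult)
  qed (auto simp: B, auto simp: B_def)
  have "ip S (A f) g = ip S f (B g)" if f: "f \<in> ell2 S" and g: "g \<in> ell2 S" for f g
  proof -
    have "ip S g (A f) - ip S (B g) f = 0"
    proof (rule ell2_functional_eq_0[where \<phi> = "\<lambda>f. ip S g (A f) - ip S (B g) f" and C = "sqrt (nsq S g) * C + sqrt (nsq S (B g))", OF _ _ _ _ f])
      fix h assume h: "h \<in> ell2 S"
      have "cmod (ip S g (A h) - ip S (B g) h) \<le> cmod (ip S g (A h)) + cmod (ip S (B g) h)"
        by (rule norm_triangle_ineq4)
      also have "cmod (ip S g (A h)) \<le> sqrt (nsq S g) * sqrt (nsq S (A h))"
        by (intro ip_Cauchy_Schwarz' g bounded_opsD(1)[OF A h])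
      also have "\<dots> \<le> sqrt (nsq S g) * (C * sqrt (nsq S h))"
        by (intro mult_left_mono C h) auto
      also have "cmod (ip S (B g) h) \<le> sqrt (nsq S (B g)) * sqrt (nsq S h)"
        by (intro ip_Cauchy_Schwarz' B g h)
      finally show "cmod (ip S g (A h) - ip S (B g) h) \<le> (sqrt (nsq S g) * C + sqrt (nsq S (B g))) * sqrt (nsq S h)"
        by (simp add: algebra_simps)
    next
      fix s assume s: "s \<in> S"
      then show "ip S g (A (delta s)) - ip S (B g) (delta s) = 0"
        using g by (simp add: B_def ip_commute[of S g])
    qed (simp_all add: bounded_opsD[OF A] ip_add_right ip_scale_right B g algebra_simps)
    then have "cnj (ip S g (A f)) = cnj (ip S (B g) f)" by simp
    then show ?thesis unfolding ip_commute[symmetric] .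
  qed
  then show ?thesis using that Bop by blast
qed

lemma adjoint_op_eqI:
  assumes B: "B \<in> bounded_ops H" and adj: "\<And>f g. f \<in> ell2 S \<Longrightarrow> g \<in> ell2 S \<Longrightarrow> ip S (A f) g = ip S f (B g)"
  shows "adjoint_op H A = B"
  unfolding adjoint_op_def
proof (rule the_equality)
  show "B \<in> bounded_ops H \<and> (\<forall>x\<in>carrier H. \<forall>y\<in>carrier H. cinner H (A x) y = cinner H x (B y))"
    using B adj by simp
  fix B' assume B': "B' \<in> bounded_ops H \<and> (\<forall>x\<in>carrier H. \<forall>y\<in>carrier H. cinner H (A x) y = cinner H x (B' y))"
  show "B' = B"
  proof (rule extensionalityI[OF bounded_opsD(2) bounded_opsD(2)[OF B]])
    fix g assume g: "g \<in> ell2 S"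
    show "B' g = B g"
    proof (rule ell2_eqI)
      show "B' g \<in> ell2 S" "B g \<in> ell2 S" using B B' g bounded_opsD(1) by auto
      fix s assume s: "s \<in> S"
      have "ip S (delta s) (B' g) = ip S (delta s) (B g)"
        using B' adj[OF delta_ell2[OF s] g] g s by auto
      then show "B' g s = B g s" using s by simp
    qed
  qed (use B' in auto)
qed

lemma adjoint_op:
  assumes A: "A \<in> bounded_ops H"
  shows "adjoint_op H A \<in> bounded_ops H"
    and "f \<in> ell2 S \<Longrightarrow> g \<in> ell2 S \<Longrightarrow> ip S (A f) g = ip S f (adjoint_op H A g)"
proof -
  obtain B where B: "B \<in> bounded_ops H" "\<And>f g. f \<in> ell2 S \<Longrightarrow> g \<in> ell2 S \<Longrightarrow> ip S (A f) g = ip S f (B g)"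
    using adjoint_exists[OF A] by blast
  have "adjoint_op H A = B" by (rule adjoint_op_eqI[OF B])
  then show "adjoint_op H A \<in> bounded_ops H"
    and "f \<in> ell2 S \<Longrightarrow> g \<in> ell2 S \<Longrightarrow> ip S (A f) g = ip S f (adjoint_op H A g)" using B by auto
qed

lemma op_mult_apply: "f \<in> ell2 S \<Longrightarrow> op_mult H A B f = A (B f)"
  by (simp add: op_mult_def compose_eq)

lemma bounded_ops_mult:
  assumes A: "A \<in> bounded_ops H" and B: "B \<in> bounded_ops H"
  shows "op_mult H A B \<in> bounded_ops H"
proof -
  obtain C where C0: "0 \<le> C" and C: "\<And>f. f \<in> ell2 S \<Longrightarrow> sqrt (nsq S (A f)) \<le> C * sqrt (nsq S f)"
    using bounded_opsD(5)[OF A] by auto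
  obtain D where D: "\<And>f. f \<in> ell2 S \<Longrightarrow> sqrt (nsq S (B f)) \<le> D * sqrt (nsq S f)"
    using bounded_opsD(5)[OF B] by auto
  show ?thesis
  proof (rule bounded_opsI[where C = "C * D"])
    fix f assume f: "f \<in> ell2 S"
    have "sqrt (nsq S (A (B f))) \<le> C * sqrt (nsq S (B f))"
      by (intro C bounded_opsD(1)[OF B] f)
    also have "\<dots> \<le> C * (D * sqrt (nsq S f))" by (intro mult_left_mono D f C0)
    finally show "sqrt (nsq S (op_mult H A B f)) \<le> C * D * sqrt (nsq S f)"
      using f by (simp add: op_mult_def compose_eq mult_ac)
  qed (auto simp: op_mult_def compose_eq bounded_opsD[OF A] bounded_opsD[OF B] ell2_add ell2_scale)
qed

lemma adjoint_mult:
  assumes A: "A \<in> bounded_ops H" and B: "B \<in> bounded_ops H"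
  shows "adjoint_op H (op_mult H A B) = op_mult H (adjoint_op H B) (adjoint_op H A)"
proof (rule adjoint_op_eqI)
  show "op_mult H (adjoint_op H B) (adjoint_op H A) \<in> bounded_ops H"
    by (intro bounded_ops_mult adjoint_op A B)
  fix f g assume f: "f \<in> ell2 S" and g: "g \<in> ell2 S"
  have "ip S (A (B f)) g = ip S (B f) (adjoint_op H A g)"
    by (intro adjoint_op(2)[OF A] bounded_opsD(1)[OF B] f g)
  also have "\<dots> = ip S f (adjoint_op H B (adjoint_op H A g))"
    by (intro adjoint_op(2)[OF B] bounded_opsD(1)[OF adjoint_op(1)[OF A]] f g)
  finally show "ip S (op_mult H A B f) g = ip S f (op_mult H (adjoint_op H B) (adjoint_op H A) g)"
    using f g by (simp add: op_mult_def compose_eq)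
qed

lemma op_sum_eq:
  assumes "finite I" "\<And>i f. i \<in> I \<Longrightarrow> f \<in> ell2 S \<Longrightarrow> A i f \<in> ell2 S"
  shows "op_sum H A I = (\<lambda>f\<in>ell2 S. \<lambda>x. \<Sum>i\<in>I. A i f x)"
  unfolding op_sum_def carrier_eq using assms by (intro restrict_ext) (auto simp: finsum_eq)

lemma kraus_map_eq:
  assumes I: "finite I" and A: "\<And>i. i \<in> I \<Longrightarrow> A i \<in> bounded_ops H" 
    and \<rho>: "\<And>f. f \<in> ell2 S \<Longrightarrow> \<rho> f \<in> ell2 S"
  shows "kraus_map H A I \<rho> = (\<lambda>f\<in>ell2 S. \<lambda>x. \<Sum>i\<in>I. A i (\<rho> (adjoint_op H (A i) f)) x)"
proof -
  have "A i (\<rho> (adjoint_op H (A i) f)) \<in> ell2 S" if "i \<in> I" "f \<in> ell2 S" for i f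
    using that by (intro bounded_opsD(1)[OF A] \<rho> bounded_opsD(1)[OF adjoint_op(1)[OF A]])
  then show ?thesis
    unfolding kraus_map_def using I by (subst op_sum_eq) (auto simp: op_mult_def compose_eq intro!: restrict_ext sum.cong)
qed

lemma pure_state_eq:
  "\<xi> \<in> ell2 S \<Longrightarrow> pure_state H \<xi> = (\<lambda>f\<in>ell2 S. \<lambda>x. ip S \<xi> f * \<xi> x)"
  unfolding pure_state_def by (auto simp: smult_eq intro!: restrict_ext)

lemma kraus_map_pure_state:
  assumes I: "finite I" and A: "\<And>i. i \<in> I \<Longrightarrow> A i \<in> bounded_ops H" and \<xi>: "\<xi> \<in> ell2 S"
  shows "kraus_map H A I (pure_state H \<xi>) = frame_op S I (\<lambda>i. A i \<xi>)"
proof -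
  have "A i (pure_state H \<xi> (adjoint_op H (A i) f)) = (\<lambda>x. ip S (A i \<xi>) f * A i \<xi> x)" if "i \<in> I" "f \<in> ell2 S" for i f
  proof -
    have f': "adjoint_op H (A i) f \<in> ell2 S" using that by (intro bounded_opsD(1)[OF adjoint_op(1)[OF A]])
    show ?thesis
      using that by (simp add: pure_state_eq \<xi> f' bounded_opsD(4)[OF A] adjoint_op(2)[OF A, symmetric])
  qed
  then show ?thesis
    unfolding frame_op_def by (subst kraus_map_eq[OF I A]) (auto simp: pure_state_eq \<xi> ell2_scale intro!: restrict_ext sum.cong)
qed

lemma kraus_map_compose:
  assumes I: "finite I" and J: "finite J" and A: "\<And>i. i \<in> I \<Longrightarrow> A i \<in> bounded_ops H" 
    and B: "\<And>j. j \<in> J \<Longrightarrow> B j \<in> bounded_ops H" and \<rho>: "\<And>f. f \<in> ell2 S \<Longrightarrow> \<rho> f \<in> ell2 S"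
  shows "kraus_map H A I (kraus_map H B J \<rho>) = kraus_map H (\<lambda>(i, j). op_mult H (A i) (B j)) (I \<times> J) \<rho>"
proof -
  have BJ: "kraus_map H B J \<rho> = (\<lambda>f\<in>ell2 S. \<lambda>x. \<Sum>j\<in>J. B j (\<rho> (adjoint_op H (B j) f)) x)"
    by (rule kraus_map_eq[OF J B \<rho>])
  have in1: "adjoint_op H (A i) f \<in> ell2 S" if "i \<in> I" "f \<in> ell2 S" for i f
    using that by (intro bounded_opsD(1)[OF adjoint_op(1)[OF A]])
  have in2: "B j (\<rho> (adjoint_op H (B j) f)) \<in> ell2 S" if "j \<in> J" "f \<in> ell2 S" for j f
    using that by (intro bounded_opsD(1)[OF B] \<rho> bounded_opsD(1)[OF adjoint_op(1)[OF B]])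
  have lin: "A i (\<lambda>x. \<Sum>j\<in>J. h j x) = (\<lambda>x. \<Sum>j\<in>J. A i (h j) x)" if "i \<in> I" "\<And>j. j \<in> J \<Longrightarrow> h j \<in> ell2 S" for i h
    using bounded_op_sum[OF A[OF that(1)], of J h "\<lambda>_. 1"] that by simp
  have "kraus_map H A I (kraus_map H B J \<rho>) = 
     (\<lambda>f\<in>ell2 S. \<lambda>x. \<Sum>i\<in>I. \<Sum>j\<in>J. A i (B j (\<rho> (adjoint_op H (B j) (adjoint_op H (A i) f)))) x)"
  proof (subst kraus_map_eq[OF I A])
    show "kraus_map H B J \<rho> f \<in> ell2 S" if "f \<in> ell2 S" for f
      using that in2 by (simp add: BJ ell2_sum)
    show "(\<lambda>f\<in>ell2 S. \<lambda>x. \<Sum>i\<in>I. A i (kraus_map H B J \<rho> (adjoint_op H (A i) f)) x) = 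
       (\<lambda>f\<in>ell2 S. \<lambda>x. \<Sum>i\<in>I. \<Sum>j\<in>J. A i (B j (\<rho> (adjoint_op H (B j) (adjoint_op H (A i) f)))) x)"
      by (intro restrict_ext ext sum.cong) (auto simp: BJ in1 in2 lin)
  qed
  also have "\<dots> = kraus_map H (\<lambda>(i, j). op_mult H (A i) (B j)) (I \<times> J) \<rho>"
  proof (subst kraus_map_eq[where I = "I \<times> J"])
    show "finite (I \<times> J)" using I J by simp
    show "(case q of (i, j) \<Rightarrow> op_mult H (A i) (B j)) \<in> bounded_ops H" if "q \<in> I \<times> J" for q
      using that A B by (auto intro: bounded_ops_mult)
    have "A i (B j (\<rho> (adjoint_op H (B j) (adjoint_op H (A i) f)))) =
      op_mult H (A i) (B j) (\<rho> (adjoint_op H (op_mult H (A i) (B j)) f))"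
      if "i \<in> I" "j \<in> J" "f \<in> ell2 S" for i j f
    proof -
      have "adjoint_op H (op_mult H (A i) (B j)) f = adjoint_op H (B j) (adjoint_op H (A i) f)"
        unfolding adjoint_mult[OF A[OF that(1)] B[OF that(2)]] using that by (intro op_mult_apply)
      moreover have "\<rho> (adjoint_op H (B j) (adjoint_op H (A i) f)) \<in> ell2 S"
        using that in1 by (intro \<rho> bounded_opsD(1)[OF adjoint_op(1)[OF B]])
      ultimately show ?thesis by (simp add: op_mult_apply)
    qed
    then show "(\<lambda>f\<in>ell2 S. \<lambda>x. \<Sum>i\<in>I. \<Sum>j\<in>J. A i (B j (\<rho> (adjoint_op H (B j) (adjoint_op H (A i) f)))) x) =
      (\<lambda>f\<in>ell2 S. \<lambda>x. \<Sum>q\<in>I \<times> J. (case q of (i, j) \<Rightarrow> op_mult H (A i) (B j))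
         (\<rho> (adjoint_op H (case q of (i, j) \<Rightarrow> op_mult H (A i) (B j)) f)) x)"
      unfolding sum.cartesian_product' by (intro restrict_ext ext sum.cong) auto
  qed (rule \<rho>)
  finally show ?thesis .
qed

lemma kraus_map_reindex:
  assumes b: "bij_betw h I' I" and I: "finite I" and A: "\<And>i. i \<in> I \<Longrightarrow> A i \<in> bounded_ops H" 
    and \<rho>: "\<And>f. f \<in> ell2 S \<Longrightarrow> \<rho> f \<in> ell2 S"
  shows "kraus_map H (\<lambda>i. A (h i)) I' \<rho> = kraus_map H A I \<rho>"
proof -
  have I': "finite I'" using b I bij_betw_finite by blast
  have h: "h i \<in> I" if "i \<in> I'" for i using b that by (auto simp: bij_betw_def)
  show ?thesis
  proof -
    have "kraus_map H (\<lambda>i. A (h i)) I' \<rho> = (\<lambda>f\<in>ell2 S. \<lambda>x. \<Sum>i\<in>I'. A (h i) (\<rho> (adjoint_op H (A (h i)) f)) x)"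
      by (rule kraus_map_eq) (simp_all add: I' A h \<rho>)
    also have "\<dots> = (\<lambda>f\<in>ell2 S. \<lambda>x. \<Sum>i\<in>I. A i (\<rho> (adjoint_op H (A i) f)) x)"
      by (intro restrict_ext ext) (rule sum.reindex_bij_betw[OF b])
    also have "\<dots> = kraus_map H A I \<rho>" 
      by (rule kraus_map_eq[symmetric]) (simp_all add: I A \<rho>)
    finally show ?thesis .
  qed
qed

lemma orthonormal_basis_delta: "orthonormal_basis H (delta ` S)"
  unfolding orthonormal_basis_def orthonormal_def
proof (intro conjI ballI impI)
  fix b c assume "b \<in> delta ` S" "c \<in> delta ` S"
  then obtain s t where "b = delta s" "c = delta t" "s \<in> S" "t \<in> S" by blast
  then show "cinner H b c = (if b = c then 1 else 0)" by (auto simp: delta_inject) (simp_all add: delta_def)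
next
  fix f assume f: "f \<in> carrier H" "\<forall>b\<in>delta ` S. cinner H b f = 0"
  show "f = \<zero>\<^bsub>H\<^esub>"
    unfolding zero_eq by (rule ell2_eqI[of _ S]) (use f in auto)
qed auto

text \<open>
  A projection of rank one is its own absolute value.
\<close>

lemma pure_state_trace_class:
  assumes \<xi>: "\<xi> \<in> ell2 S" "nsq S \<xi> = 1"
  shows "pure_state H \<xi> \<in> trace_class H"
proof -
  let ?P = "pure_state H \<xi>"
  note P = pure_state_eq[OF \<xi>(1)]
  have bd: "?P \<in> bounded_ops H"
  proof (rule bounded_opsI[where C = 1])
    fix f assume f: "f \<in> ell2 S"
    have "sqrt (nsq S (?P f)) = cmod (ip S \<xi> f)" using \<xi> f by (simp add: P nsq_scale)
    also have "\<dots> \<le> 1 * sqrt (nsq S f)" using ip_Cauchy_Schwarz'[OF \<xi>(1) f] \<xi> by simp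
    finally show "sqrt (nsq S (?P f)) \<le> 1 * sqrt (nsq S f)" .
  qed (use \<xi> in \<open>auto simp: P ell2_scale ell2_add ip_add_right ip_scale_right distrib_right mult.assoc\<close>)
  have adj: "adjoint_op H ?P = ?P"
    by (rule adjoint_op_eqI[OF bd]) (simp add: P ip_scale_left ip_scale_right ip_commute[of S _ \<xi>])
  have q: "ip S f (?P f) = of_real ((cmod (ip S \<xi> f))\<^sup>2)" if "f \<in> ell2 S" for f
    using that by (simp add: P ip_scale_right ip_commute[of S f \<xi>] complex_norm_square[symmetric])
  have pos: "positive_op H ?P"
    unfolding positive_op_def
  proof (intro conjI ballI bd)
    fix f assume "f \<in> carrier H"
    then show "cinner H f (?P f) \<in> \<real>\<^sub>\<ge>\<^sub>0"
      unfolding cinner_eq carrier_eq by (subst q) (simp_all only: nonneg_Reals_of_real_iff zero_le_power2)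
  qed
  have inj: "inj_on delta S" by (auto simp: inj_on_def delta_inject)
  have "(\<lambda>b. cinner H b (?P b)) summable_on delta ` S"
    unfolding summable_on_reindex[OF inj]
  proof -
    have "(\<lambda>s. of_real ((cmod (\<xi> s))\<^sup>2) :: complex) summable_on S"
      by (intro summable_on_of_real ell2_summable \<xi>)
    then show "((\<lambda>b. cinner H b (?P b)) \<circ> delta) summable_on S"
      by (rule summable_on_cong[THEN iffD1, rotated]) (simp only: q cinner_eq o_def delta_ell2 ip_delta_right complex_mod_cnj)
  qed
  then show ?thesis unfolding trace_class_def
    using bd pos orthonormal_basis_delta by (intro CollectI conjI exI[of _ ?P] exI[of _ "delta ` S"]) (simp_all only: adj)
qed

end

section \<open>Entropy of finite rank operators and Gram matrices\<close>

context ell2_model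
begin

lemma frame_op_apply: "f \<in> ell2 S \<Longrightarrow> frame_op S I v f = (\<lambda>x. \<Sum>i\<in>I. ip S (v i) f * v i x)"
  by (simp add: frame_op_def)

context
  fixes J :: "'j set" and w :: "'j \<Rightarrow> 'x \<Rightarrow> complex"
  assumes J: "finite J" and w: "\<And>j. j \<in> J \<Longrightarrow> w j \<in> ell2 S"
    and orth: "\<And>j k. j \<in> J \<Longrightarrow> k \<in> J \<Longrightarrow> j \<noteq> k \<Longrightarrow> ip S (w j) (w k) = 0"
begin

lemma ip_frame_op_orthogonal:
  assumes k: "k \<in> J" and f: "f \<in> ell2 S"
  shows "ip S (w k) (frame_op S J w f) = ip S (w k) f * of_real (nsq S (w k))"
proof -
  have "ip S (w k) (frame_op S J w f) = (\<Sum>j\<in>J. ip S (w j) f * ip S (w k) (w j))"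
    unfolding frame_op_apply[OF f]
    by (subst ip_sum_right[OF w[OF k]]) (auto intro: ell2_scale w simp: ip_scale_right)
  also have "\<dots> = (\<Sum>j\<in>J. if j = k then ip S (w k) f * of_real (nsq S (w k)) else 0)"
    by (rule sum.cong[OF refl]) (simp add: orth[OF k] ip_self)
  finally show ?thesis using J k by simp
qed

lemma eigenspace_frame_op:
  "eigenspace H (frame_op S J w) l = {f \<in> ell2 S. frame_op S J w f = (\<lambda>x. of_real l * f x)}"
  by (auto simp: eigenspace_def smult_eq)

text \<open>
  Pairing with \<open>w\<^sub>j\<close> gives \<open>(nsq w\<^sub>j - l) \<langle>w\<^sub>j, f\<rangle> = 0\<close>, so that only the \<open>w\<^sub>j\<close> with \<open>nsq w\<^sub>j = l\<close> occur.
\<close>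

lemma eigenvector_expansion:
  assumes f: "f \<in> eigenspace H (frame_op S J w) l" and l: "l \<noteq> 0"
  shows "f x = (\<Sum>j\<in>{j \<in> J. nsq S (w j) = l}. ip S (w j) f * w j x) / of_real l"
proof -
  have f2: "f \<in> ell2 S" and ev: "frame_op S J w f = (\<lambda>x. of_real l * f x)"
    using f unfolding eigenspace_frame_op by auto
  have zero: "ip S (w j) f = 0" if "j \<in> J" "nsq S (w j) \<noteq> l" for j
  proof -
    have "ip S (w j) f * of_real (nsq S (w j)) = of_real l * ip S (w j) f"
      using ip_frame_op_orthogonal[OF that(1) f2] unfolding ev ip_scale_right by (rule sym)
    then have "ip S (w j) f * of_real (nsq S (w j) - l) = 0"
      
      unfolding of_real_diff right_diff_distrib by (simp only: mult.commute[of "of_real l" "ip S (w j) f"] diff_self)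
    then show ?thesis using that(2) by (metis mult_eq_0_iff of_real_eq_0_iff right_minus_eq)
  qed
  have "of_real l * f x = (\<Sum>j\<in>J. ip S (w j) f * w j x)"
    using fun_cong[OF ev, of x] unfolding frame_op_apply[OF f2] by simp
  also have "\<dots> = (\<Sum>j\<in>{j \<in> J. nsq S (w j) = l}. ip S (w j) f * w j x)"
    by (rule sum.mono_neutral_right) (use J zero in auto)
  finally show ?thesis using l by (simp add: field_simps)
qed

text \<open>
  The vectors \<open>w\<^sub>j / \<surd>l\<close> with \<open>nsq w\<^sub>j = l\<close> form an orthonormal system in the eigenspace.  No system is
  larger: by Bessel's inequality, summing \<open>\<Sum>\<^sub>j |\<langle>b, w\<^sub>j\<rangle>|\<^sup>2 = l\<close> over its members \<open>b\<close> gives at most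
  \<open>\<Sum>\<^sub>j nsq w\<^sub>j\<close>.
\<close>

lemma multiplicity_frame_op:
  assumes l: "0 < l"
  shows "multiplicity H (frame_op S J w) l = ereal (real (card {j \<in> J. nsq S (w j) = l}))"
proof -
  let ?J = "{j \<in> J. nsq S (w j) = l}"
  let ?e = "\<lambda>j x. w j x / of_real (sqrt l)"
  have Jl: "finite ?J" using J by simp
  have e2: "?e j \<in> ell2 S" if "j \<in> ?J" for j
    using ell2_scale[OF w, of j "1 / of_real (sqrt l)"] that by simp
  have eip: "ip S (?e j) (?e k) = (if j = k then 1 else 0)" if "j \<in> ?J" "k \<in> ?J" for j k
  proof -
    have "ip S (?e j) (?e k) = ip S (w j) (w k) / (of_real (sqrt l) * of_real (sqrt l))"
      using ip_scale_left[of S "1 / of_real (sqrt l)" "w j" "?e k"] ip_scale_right[of S "w j" "1 / of_real (sqrt l)" "w k"]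
      by simp
    also have "of_real (sqrt l) * of_real (sqrt l) = (of_real l :: complex)"
      using l by (metis abs_of_pos of_real_mult real_sqrt_mult_self)
    finally show ?thesis using that l orth[of j k] by (auto simp: ip_self)
  qed
  have inj: "inj_on ?e ?J"
  proof (rule inj_onI, rule ccontr)
    fix j k assume jk: "j \<in> ?J" "k \<in> ?J" "?e j = ?e k" "j \<noteq> k"
    have "ip S (?e j) (?e k) = 0" using eip[OF jk(1,2)] jk(4) by simp
    moreover have "ip S (?e j) (?e k) = 1" using eip[OF jk(1,1)] unfolding jk(3) by simp
    ultimately show False by simp
  qed
  have lower: "ereal (real (card ?J)) \<le> multiplicity H (frame_op S J w) l"
    unfolding multiplicity_def
  proof (rule SUP_upper2[of "?e ` ?J"])
    have "?e j \<in> eigenspace H (frame_op S J w) l" if j: "j \<in> ?J" for j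
      unfolding eigenspace_frame_op
    proof (intro CollectI conjI e2[OF j] ext)
      fix x
      have "frame_op S J w (?e j) x = (\<Sum>k\<in>J. ip S (w k) (w j) / of_real (sqrt l) * w k x)"
        unfolding frame_op_apply[OF e2[OF j]] using ip_scale_right[of S _ "1 / of_real (sqrt l)" "w j"] by simp
      also have "\<dots> = (\<Sum>k\<in>J. if k = j then of_real l / of_real (sqrt l) * w j x else 0)"
        using j by (intro sum.cong refl) (auto simp: orth ip_self)
      also have "\<dots> = of_real l * ?e j x" using J j by simp
      finally show "frame_op S J w (?e j) x = of_real l * ?e j x" .
    qed
    then show "?e ` ?J \<in> {B. finite B \<and> B \<subseteq> eigenspace H (frame_op S J w) l \<and> orthonormal H B}"
      using Jl e2 eip inj by (auto simp: orthonormal_def inj_on_def)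
    show "ereal (real (card ?J)) \<le> ereal (real (card (?e ` ?J)))" using inj by (simp add: card_image)
  qed
  have upper: "multiplicity H (frame_op S J w) l \<le> ereal (real (card ?J))"
    unfolding multiplicity_def
  proof (rule SUP_least)
    fix B assume "B \<in> {B. finite B \<and> B \<subseteq> eigenspace H (frame_op S J w) l \<and> orthonormal H B}"
    then have B: "finite B" "B \<subseteq> eigenspace H (frame_op S J w) l" "orthonormal H B" by auto
    then have B2: "b \<in> ell2 S" if "b \<in> B" for b using that by (auto simp: eigenspace_frame_op)
    have fam: "orthonormal_family S B (\<lambda>b. b)"
      using B(3) B2 by (auto simp: orthonormal_family_def orthonormal_def)
    note sq = cnj_mult_self
    have one: "(\<Sum>j\<in>?J. (cmod (ip S b (w j)))\<^sup>2) = l" if b: "b \<in> B" for b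
    proof -
      have "b = (\<lambda>x. (1 / of_real l) * (\<Sum>j\<in>?J. ip S (w j) b * w j x))"
        using eigenvector_expansion[of b l] B(2) b l by auto
      then have "ip S b b = ip S b (\<lambda>x. (1 / of_real l) * (\<Sum>j\<in>?J. ip S (w j) b * w j x))" by simp
      also have "\<dots> = (1 / of_real l) * (\<Sum>j\<in>?J. ip S (w j) b * ip S b (w j))"
        unfolding ip_scale_right
        by (subst ip_sum_right[OF B2[OF b]]) (auto intro!: ell2_scale w simp: ip_scale_right)
      also have "(\<Sum>j\<in>?J. ip S (w j) b * ip S b (w j)) = of_real (\<Sum>j\<in>?J. (cmod (ip S b (w j)))\<^sup>2)"
        unfolding of_real_sum by (intro sum.cong refl) (subst ip_commute, rule sq)
      finally have "of_real (\<Sum>j\<in>?J. (cmod (ip S b (w j)))\<^sup>2) = of_real l * ip S b b" using l by (simp del: of_real_sum)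
      also have "ip S b b = 1" using fam b by (auto simp: orthonormal_family_def)
      finally show ?thesis unfolding mult_1_right of_real_eq_iff .
    qed
    have "real (card B) * l = (\<Sum>b\<in>B. \<Sum>j\<in>?J. (cmod (ip S b (w j)))\<^sup>2)"
      using one by simp
    also have "\<dots> = (\<Sum>j\<in>?J. \<Sum>b\<in>B. (cmod (ip S b (w j)))\<^sup>2)" by (rule sum.swap)
    also have "\<dots> \<le> (\<Sum>j\<in>?J. nsq S (w j))"
      using Bessel[OF fam w B(1) order_refl] by (intro sum_mono) auto
    also have "\<dots> = real (card ?J) * l" by simp
    finally show "ereal (real (card B)) \<le> ereal (real (card ?J))" using l by simp
  qed
  show ?thesis using lower upper by (rule antisym[rotated])
qed

lemma eigenvalues_frame_op:
  "eigenvalues H (frame_op S J w) - {0} = (\<lambda>j. nsq S (w j)) ` J - {0}"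
proof (intro equalityI subsetI)
  fix l assume l: "l \<in> eigenvalues H (frame_op S J w) - {0}"
  then obtain f where f: "f \<in> eigenspace H (frame_op S J w) l" "f \<noteq> (\<lambda>x. 0)"
    by (auto simp: eigenvalues_def)
  show "l \<in> (\<lambda>j. nsq S (w j)) ` J - {0}"
  proof (rule ccontr)
    assume "l \<notin> (\<lambda>j. nsq S (w j)) ` J - {0}"
    then have empty: "{j \<in> J. nsq S (w j) = l} = {}" using l by auto
    have "f x = 0" for x using eigenvector_expansion[OF f(1)] l unfolding empty by simp
    then show False using f(2) by auto
  qed
next
  fix l assume l: "l \<in> (\<lambda>j. nsq S (w j)) ` J - {0}"
  then obtain j where j: "j \<in> J" "nsq S (w j) = l" "l \<noteq> 0" by auto
  have "w j \<in> eigenspace H (frame_op S J w) l"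
    unfolding eigenspace_frame_op
  proof (intro CollectI conjI w j ext)
    fix x
    have "frame_op S J w (w j) x = (\<Sum>k\<in>J. if k = j then of_real l * w j x else 0)"
      unfolding frame_op_apply[OF w[OF j(1)]] by (intro sum.cong refl) (auto simp: orth j ip_self)
    then show "frame_op S J w (w j) x = of_real l * w j x" using J j by simp
  qed
  moreover have "w j \<noteq> (\<lambda>x. 0)" using j by auto
  ultimately show "l \<in> eigenvalues H (frame_op S J w) - {0}" using j by (auto simp: eigenvalues_def)
qed

lemma entropy_frame_op_orthogonal:
  "entropy H (frame_op S J w) = ereal (\<Sum>j\<in>J. - (nsq S (w j) * ln (nsq S (w j))))"
proof -
  let ?p = "\<lambda>j. nsq S (w j)" and ?\<rho> = "frame_op S J w"
  let ?h = "\<lambda>l. multiplicity H ?\<rho> l * ereal (- (l * ln l))"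
  let ?E = "eigenvalues H ?\<rho>"
  have "finite (?p ` J - {0})" using J by simp
  then have finE: "finite ?E" using eigenvalues_frame_op by (metis finite_Diff2 finite.emptyI finite_insert)
  have "entropy H ?\<rho> = (\<Sum>l\<in>?E. ?h l)" unfolding entropy_def using finE by simp
  also have "\<dots> = (\<Sum>l\<in>?E - {0}. ?h l)"
    by (rule sum.mono_neutral_right) (use finE in auto)
  also have "\<dots> = (\<Sum>l\<in>?p ` J - {0}. ?h l)" by (simp only: eigenvalues_frame_op)
  also have "\<dots> = (\<Sum>l\<in>?p ` J - {0}. ereal (real (card {j \<in> J. ?p j = l}) * - (l * ln l)))"
  proof (intro sum.cong refl)
    fix l assume "l \<in> ?p ` J - {0}"
    then have "0 < l" using nsq_nonneg[of S] by (auto simp: less_le)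
    then show "?h l = ereal (real (card {j \<in> J. ?p j = l}) * - (l * ln l))"
      by (simp only: multiplicity_frame_op times_ereal.simps)
  qed
  also have "\<dots> = ereal (\<Sum>l\<in>?p ` J - {0}. real (card {j \<in> J. ?p j = l}) * - (l * ln l))"
    by simp
  also have "(\<Sum>l\<in>?p ` J - {0}. real (card {j \<in> J. ?p j = l}) * - (l * ln l)) = 
      (\<Sum>l\<in>?p ` J. real (card {j \<in> J. ?p j = l}) * - (l * ln l))"
    by (rule sum.mono_neutral_left) (use J in auto)
  also have "\<dots> = (\<Sum>j\<in>J. - (?p j * ln (?p j)))"
    using sum_fun_comp[OF J finite_imageI[OF J] order_refl, of "\<lambda>l. - (l * ln l)" ?p] by simp
  finally show ?thesis .
qed

end

end

definition gram :: "'x set \<Rightarrow> ('i \<Rightarrow> 'x \<Rightarrow> complex) \<Rightarrow> 'i \<Rightarrow> 'i \<Rightarrow> complex" where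
  "gram S v i j = ip S (v i) (v j)"

text \<open>
  The entropy of the spectrum.  For Gram matrices it does not depend on the chosen diagonalization,
  since each of them computes the entropy of the same operator (\<open>matrix_entropy_eq\<close>).
\<close>

definition matrix_entropy :: "'i set \<Rightarrow> ('i \<Rightarrow> 'i \<Rightarrow> complex) \<Rightarrow> real" where
  "matrix_entropy I G = (SOME s. \<exists>U p. diagonalizes I G U p \<and> s = (\<Sum>i\<in>I. - (p i * ln (p i))))"

lemma isometry_sum:
  fixes U :: "'i \<Rightarrow> 'j \<Rightarrow> complex"
  assumes I: "finite I"
    and iso: "\<And>i k. i \<in> I \<Longrightarrow> k \<in> I \<Longrightarrow> (\<Sum>j\<in>J. U i j * cnj (U k j)) = (if i = k then 1 else 0)"
  shows "(\<Sum>j\<in>J. (\<Sum>i\<in>I. cnj (U i j) * a i) * (\<Sum>i\<in>I. U i j * b i)) = (\<Sum>i\<in>I. a i * b i)"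
proof -
  have "(\<Sum>j\<in>J. (\<Sum>i\<in>I. cnj (U i j) * a i) * (\<Sum>k\<in>I. U k j * b k)) =
     (\<Sum>j\<in>J. \<Sum>i\<in>I. \<Sum>k\<in>I. a i * b k * (U k j * cnj (U i j)))"
    unfolding sum_product by (simp add: mult_ac)
  also have "\<dots> = (\<Sum>i\<in>I. \<Sum>j\<in>J. \<Sum>k\<in>I. a i * b k * (U k j * cnj (U i j)))" by (rule sum.swap)
  also have "\<dots> = (\<Sum>i\<in>I. \<Sum>k\<in>I. \<Sum>j\<in>J. a i * b k * (U k j * cnj (U i j)))"
    by (rule sum.cong[OF refl], rule sum.swap)
  also have "\<dots> = (\<Sum>i\<in>I. \<Sum>k\<in>I. a i * b k * (\<Sum>j\<in>J. U k j * cnj (U i j)))"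
    by (simp add: sum_distrib_left)
  also have "\<dots> = (\<Sum>i\<in>I. \<Sum>k\<in>I. if k = i then a i * b i else 0)"
    by (intro sum.cong refl) (simp add: iso)
  finally show ?thesis using I by simp
qed

text \<open>
  The unitary freedom of ensembles: mixing the vectors by coefficients with orthonormal rows does not
  change the operator.  This is used for the diagonalization of Gram matrices and for the comparison
  of Kraus families.
\<close>

lemma frame_op_isometry:
  fixes U :: "'i \<Rightarrow> 'j \<Rightarrow> complex"
  assumes I: "finite I" and v: "\<And>i. i \<in> I \<Longrightarrow> v i \<in> ell2 S"
    and iso: "\<And>i k. i \<in> I \<Longrightarrow> k \<in> I \<Longrightarrow> (\<Sum>j\<in>J. U i j * cnj (U k j)) = (if i = k then 1 else 0)"
  shows "frame_op S J (\<lambda>j x. \<Sum>i\<in>I. U i j * v i x) = frame_op S I v"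
  unfolding frame_op_def
proof (intro restrict_ext ext)
  fix f x assume f: "f \<in> ell2 S"
  have "ip S (\<lambda>x. \<Sum>i\<in>I. U i j * v i x) f = (\<Sum>i\<in>I. cnj (U i j) * ip S (v i) f)" for j
    using f by (subst ip_sum_left) (auto intro!: ell2_scale v simp: ip_scale_left)
  then show "(\<Sum>j\<in>J. ip S (\<lambda>x. \<Sum>i\<in>I. U i j * v i x) f * (\<Sum>i\<in>I. U i j * v i x)) = (\<Sum>i\<in>I. ip S (v i) f * v i x)"
    by (simp only:) (rule isometry_sum[OF I iso])
qed

context
  fixes S :: "'x set" and I :: "'i set" and v :: "'i \<Rightarrow> 'x \<Rightarrow> complex" and U p w
  assumes I: "finite I" and v: "\<And>i. i \<in> I \<Longrightarrow> v i \<in> ell2 S"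
    and diag: "diagonalizes I (gram S v) U p"
  defines "w \<equiv> \<lambda>j x. \<Sum>i\<in>I. U i j * v i x"
begin

lemma w_ell2: "w j \<in> ell2 S"
  unfolding w_def by (intro ell2_sum ell2_scale v)

lemma ip_w_right: "f \<in> ell2 S \<Longrightarrow> ip S f (w j) = (\<Sum>i\<in>I. U i j * ip S f (v i))"
  unfolding w_def by (subst ip_sum_right) (auto intro!: ell2_scale v simp: ip_scale_right)

lemma ip_w_left: "f \<in> ell2 S \<Longrightarrow> ip S (w j) f = (\<Sum>i\<in>I. cnj (U i j) * ip S (v i) f)"
  unfolding w_def by (subst ip_sum_left) (auto intro!: ell2_scale v simp: ip_scale_left)

lemma ip_w: "j \<in> I \<Longrightarrow> k \<in> I \<Longrightarrow> ip S (w j) (w k) = (if j = k then of_real (p j) else 0)"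
proof -
  assume jk: "j \<in> I" "k \<in> I"
  have "ip S (w j) (w k) = (\<Sum>i\<in>I. cnj (U i j) * (\<Sum>l\<in>I. U l k * ip S (v i) (v l)))"
    unfolding ip_w_left[OF w_ell2] by (intro sum.cong refl arg_cong2[where f = "(*)"] ip_w_right v)
  also have "\<dots> = herm_form I (gram S v) (\<lambda>i. U i j) (\<lambda>i. U i k)"
    unfolding herm_form_def gram_def by (simp add: sum_distrib_left mult_ac)
  finally show ?thesis using diag jk by (simp add: diagonalizes_def)
qed

lemma nsq_w: "j \<in> I \<Longrightarrow> nsq S (w j) = p j"
  using ip_w[of j j] by (simp add: ip_self)

lemma rows_orthonormal: "i \<in> I \<Longrightarrow> k \<in> I \<Longrightarrow> (\<Sum>j\<in>I. U i j * cnj (U k j)) = (if i = k then 1 else 0)"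
  using diag by (simp add: diagonalizes_def)

lemma frame_op_w: "frame_op S I w = frame_op S I v"
  unfolding w_def by (rule frame_op_isometry[OF I v rows_orthonormal])

text \<open>
  Both sides are the trace of the square of \<open>\<Sum>\<^sub>i |v\<^sub>i\<rangle>\<langle>v\<^sub>i| = \<Sum>\<^sub>j |w\<^sub>j\<rangle>\<langle>w\<^sub>j|\<close>.
\<close>

lemma sum_p_squared: "(\<Sum>j\<in>I. (p j)\<^sup>2) = (\<Sum>i\<in>I. \<Sum>k\<in>I. (cmod (gram S v i k))\<^sup>2)"
proof -
  note sq = mult_cnj_self
  have par: "(\<Sum>j\<in>I. ip S f (w j) * ip S (w j) g) = (\<Sum>i\<in>I. ip S f (v i) * ip S (v i) g)"
    if "f \<in> ell2 S" "g \<in> ell2 S" for f g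
    using isometry_sum[OF I rows_orthonormal, of "\<lambda>i. ip S (v i) g" "\<lambda>i. ip S f (v i)"] that
    by (simp add: ip_w_left ip_w_right mult.commute)
  have "of_real (\<Sum>i\<in>I. \<Sum>k\<in>I. (cmod (gram S v i k))\<^sup>2) = (\<Sum>i\<in>I. \<Sum>k\<in>I. ip S (v i) (v k) * ip S (v k) (v i))"
    unfolding of_real_sum sq[symmetric] gram_def by (simp only: ip_commute[symmetric])
  also have "\<dots> = (\<Sum>i\<in>I. \<Sum>k\<in>I. ip S (v i) (w k) * ip S (w k) (v i))"
    by (intro sum.cong refl par[symmetric] v)
  also have "\<dots> = (\<Sum>k\<in>I. \<Sum>i\<in>I. ip S (v i) (w k) * ip S (w k) (v i))" by (rule sum.swap)
  also have "\<dots> = (\<Sum>k\<in>I. \<Sum>i\<in>I. ip S (w k) (v i) * ip S (v i) (w k))" by (simp only: mult.commute)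
  also have "\<dots> = (\<Sum>k\<in>I. \<Sum>j\<in>I. ip S (w k) (w j) * ip S (w j) (w k))"
    by (intro sum.cong refl par[symmetric] w_ell2)
  also have "\<dots> = (\<Sum>k\<in>I. \<Sum>j\<in>I. if j = k then of_real ((p k)\<^sup>2) else 0)"
    by (intro sum.cong refl) (auto simp: ip_w power2_eq_square)
  also have "\<dots> = of_real (\<Sum>k\<in>I. (p k)\<^sup>2)" using I by simp
  finally show ?thesis unfolding of_real_eq_iff by simp
qed

lemma sum_p: "(\<Sum>j\<in>I. p j) = (\<Sum>i\<in>I. nsq S (v i))"
proof -
  have "complex_of_real (\<Sum>j\<in>I. p j) = of_real (\<Sum>i\<in>I. nsq S (v i))"
    unfolding diagonalizes_trace[OF I diag] gram_def by (simp add: ip_self)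
  then show ?thesis by (simp only: of_real_eq_iff)
qed

lemma p_nonneg: "j \<in> I \<Longrightarrow> 0 \<le> p j"
  using nsq_w[of j] nsq_nonneg[of S "w j"] by simp

lemma entropy_eq_sum_p:
  assumes "ell2_model H S"
  shows "entropy H (frame_op S I v) = ereal (\<Sum>j\<in>I. - (p j * ln (p j)))"
proof -
  interpret ell2_model H S by fact
  have "entropy H (frame_op S I w) = ereal (\<Sum>j\<in>I. - (nsq S (w j) * ln (nsq S (w j))))"
    by (rule entropy_frame_op_orthogonal) (use I w_ell2 ip_w in auto)
  also have "(\<Sum>j\<in>I. - (nsq S (w j) * ln (nsq S (w j)))) = (\<Sum>j\<in>I. - (p j * ln (p j)))"
    by (intro sum.cong refl) (simp only: nsq_w)
  finally show ?thesis by (simp only: frame_op_w)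
qed

end

lemma gram_diagonalization:
  fixes v :: "'i \<Rightarrow> 'x \<Rightarrow> complex"
  assumes "finite I"
  obtains U p where "diagonalizes I (gram S v) U p"
  by (rule Hermitian_diagonalization[OF assms, of "gram S v"]) (unfold gram_def, rule ip_commute)

text \<open>
  Addition replaces functions outside the carrier by zero.  Then the distance \<open>cnorm (x \<ominus> y)\<close> is
  symmetric on all functions, as the locale \<open>Metric_space\<close> demands; with pointwise addition the
  inverse of a function outside the carrier would be an arbitrary value.
\<close>

definition l2_space :: "'x set \<Rightarrow> ('x \<Rightarrow> complex) cinner_space" where
  "l2_space S = \<lparr>carrier = ell2 S, mult = undefined, one = undefined, zero = (\<lambda>x. 0),
     add = (\<lambda>f g x. (if f \<in> ell2 S then f x else 0) + (if g \<in> ell2 S then g x else 0)),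
     smult = (\<lambda>c f x. c * f x), cinner = ip S\<rparr>"

interpretation l2: ell2_model "l2_space S" S for S :: "'x set"
  by unfold_locales (auto simp: l2_space_def)

lemma
  fixes v :: "'i \<Rightarrow> 'x \<Rightarrow> complex"
  assumes I: "finite I" and v: "\<And>i. i \<in> I \<Longrightarrow> v i \<in> ell2 S" 
  shows matrix_entropy_eq: "diagonalizes I (gram S v) U p \<Longrightarrow> matrix_entropy I (gram S v) = (\<Sum>j\<in>I. - (p j * ln (p j)))"
    and entropy_frame_op: "ell2_model H S \<Longrightarrow> entropy H (frame_op S I v) = ereal (matrix_entropy I (gram S v))"
proof -
  obtain U p where d: "diagonalizes I (gram S v) U p" using gram_diagonalization[OF I, of S v] .
  then have "\<exists>s U p. diagonalizes I (gram S v) U p \<and> s = (\<Sum>i\<in>I. - (p i * ln (p i)))" by blast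
  then have "\<exists>U p. diagonalizes I (gram S v) U p \<and> matrix_entropy I (gram S v) = (\<Sum>i\<in>I. - (p i * ln (p i)))"
    unfolding matrix_entropy_def by (rule someI_ex)
  then obtain U' p' where d': "diagonalizes I (gram S v) U' p'" "matrix_entropy I (gram S v) = (\<Sum>i\<in>I. - (p' i * ln (p' i)))" by auto
  show "matrix_entropy I (gram S v) = (\<Sum>j\<in>I. - (p j * ln (p j)))" if "diagonalizes I (gram S v) U p" for U p
    using entropy_eq_sum_p[OF I v that l2.ell2_model_axioms] entropy_eq_sum_p[OF I v d'(1) l2.ell2_model_axioms] d'(2) by simp
  show "entropy H (frame_op S I v) = ereal (matrix_entropy I (gram S v))" if "ell2_model H S"
    using entropy_eq_sum_p[OF I v d'(1) that] d'(2) by simp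
qed

lemma
  fixes v :: "'i \<Rightarrow> 'x \<Rightarrow> complex"
  assumes I: "finite I" and v: "\<And>i. i \<in> I \<Longrightarrow> v i \<in> ell2 S" and one: "(\<Sum>i\<in>I. nsq S (v i)) = 1"
  shows matrix_entropy_lower_bound: "0 < s \<Longrightarrow> (\<Sum>i\<in>I. \<Sum>k\<in>I. (cmod (gram S v i k))\<^sup>2) \<le> s \<Longrightarrow> - ln s \<le> matrix_entropy I (gram S v)"
    and matrix_entropy_nonneg: "0 \<le> matrix_entropy I (gram S v)"
proof -
  obtain U p where d: "diagonalizes I (gram S v) U p" using gram_diagonalization[OF I, of S v] .
  have p: "j \<in> I \<Longrightarrow> 0 \<le> p j" "(\<Sum>j\<in>I. p j) = 1" for j
    using p_nonneg[OF I v d] sum_p[OF I v d] one by auto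
  have le1: "p j \<le> 1" if "j \<in> I" for j
    using member_le_sum[of j I p] that p I by simp
  have eq: "matrix_entropy I (gram S v) = (\<Sum>j\<in>I. - (p j * ln (p j)))"
    "(\<Sum>i\<in>I. \<Sum>k\<in>I. (cmod (gram S v i k))\<^sup>2) = (\<Sum>j\<in>I. (p j)\<^sup>2)"
    using matrix_entropy_eq[OF I v d] sum_p_squared[OF I v d] by auto
  show "- ln s \<le> matrix_entropy I (gram S v)" 
    if "0 < s" "(\<Sum>i\<in>I. \<Sum>k\<in>I. (cmod (gram S v i k))\<^sup>2) \<le> s"
    using that unfolding eq by (intro sum_entropy_lower_bound) (use p in auto)
  have "0 \<le> - (p j * ln (p j))" if "j \<in> I" for j
    using p(1)[OF that] le1[OF that] by (cases "p j = 0") (auto simp: mult_nonneg_nonpos)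
  then show "0 \<le> matrix_entropy I (gram S v)"
    unfolding eq by (intro sum_nonneg)
qed

text \<open>
  The Gram matrix of product vectors is the Kronecker product, whose spectrum consists of the products
  of the eigenvalues, and entropy is additive on product distributions.
\<close>

lemma matrix_entropy_product:
  fixes v :: "'i \<Rightarrow> 'x \<Rightarrow> complex" and v' :: "'j \<Rightarrow> 'y \<Rightarrow> complex" and V :: "'k \<Rightarrow> 'z \<Rightarrow> complex"
  assumes I: "finite I" and v: "\<And>i. i \<in> I \<Longrightarrow> v i \<in> ell2 S" and one: "(\<Sum>i\<in>I. nsq S (v i)) = 1"
    and I': "finite I'" and v': "\<And>i. i \<in> I' \<Longrightarrow> v' i \<in> ell2 S'" and one': "(\<Sum>i\<in>I'. nsq S' (v' i)) = 1"
    and V: "\<And>k. k \<in> K \<Longrightarrow> V k \<in> ell2 T"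
    and h: "bij_betw (\<lambda>k. (g k, g' k)) K (I \<times> I')"
    and prod: "\<And>k l. k \<in> K \<Longrightarrow> l \<in> K \<Longrightarrow> gram T V k l = gram S v (g k) (g l) * gram S' v' (g' k) (g' l)"
  shows "matrix_entropy K (gram T V) = matrix_entropy I (gram S v) + matrix_entropy I' (gram S' v')"
proof -
  obtain U p where d: "diagonalizes I (gram S v) U p" using gram_diagonalization[OF I, of S v] .
  obtain U' p' where d': "diagonalizes I' (gram S' v') U' p'" using gram_diagonalization[OF I', of S' v'] .
  have K: "finite K" using bij_betw_finite[OF h] I I' by simp
  have D: "diagonalizes K (gram T V) (\<lambda>i j. (\<lambda>(i, i') (j, j'). U i j * U' i' j') (g i, g' i) (g j, g' j))
     (\<lambda>j. (\<lambda>(i, i'). p i * p' i') (g j, g' j))"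
    by (rule diagonalizes_reindex[OF h diagonalizes_Kronecker[OF I I' d d']]) (simp add: prod)
  have "matrix_entropy K (gram T V) = (\<Sum>k\<in>K. (\<lambda>(i, j). - (p i * p' j * ln (p i * p' j))) (g k, g' k))"
    using matrix_entropy_eq[OF K V D] by simp
  also have "\<dots> = (\<Sum>(i, j)\<in>I \<times> I'. - (p i * p' j * ln (p i * p' j)))"
    by (rule sum.reindex_bij_betw[OF h])
  also have "\<dots> = (\<Sum>i\<in>I. - (p i * ln (p i))) + (\<Sum>j\<in>I'. - (p' j * ln (p' j)))"
    by (rule sum_entropy_product) 
       (use p_nonneg[OF I v d] sum_p[OF I v d] one p_nonneg[OF I' v' d'] sum_p[OF I' v' d'] one' in auto)
  finally show ?thesis using matrix_entropy_eq[OF I v d] matrix_entropy_eq[OF I' v' d'] by simp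
qed

lemma complex_hilbert_space_l2_space: "complex_hilbert_space (l2_space S)"
proof -
  let ?H = "l2_space S"
  let ?pr = "\<lambda>f. if f \<in> ell2 S then f else (\<lambda>x. 0)"
  have cf: "cring complex_field"
    by (rule cringI) 
       (auto simp: complex_field_def algebra_simps intro!: abelian_groupI comm_monoidI exI[of _ "- _"])
  have ag: "abelian_group ?H"
  proof (rule abelian_groupI)
    fix f assume "f \<in> carrier ?H"
    then show "\<exists>g\<in>carrier ?H. g \<oplus>\<^bsub>?H\<^esub> f = \<zero>\<^bsub>?H\<^esub>"
      by (intro bexI[of _ "\<lambda>x. - f x"]) (auto simp: l2.add_eq ell2_uminus)
  qed (auto simp: l2.add_eq ell2_add add.assoc add.commute)
  have "Module.module complex_field ?H"
    by (rule moduleI[OF cf ag])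
       (auto simp: complex_field_def l2.smult_eq l2.add_eq ell2_scale ell2_add algebra_simps)
  moreover have "Metric_space.mcomplete (carrier ?H) (\<lambda>x y. cnorm ?H (x \<ominus>\<^bsub>?H\<^esub> y))"
  proof -
    have add: "f \<oplus>\<^bsub>?H\<^esub> g = (\<lambda>x. ?pr f x + ?pr g x)" for f g
      by (auto simp: l2_space_def)
    have inv: "\<ominus>\<^bsub>?H\<^esub> f = (\<lambda>x. - ?pr f x)" for f
      unfolding a_inv_def m_inv_def
    proof (rule the_equality)
      have "(\<lambda>x. - ?pr f x) \<in> ell2 S" by (auto simp: ell2_uminus)
      then show "(\<lambda>x. - ?pr f x) \<in> carrier (add_monoid ?H) \<and> f \<otimes>\<^bsub>add_monoid ?H\<^esub> (\<lambda>x. - ?pr f x) = \<one>\<^bsub>add_monoid ?H\<^esub> \<and>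
          (\<lambda>x. - ?pr f x) \<otimes>\<^bsub>add_monoid ?H\<^esub> f = \<one>\<^bsub>add_monoid ?H\<^esub>"
        by (simp add: add)
      fix g assume g: "g \<in> carrier (add_monoid ?H) \<and> f \<otimes>\<^bsub>add_monoid ?H\<^esub> g = \<one>\<^bsub>add_monoid ?H\<^esub> \<and>
          g \<otimes>\<^bsub>add_monoid ?H\<^esub> f = \<one>\<^bsub>add_monoid ?H\<^esub>"
      then have g2: "g \<in> ell2 S" and z: "f \<oplus>\<^bsub>?H\<^esub> g = (\<lambda>x. 0)" by auto
      have "?pr f x + g x = 0" for x using fun_cong[OF z, of x] g2 by (simp only: add if_True)
      then show "g = (\<lambda>x. - ?pr f x)" by (intro ext) (simp add: eq_neg_iff_add_eq_0 add.commute)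
    qed
    have pr: "?pr f \<in> ell2 S" for f by simp
    have d: "(\<lambda>x y. cnorm ?H (x \<ominus>\<^bsub>?H\<^esub> y)) = (\<lambda>f g. sqrt (nsq S (\<lambda>x. ?pr f x - ?pr g x)))"
    proof (intro ext)
      fix f g
      have "(\<lambda>x. - ?pr g x) \<in> ell2 S" by (auto simp: ell2_uminus)
      then have "f \<ominus>\<^bsub>?H\<^esub> g = (\<lambda>x. ?pr f x - ?pr g x)"
        unfolding a_minus_def inv add by auto
      then show "cnorm ?H (f \<ominus>\<^bsub>?H\<^esub> g) = sqrt (nsq S (\<lambda>x. ?pr f x - ?pr g x))"
        by (simp only: l2.cnorm_eq)
    qed
    interpret M: Metric_space "ell2 S" "\<lambda>f g. sqrt (nsq S (\<lambda>x. ?pr f x - ?pr g x))"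
    proof
      fix f g h :: "'a \<Rightarrow> complex"
      have "nsq S (\<lambda>x. ?pr f x - ?pr g x) = nsq S (\<lambda>x. - (?pr f x - ?pr g x))" by (simp only: nsq_uminus)
      then show "sqrt (nsq S (\<lambda>x. ?pr f x - ?pr g x)) = sqrt (nsq S (\<lambda>x. ?pr g x - ?pr f x))"
        by (simp only: minus_diff_eq)
      {
        assume fg: "f \<in> ell2 S" "g \<in> ell2 S"
        show "sqrt (nsq S (\<lambda>x. ?pr f x - ?pr g x)) = 0 \<longleftrightarrow> f = g"
          using fg nsq_eq_0[OF ell2_diff[OF fg]] by (auto simp: fun_eq_iff)
        assume h: "h \<in> ell2 S"
        show "sqrt (nsq S (\<lambda>x. ?pr f x - ?pr h x)) \<le> 
          sqrt (nsq S (\<lambda>x. ?pr f x - ?pr g x)) + sqrt (nsq S (\<lambda>x. ?pr g x - ?pr h x))"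
          using nsq_triangle[OF ell2_diff[OF fg] ell2_diff[OF fg(2) h]] fg h by simp
      }
    qed simp
    have "M.mcomplete"
      unfolding M.mcomplete_def
    proof (intro allI impI)
      fix s assume "M.MCauchy s"
      then have s: "\<And>n. s n \<in> ell2 S" 
        and c: "\<And>e. e > 0 \<Longrightarrow> \<exists>N. \<forall>n n'. N \<le> n \<longrightarrow> N \<le> n' \<longrightarrow> sqrt (nsq S (\<lambda>x. s n x - s n' x)) < e"
        unfolding M.MCauchy_def by (auto simp: image_subset_iff)
      have "\<exists>N. \<forall>m\<ge>N. \<forall>n\<ge>N. nsq S (\<lambda>x. s m x - s n x) < e" if "0 < e" for e
      proof -
        from c[OF real_sqrt_gt_zero[OF that]] obtain N
          where N: "\<forall>n n'. N \<le> n \<longrightarrow> N \<le> n' \<longrightarrow> sqrt (nsq S (\<lambda>x. s n x - s n' x)) < sqrt e" ..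
        then show ?thesis by (intro exI[of _ N]) simp
      qed
      note cau = this
      obtain f where f: "f \<in> ell2 S" "\<And>e. 0 < e \<Longrightarrow> \<exists>N. \<forall>n\<ge>N. nsq S (\<lambda>x. s n x - f x) < e"
        by (rule ell2_complete[OF s cau]) (auto intro: that)
      have "limitin M.mtopology s f sequentially"
        unfolding M.limitin_metric eventually_sequentially
      proof (intro conjI f allI impI)
        fix e :: real assume "0 < e"
        from f(2)[OF zero_less_power[OF this, of 2]] obtain N
          where "\<forall>n\<ge>N. nsq S (\<lambda>x. s n x - f x) < e\<^sup>2" ..
        then have "\<forall>n\<ge>N. sqrt (nsq S (\<lambda>x. s n x - f x)) < e" 
          using real_less_lsqrt[OF less_imp_le[OF \<open>0 < e\<close>]] by blast
        then show "\<exists>N. \<forall>n\<ge>N. s n \<in> ell2 S \<and> sqrt (nsq S (\<lambda>x. ?pr (s n) x - ?pr f x)) < e"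
          using s f by auto
      qed
      then show "\<exists>f. limitin M.mtopology s f sequentially" by blast
    qed
    then show ?thesis unfolding d l2.carrier_eq .
  qed
  moreover have "f = (\<lambda>x. 0)" if "f \<in> ell2 S" "ip S f f = 0" for f
    using nsq_eq_0[OF that(1)] that(2) by (simp add: ip_self)
  ultimately show ?thesis
    unfolding complex_hilbert_space_def complex_hilbert_space_axioms_def l2.carrier_eq l2.cinner_eq l2.zero_eq
    by (auto simp: l2.add_eq l2.smult_eq ip_add_right ip_scale_right ip_self intro: ip_commute)
qed

section \<open>Tensor powers and change of basis\<close>

lemma tuples_0 [simp]: "tuples 0 S = {[]}"
  by (auto simp: tuples_def)

lemma tuples_nth: "xs \<in> tuples k S \<Longrightarrow> i < k \<Longrightarrow> xs ! i \<in> S"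
  by (auto simp: tuples_def)

lemma tuples_length: "xs \<in> tuples k S \<Longrightarrow> length xs = k"
  by (auto simp: tuples_def)

lemma tuplesI: "length xs = k \<Longrightarrow> (\<And>i. i < k \<Longrightarrow> xs ! i \<in> S) \<Longrightarrow> xs \<in> tuples k S"
  by (auto simp: tuples_def in_set_conv_nth)

lemma tuples_eqI: "xs \<in> tuples k S \<Longrightarrow> ys \<in> tuples k S' \<Longrightarrow> (\<And>i. i < k \<Longrightarrow> xs ! i = ys ! i) \<Longrightarrow> xs = ys"
  by (auto simp: tuples_def intro: nth_equalityI)

lemma bij_betw_tuples: "bij_betw (\<lambda>g. map g [0..<k]) (PiE {..<k} (\<lambda>_. S)) (tuples k S)"
proof (rule bij_betwI[where g = "\<lambda>ws. restrict (\<lambda>i. ws ! i) {..<k}"])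
  show "(\<lambda>g. map g [0..<k]) \<in> (PiE {..<k} (\<lambda>_. S)) \<rightarrow> tuples k S"
  proof
    fix g assume g: "g \<in> PiE {..<k} (\<lambda>_. S)"
    show "map g [0..<k] \<in> tuples k S" by (rule tuplesI) (use PiE_mem[OF g] in simp_all)
  qed
  show "(\<lambda>ws. restrict (\<lambda>i. ws ! i) {..<k}) \<in> tuples k S \<rightarrow> (PiE {..<k} (\<lambda>_. S))"
  proof
    fix ws assume ws: "ws \<in> tuples k S"
    show "restrict (\<lambda>i. ws ! i) {..<k} \<in> (PiE {..<k} (\<lambda>_. S))"
      by (rule PiE_I) (use tuples_nth[OF ws] in simp_all)
  qed
  show "restrict (\<lambda>i. map g [0..<k] ! i) {..<k} = g" if g: "g \<in> PiE {..<k} (\<lambda>_. S)" for g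
  proof
    fix i show "restrict (\<lambda>i. map g [0..<k] ! i) {..<k} i = g i"
      by (cases "i < k") (use PiE_arb[OF g, of i] in simp_all)
  qed
  show "map (restrict (\<lambda>i. ws ! i) {..<k}) [0..<k] = ws" if ws: "ws \<in> tuples k S" for ws
    by (rule nth_equalityI) (use tuples_length[OF ws] in simp_all)
qed

lemma finite_tuples: "finite S \<Longrightarrow> finite (tuples k S)"
  using bij_betw_finite[OF bij_betw_tuples, of k S] by (simp add: finite_PiE)

lemma sum_tuples_prod:
  fixes f :: "nat \<Rightarrow> 'a \<Rightarrow> 'b :: comm_semiring_1"
  assumes "finite S"
  shows "(\<Sum>ws\<in>tuples k S. \<Prod>i<k. f i (ws ! i)) = (\<Prod>i<k. \<Sum>w\<in>S. f i w)"
proof -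
  have "(\<Sum>ws\<in>tuples k S. \<Prod>i<k. f i (ws ! i)) = (\<Sum>g\<in>PiE {..<k} (\<lambda>_. S). \<Prod>i<k. f i (map g [0..<k] ! i))"
    by (rule sum.reindex_bij_betw[OF bij_betw_tuples, symmetric])
  also have "\<dots> = (\<Sum>g\<in>PiE {..<k} (\<lambda>_. S). \<Prod>i<k. f i (g i))" by simp
  also have "\<dots> = (\<Prod>i<k. \<Sum>w\<in>S. f i w)" using assms by (subst prod_sum_PiE) auto
  finally show ?thesis .
qed

lemma infsum_tuples_prod:
  fixes f :: "nat \<Rightarrow> 'a \<Rightarrow> complex"
  assumes "\<And>i. i < k \<Longrightarrow> (\<lambda>w. norm (f i w)) summable_on S"
  shows "(\<Sum>\<^sub>\<infinity>ws\<in>tuples k S. \<Prod>i<k. f i (ws ! i)) = (\<Prod>i<k. \<Sum>\<^sub>\<infinity>w\<in>S. f i w)"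
proof -
  have "(\<Sum>\<^sub>\<infinity>ws\<in>tuples k S. \<Prod>i<k. f i (ws ! i)) = (\<Sum>\<^sub>\<infinity>g\<in>PiE {..<k} (\<lambda>_. S). \<Prod>i<k. f i (map g [0..<k] ! i))"
    by (rule infsum_reindex_bij_betw[OF bij_betw_tuples, symmetric])
  also have "\<dots> = (\<Sum>\<^sub>\<infinity>g\<in>PiE {..<k} (\<lambda>_. S). \<Prod>i<k. f i (g i))" by simp
  also have "\<dots> = (\<Prod>i<k. \<Sum>\<^sub>\<infinity>w\<in>S. f i w)" using assms by (intro infsum_prod_PiE_abs) auto
  finally show ?thesis .
qed

text \<open>
  Elementary tensors.
\<close>

definition tprod :: "nat \<Rightarrow> 'x set \<Rightarrow> ('x \<Rightarrow> complex) list \<Rightarrow> 'x list \<Rightarrow> complex" where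
  "tprod k S fs = (\<lambda>xs. if xs \<in> tuples k S then \<Prod>i<k. (fs ! i) (xs ! i) else 0)"

text \<open>
  A finite set of tuples lies in a finite power, over which the sum of products factorizes.
\<close>

lemma tprod_ell2:
  assumes fs: "fs \<in> tuples k (ell2 S)"
  shows "tprod k S fs \<in> ell2 (tuples k S)"
proof (rule ell2_bounded_sums(1)[where C = "\<Prod>i<k. nsq S (fs ! i)"])
  fix F assume F: "finite F" "F \<subseteq> tuples k S"
  define G where "G = (\<Union>xs\<in>F. set xs)"
  have G: "finite G" "G \<subseteq> S" "F \<subseteq> tuples k G" using F by (auto simp: G_def tuples_def)
  have "(\<Sum>xs\<in>F. (cmod (tprod k S fs xs))\<^sup>2) \<le> (\<Sum>xs\<in>tuples k G. (cmod (tprod k S fs xs))\<^sup>2)"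
    using G by (intro sum_mono2 finite_tuples) auto
  also have "\<dots> = (\<Sum>xs\<in>tuples k G. \<Prod>i<k. (cmod ((fs ! i) (xs ! i)))\<^sup>2)"
    using G by (intro sum.cong refl) (auto simp: tprod_def prod_norm[symmetric] prod_power_distrib tuples_def)
  also have "\<dots> = (\<Prod>i<k. \<Sum>x\<in>G. (cmod ((fs ! i) x))\<^sup>2)" by (rule sum_tuples_prod[OF G(1)])
  also have "\<dots> \<le> (\<Prod>i<k. nsq S (fs ! i))"
    using G fs by (intro prod_mono) (auto intro!: sum_nonneg finite_sum_le_nsq tuples_nth)
  finally show "(\<Sum>xs\<in>F. (cmod (tprod k S fs xs))\<^sup>2) \<le> (\<Prod>i<k. nsq S (fs ! i))" .
qed (auto simp: tprod_def)

lemma ip_tprod: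
  assumes fs: "fs \<in> tuples k (ell2 S)" and gs: "gs \<in> tuples k (ell2 S)"
  shows "ip (tuples k S) (tprod k S fs) (tprod k S gs) = (\<Prod>i<k. ip S (fs ! i) (gs ! i))"
proof -
  have "ip (tuples k S) (tprod k S fs) (tprod k S gs) = 
     (\<Sum>\<^sub>\<infinity>xs\<in>tuples k S. \<Prod>i<k. cnj ((fs ! i) (xs ! i)) * (gs ! i) (xs ! i))"
    unfolding ip_def by (intro infsum_cong) (simp add: tprod_def prod.distrib)
  also have "\<dots> = (\<Prod>i<k. ip S (fs ! i) (gs ! i))"
    unfolding ip_def using fs gs by (intro infsum_tuples_prod ip_abs_summable tuples_nth)
  finally show ?thesis .
qed

lemma orthonormal_family_tprod:
  assumes e: "orthonormal_family X Y e"
  shows "orthonormal_family (tuples k X) (tuples k Y) (\<lambda>ys. tprod k X (map e ys))"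
  unfolding orthonormal_family_def
proof (intro conjI ballI)
  have mem: "map e ys \<in> tuples k (ell2 X)" if "ys \<in> tuples k Y" for ys
    using that e by (auto simp: tuples_def orthonormal_family_def)
  show "tprod k X (map e ys) \<in> ell2 (tuples k X)" if "ys \<in> tuples k Y" for ys
    by (rule tprod_ell2[OF mem[OF that]])
  fix ys zs assume ys: "ys \<in> tuples k Y" and zs: "zs \<in> tuples k Y"
  have "ip (tuples k X) (tprod k X (map e ys)) (tprod k X (map e zs)) = (\<Prod>i<k. if ys ! i = zs ! i then 1 else 0)"
    unfolding ip_tprod[OF mem[OF ys] mem[OF zs]]
    using e ys zs by (intro prod.cong) (auto simp: orthonormal_family_def tuples_length tuples_nth)
  also have "\<dots> = (if ys = zs then 1 else 0)"
  proof (cases "ys = zs")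
    case False
    then obtain i where "i < k" "ys ! i \<noteq> zs ! i" using tuples_eqI[OF ys zs] by blast
    then show ?thesis using False by (auto intro!: prod_zero)
  qed simp
  finally show "ip (tuples k X) (tprod k X (map e ys)) (tprod k X (map e zs)) = (if ys = zs then 1 else 0)" .
qed

lemma synth_inverse:
  assumes e: "orthonormal_family X Y e" and r: "orthonormal_family Y X r"
    and cnj: "\<And>x y. x \<in> X \<Longrightarrow> y \<in> Y \<Longrightarrow> r x y = cnj (e y x)"
    and c: "c \<in> ell2 Y"
  shows "synth Y X r (synth X Y e c) = c"
proof
  fix y show "synth Y X r (synth X Y e c) y = c y"
  proof (cases "y \<in> Y")
    case True
    have "synth Y X r (synth X Y e c) y = ip X (e y) (synth X Y e c)"
      unfolding synth_def[of Y X] ip_def using True by (auto simp: cnj mult.commute intro!: infsum_cong)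
    then show ?thesis using ip_synth_basis[OF e True c] by simp
  qed (use ell2_outside[OF c] in \<open>simp add: synth_def\<close>)
qed

context
  fixes W :: "'x set" and B :: "('x \<Rightarrow> complex) set"
  assumes B: "orthonormal_basis (l2_space W) B"
begin

lemma basis_family: "orthonormal_family W B (\<lambda>b. b)"
  using B by (auto simp: orthonormal_basis_def orthonormal_def orthonormal_family_def)

text \<open>
  The difference of \<open>f\<close> and its expansion is orthogonal to the basis, hence zero by maximality.
\<close>

lemma basis_expansion:
  assumes f: "f \<in> ell2 W"
  shows "synth W B (\<lambda>b. b) (\<lambda>b. if b \<in> B then ip W b f else 0) = f"
proof -
  let ?c = "\<lambda>b. if b \<in> B then ip W b f else 0"
  let ?g = "synth W B (\<lambda>b. b) ?c"
  have c: "?c \<in> ell2 B" by (rule Bessel_infinite[OF basis_family f])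
  have g: "?g \<in> ell2 W" by (rule synth_contraction[OF basis_family c])
  have "ip W b (\<lambda>x. f x - ?g x) = 0" if "b \<in> B" for b
  proof -
    have "b \<in> ell2 W" using basis_family that by (auto simp: orthonormal_family_def)
    then have "ip W b (\<lambda>x. f x - ?g x) = ip W b f - ip W b ?g" by (rule ip_diff_right[OF _ f g])
    also have "ip W b ?g = ip W b f" using ip_synth_basis[OF basis_family that c] that by simp
    finally show ?thesis by simp
  qed
  then have "(\<lambda>x. f x - ?g x) = (\<lambda>x. 0)"
    using B ell2_diff[OF f g] by (auto simp: orthonormal_basis_def)
  then show ?thesis by (auto simp: fun_eq_iff)
qed

definition row :: "'x \<Rightarrow> ('x \<Rightarrow> complex) \<Rightarrow> complex" where
  "row w = (\<lambda>b. if b \<in> B then cnj (b w) else 0)"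

text \<open>
  The Parseval identity for the vectors \<open>delta v\<close> and \<open>delta w\<close>.
\<close>

lemma row_family: "orthonormal_family B W row"
  unfolding orthonormal_family_def[of B W]
proof (intro conjI ballI)
  show "row w \<in> ell2 B" if "w \<in> W" for w
    unfolding row_def by (rule synth_rows[OF basis_family that])
  fix v w assume v: "v \<in> W" and w: "w \<in> W"
  have c: "(\<lambda>b. if b \<in> B then ip W b (delta w) else 0) = row w" using w by (auto simp: row_def)
  have "ip B (row v) (row w) = synth W B (\<lambda>b. b) (row w) v"
    unfolding row_def by (rule synth_eq_ip[OF basis_family v, symmetric])
  also have "\<dots> = delta w v" using basis_expansion[OF delta_ell2[OF w]] unfolding c by simp
  finally show "ip B (row v) (row w) = (if v = w then 1 else 0)" by (simp add: delta_def)
qed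

end

text \<open>
  The matrix of coordinates \<open>(w, b) \<mapsto> b w\<close> of the chosen basis \<open>B\<close> has orthonormal rows and columns,
  and so do its tensor powers.  They define the unitary \<open>\<Theta> k\<close> from the square summable families on
  \<open>k\<close>-tuples of basis vectors to those on \<open>k\<close>-tuples of elements of \<open>W\<close>, with inverse \<open>\<Theta>' k\<close>.
\<close>

locale basis_change =
  fixes W :: "'x set" and H :: "('x \<Rightarrow> complex) cinner_space" and B :: "('x \<Rightarrow> complex) set"
  defines "H \<equiv> l2_space W" and "B \<equiv> some_onb H"
begin

sublocale H: ell2_model H W
  unfolding H_def by (rule l2.ell2_model_axioms)

sublocale T: ell2_model "tensor_space H k" "tuples k B" for k
  by unfold_locales (auto simp: tensor_space_def B_def ell2_def ip_def)

lemma basis: "orthonormal_basis (l2_space W) B"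
  using someI[of "orthonormal_basis H", OF H.orthonormal_basis_delta]
  by (simp add: B_def some_onb_def H_def)

lemma basis_ell2: "b \<in> B \<Longrightarrow> b \<in> ell2 W"
  using basis_family[OF basis] by (auto simp: orthonormal_family_def)

lemma columns: "orthonormal_family (tuples k W) (tuples k B) (tprod k W)"
  using orthonormal_family_tprod[OF basis_family[OF basis], of k] by simp

definition rows :: "nat \<Rightarrow> 'x list \<Rightarrow> ('x \<Rightarrow> complex) list \<Rightarrow> complex" where
  "rows k ws = tprod k B (map (row B) ws)"

lemma rows: "orthonormal_family (tuples k B) (tuples k W) (rows k)"
  unfolding rows_def by (rule orthonormal_family_tprod[OF row_family[OF basis]])

lemma rows_eq: "ws \<in> tuples k W \<Longrightarrow> bs \<in> tuples k B \<Longrightarrow> rows k ws bs = cnj (tprod k W bs ws)"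
  by (auto simp: rows_def tprod_def row_def[OF basis] tuples_length tuples_nth intro!: prod.cong)

definition \<Theta> :: "nat \<Rightarrow> (('x \<Rightarrow> complex) list \<Rightarrow> complex) \<Rightarrow> 'x list \<Rightarrow> complex" where
  "\<Theta> k = synth (tuples k W) (tuples k B) (tprod k W)"

definition \<Theta>' :: "nat \<Rightarrow> ('x list \<Rightarrow> complex) \<Rightarrow> ('x \<Rightarrow> complex) list \<Rightarrow> complex" where
  "\<Theta>' k = synth (tuples k B) (tuples k W) (rows k)"

lemma \<Theta>_ell2: "f \<in> ell2 (tuples k B) \<Longrightarrow> \<Theta> k f \<in> ell2 (tuples k W)"
  unfolding \<Theta>_def by (rule synth_contraction[OF columns])

lemma \<Theta>'_ell2: "f \<in> ell2 (tuples k W) \<Longrightarrow> \<Theta>' k f \<in> ell2 (tuples k B)"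
  unfolding \<Theta>'_def by (rule synth_contraction[OF rows])

lemma \<Theta>'_\<Theta>: "f \<in> ell2 (tuples k B) \<Longrightarrow> \<Theta>' k (\<Theta> k f) = f"
  unfolding \<Theta>_def \<Theta>'_def by (rule synth_inverse[OF columns rows]) (simp_all add: rows_eq)

lemma \<Theta>_\<Theta>': "f \<in> ell2 (tuples k W) \<Longrightarrow> \<Theta> k (\<Theta>' k f) = f"
  unfolding \<Theta>_def \<Theta>'_def by (rule synth_inverse[OF rows columns]) (simp_all add: rows_eq)

lemma ip_\<Theta>: "f \<in> ell2 (tuples k B) \<Longrightarrow> g \<in> ell2 (tuples k B) \<Longrightarrow> 
    ip (tuples k W) (\<Theta> k f) (\<Theta> k g) = ip (tuples k B) f g"
  unfolding \<Theta>_def by (rule synth_isometry[OF columns])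

lemma ip_\<Theta>': "f \<in> ell2 (tuples k W) \<Longrightarrow> g \<in> ell2 (tuples k W) \<Longrightarrow> 
    ip (tuples k B) (\<Theta>' k f) (\<Theta>' k g) = ip (tuples k W) f g"
  unfolding \<Theta>'_def by (rule synth_isometry[OF rows])

lemma nsq_\<Theta>: "f \<in> ell2 (tuples k B) \<Longrightarrow> nsq (tuples k W) (\<Theta> k f) = nsq (tuples k B) f"
  by (simp add: nsq_ip ip_\<Theta>)

lemma nsq_\<Theta>': "f \<in> ell2 (tuples k W) \<Longrightarrow> nsq (tuples k B) (\<Theta>' k f) = nsq (tuples k W) f"
  by (simp add: nsq_ip ip_\<Theta>')

lemma \<Theta>_add: "f \<in> ell2 (tuples k B) \<Longrightarrow> g \<in> ell2 (tuples k B) \<Longrightarrow> \<Theta> k (\<lambda>x. f x + g x) = (\<lambda>x. \<Theta> k f x + \<Theta> k g x)"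
  unfolding \<Theta>_def by (rule synth_add[OF columns])

lemma \<Theta>_scale: "\<Theta> k (\<lambda>x. d * f x) = (\<lambda>x. d * \<Theta> k f x)"
  unfolding \<Theta>_def by (rule synth_scale[OF columns])

lemma \<Theta>'_add: "f \<in> ell2 (tuples k W) \<Longrightarrow> g \<in> ell2 (tuples k W) \<Longrightarrow> \<Theta>' k (\<lambda>x. f x + g x) = (\<lambda>x. \<Theta>' k f x + \<Theta>' k g x)"
  unfolding \<Theta>'_def by (rule synth_add[OF rows])

lemma \<Theta>'_scale: "\<Theta>' k (\<lambda>x. d * f x) = (\<lambda>x. d * \<Theta>' k f x)"
  unfolding \<Theta>'_def by (rule synth_scale[OF rows])

lemma tensor_vec_eq:
  assumes "length xs = k"
  shows "tensor_vec H xs = tprod k B (map (\<lambda>x b. if b \<in> B then ip W b x else 0) xs)"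
proof
  fix bs
  show "tensor_vec H xs bs = tprod k B (map (\<lambda>x b. if b \<in> B then ip W b x else 0) xs) bs"
  proof (cases "bs \<in> tuples k B")
    case True
    then show ?thesis using assms
      by (auto simp: tensor_vec_def tprod_def B_def[symmetric] tuples_nth intro!: prod.cong)
  qed (use assms in \<open>simp add: tensor_vec_def tprod_def B_def\<close>)
qed

lemma tensor_vec_ell2: 
  assumes "xs \<in> tuples k (ell2 W)" shows "tensor_vec H xs \<in> ell2 (tuples k B)"
  unfolding tensor_vec_eq[OF tuples_length[OF assms]]
  by (rule tprod_ell2, rule tuplesI) 
     (use assms in \<open>auto simp: tuples_length intro!: Bessel_infinite(1)[OF basis_family[OF basis]] tuples_nth\<close>)

lemma \<Theta>_tensor_vec:
  assumes xs: "xs \<in> tuples k (ell2 W)"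
  shows "\<Theta> k (tensor_vec H xs) = tprod k W xs"
proof
  let ?c = "\<lambda>x b. if b \<in> B then ip W b x else 0"
  fix ws show "\<Theta> k (tensor_vec H xs) ws = tprod k W xs ws"
  proof (cases "ws \<in> tuples k W")
    case True
    have "\<Theta> k (tensor_vec H xs) ws = ip (tuples k B) (rows k ws) (tensor_vec H xs)"
      unfolding \<Theta>_def ip_def synth_def using True by (auto simp: rows_eq mult.commute intro!: infsum_cong)
    also have "\<dots> = (\<Prod>i<k. ip B (map (row B) ws ! i) (map ?c xs ! i))"
      unfolding rows_def tensor_vec_eq[OF tuples_length[OF xs]]
    proof (rule ip_tprod)
      show "map (row B) ws \<in> tuples k (ell2 B)"
        by (rule tuplesI) (use True row_family[OF basis] in \<open>auto simp: tuples_length tuples_nth orthonormal_family_def\<close>)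
      show "map ?c xs \<in> tuples k (ell2 B)"
        by (rule tuplesI) (use xs in \<open>auto simp: tuples_length intro!: Bessel_infinite(1)[OF basis_family[OF basis]] tuples_nth\<close>)
    qed
    also have "\<dots> = (\<Prod>i<k. (xs ! i) (ws ! i))"
    proof (rule prod.cong[OF refl])
      fix i assume "i \<in> {..<k}"
      then have i: "i < length ws" "i < length xs" "ws ! i \<in> W" "xs ! i \<in> ell2 W"
        using True xs by (auto simp: tuples_length tuples_nth)
      have "ip B (row B (ws ! i)) (?c (xs ! i)) = synth W B (\<lambda>b. b) (?c (xs ! i)) (ws ! i)"
        unfolding row_def[OF basis] by (rule synth_eq_ip[OF basis_family[OF basis] i(3), symmetric])
      then show "ip B (map (row B) ws ! i) (map ?c xs ! i) = (xs ! i) (ws ! i)"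
        using basis_expansion[OF basis i(4)] i by simp
    qed
    finally show ?thesis using True by (simp add: tprod_def)
  qed (simp add: \<Theta>_def synth_def tprod_def)
qed

lemma tensor_vec_basis:
  assumes bs: "bs \<in> tuples k B" shows "tensor_vec H bs = delta bs"
proof
  fix cs show "tensor_vec H bs cs = delta bs cs"
  proof (cases "cs \<in> tuples k B")
    case True
    have "tensor_vec H bs cs = (\<Prod>i<k. if cs ! i = bs ! i then 1 else 0)"
      using True bs basis_family[OF basis]
      by (auto simp: tensor_vec_def B_def[symmetric] tuples_length tuples_nth orthonormal_family_def intro!: prod.cong)
    also have "\<dots> = delta bs cs"
    proof (cases "cs = bs")
      case False
      then obtain i where "i < k" "cs ! i \<noteq> bs ! i" using tuples_eqI[OF True bs] by blast
      then show ?thesis using False by (auto simp: delta_def intro!: prod_zero)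
    qed (simp add: delta_def)
    finally show ?thesis .
  next
    case False
    then show ?thesis using bs by (auto simp: tensor_vec_def B_def[symmetric] tuples_length delta_def)
  qed
qed

text \<open>
  The canonical basis vectors of the tensor power are themselves elementary tensors, so that a bounded
  operator is determined by its values on elementary tensors.
\<close>

lemma tensor_op_eqI:
  assumes As: "length As = k" and T: "T \<in> bounded_ops (tensor_space H k)"
    and el: "\<And>xs. xs \<in> tuples k (ell2 W) \<Longrightarrow> T (tensor_vec H xs) = tensor_vec H (map2 (\<lambda>A x. A x) As xs)"
  shows "tensor_op H As = T"
  unfolding tensor_op_def As
proof (rule the_equality)
  show "T \<in> bounded_ops (tensor_space H k) \<and> 
      (\<forall>xs\<in>tuples k (carrier H). T (tensor_vec H xs) = tensor_vec H (map2 (\<lambda>A x. A x) As xs))"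
    using T el by simp
  fix T' assume T': "T' \<in> bounded_ops (tensor_space H k) \<and> 
      (\<forall>xs\<in>tuples k (carrier H). T' (tensor_vec H xs) = tensor_vec H (map2 (\<lambda>A x. A x) As xs))"
  show "T' = T"
  proof (rule T.bounded_ops_eqI[OF _ T])
    fix bs assume bs: "bs \<in> tuples k B"
    then have "bs \<in> tuples k (ell2 W)" using basis_ell2 by (auto simp: tuples_def)
    then have "T' (tensor_vec H bs) = T (tensor_vec H bs)" using T' el by simp
    then show "T' (delta bs) = T (delta bs)" by (simp only: tensor_vec_basis[OF bs])
  qed (use T' in blast)
qed

end

section \<open>Channels given by permutations\<close>

lemma (in ell2_model) bounded_ops_linear_combination:
  assumes "finite I" "\<And>i. i \<in> I \<Longrightarrow> A i \<in> bounded_ops H"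
  shows "(\<lambda>f\<in>ell2 S. \<lambda>x. \<Sum>i\<in>I. c i * A i f x) \<in> bounded_ops H"
proof -
  have "\<forall>i\<in>I. \<exists>C. \<forall>f\<in>ell2 S. sqrt (nsq S (A i f)) \<le> C * sqrt (nsq S f)"
    using bounded_opsD(5)[OF assms(2)] by fast
  then obtain C where C: "\<And>i f. i \<in> I \<Longrightarrow> f \<in> ell2 S \<Longrightarrow> sqrt (nsq S (A i f)) \<le> C i * sqrt (nsq S f)"
    by metis
  have A2: "A i f \<in> ell2 S" if "i \<in> I" "f \<in> ell2 S" for i f
    using bounded_opsD(1)[OF assms(2)[OF that(1)] that(2)] .
  have bound: "sqrt (nsq S (\<lambda>x. \<Sum>i\<in>J. c i * A i f x)) \<le> (\<Sum>i\<in>J. cmod (c i) * C i) * sqrt (nsq S f)"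
    if "J \<subseteq> I" "f \<in> ell2 S" for J f
    using finite_subset[OF that(1) assms(1)] that(1)
  proof (induction J rule: finite_induct)
    case (insert i J)
    have "sqrt (nsq S (\<lambda>x. c i * A i f x + (\<Sum>i\<in>J. c i * A i f x))) \<le> 
      sqrt (nsq S (\<lambda>x. c i * A i f x)) + sqrt (nsq S (\<lambda>x. \<Sum>i\<in>J. c i * A i f x))"
      using insert that(2) by (intro nsq_triangle ell2_scale ell2_frame_sum A2) auto
    also have "sqrt (nsq S (\<lambda>x. c i * A i f x)) = cmod (c i) * sqrt (nsq S (A i f))"
      by (simp add: nsq_scale real_sqrt_mult)
    also have "\<dots> \<le> cmod (c i) * (C i * sqrt (nsq S f))"
      using insert that(2) by (intro mult_left_mono C) auto
    finally show ?case using insert by (simp add: distrib_right mult.assoc)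
  qed simp
  show ?thesis
  proof (rule bounded_opsI[where C = "\<Sum>i\<in>I. cmod (c i) * C i"])
    fix f assume f: "f \<in> ell2 S"
    show "(\<lambda>f\<in>ell2 S. \<lambda>x. \<Sum>i\<in>I. c i * A i f x) f \<in> ell2 S"
      using f by (simp add: ell2_frame_sum A2)
    show "sqrt (nsq S ((\<lambda>f\<in>ell2 S. \<lambda>x. \<Sum>i\<in>I. c i * A i f x) f)) \<le> (\<Sum>i\<in>I. cmod (c i) * C i) * sqrt (nsq S f)"
      using bound[OF order_refl f] f by simp
    show "(\<lambda>f\<in>ell2 S. \<lambda>x. \<Sum>i\<in>I. c i * A i f x) (\<lambda>x. d * f x) = (\<lambda>x. d * (\<lambda>f\<in>ell2 S. \<lambda>x. \<Sum>i\<in>I. c i * A i f x) f x)" for d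
    proof
      fix x
      have "(\<Sum>i\<in>I. c i * A i (\<lambda>x. d * f x) x) = (\<Sum>i\<in>I. d * (c i * A i f x))"
        by (intro sum.cong refl) (simp add: bounded_opsD(4)[OF assms(2) f] mult_ac)
      then show "(\<lambda>f\<in>ell2 S. \<lambda>x. \<Sum>i\<in>I. c i * A i f x) (\<lambda>x. d * f x) x = d * (\<lambda>f\<in>ell2 S. \<lambda>x. \<Sum>i\<in>I. c i * A i f x) f x"
        using f by (simp add: ell2_scale sum_distrib_left)
    qed
    fix g assume g: "g \<in> ell2 S"
    show "(\<lambda>f\<in>ell2 S. \<lambda>x. \<Sum>i\<in>I. c i * A i f x) (\<lambda>x. f x + g x) = 
       (\<lambda>x. (\<lambda>f\<in>ell2 S. \<lambda>x. \<Sum>i\<in>I. c i * A i f x) f x + (\<lambda>f\<in>ell2 S. \<lambda>x. \<Sum>i\<in>I. c i * A i f x) g x)"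
    proof
      fix x
      have "(\<Sum>i\<in>I. c i * A i (\<lambda>x. f x + g x) x) = (\<Sum>i\<in>I. c i * A i f x + c i * A i g x)"
        by (intro sum.cong refl) (simp add: bounded_opsD(3)[OF assms(2) f g] distrib_left)
      then show "(\<lambda>f\<in>ell2 S. \<lambda>x. \<Sum>i\<in>I. c i * A i f x) (\<lambda>x. f x + g x) x = 
       (\<lambda>f\<in>ell2 S. \<lambda>x. \<Sum>i\<in>I. c i * A i f x) f x + (\<lambda>f\<in>ell2 S. \<lambda>x. \<Sum>i\<in>I. c i * A i f x) g x"
        using f g by (simp add: ell2_add sum.distrib)
    qed
  qed simp
qed

lemma matrix_entropy_cong:
  assumes "\<And>i j. i \<in> I \<Longrightarrow> j \<in> I \<Longrightarrow> G i j = G' i j"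
  shows "matrix_entropy I G = matrix_entropy I G'"
proof -
  have "herm_form I G x y = herm_form I G' x y" for x y
    unfolding herm_form_def by (intro sum.cong refl) (simp add: assms)
  then show ?thesis unfolding matrix_entropy_def diagonalizes_def by simp
qed

definition involution_on :: "'x set \<Rightarrow> ('x \<Rightarrow> 'x) \<Rightarrow> bool" where
  "involution_on X \<tau> \<longleftrightarrow> (\<forall>x\<in>X. \<tau> x \<in> X \<and> \<tau> (\<tau> x) = x)"

definition permop :: "'x set \<Rightarrow> ('x \<Rightarrow> 'x) \<Rightarrow> ('x \<Rightarrow> complex) \<Rightarrow> 'x \<Rightarrow> complex" where
  "permop X \<tau> f = (\<lambda>x. if x \<in> X then f (\<tau> x) else 0)"

lemma involution_bij: "involution_on X \<tau> \<Longrightarrow> bij_betw \<tau> X X"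
  by (rule bij_betwI[where g = \<tau>]) (auto simp: involution_on_def)

lemma ip_permop:
  assumes "involution_on X \<tau>" shows "ip X (permop X \<tau> f) (permop X \<tau> g) = ip X f g"
proof -
  have "ip X (permop X \<tau> f) (permop X \<tau> g) = (\<Sum>\<^sub>\<infinity>x\<in>X. cnj (f (\<tau> x)) * g (\<tau> x))"
    unfolding ip_def permop_def by (intro infsum_cong) simp
  also have "\<dots> = ip X f g"
    unfolding ip_def by (rule infsum_reindex_bij_betw[OF involution_bij[OF assms]])
  finally show ?thesis .
qed

lemma nsq_permop: "involution_on X \<tau> \<Longrightarrow> nsq X (permop X \<tau> f) = nsq X f"
  using ip_permop[of X \<tau> f f] unfolding ip_self of_real_eq_iff .

lemma permop_ell2:
  assumes "involution_on X \<tau>" "f \<in> ell2 X" shows "permop X \<tau> f \<in> ell2 X"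
proof -
  have "(\<lambda>x. (cmod (f (\<tau> x)))\<^sup>2) summable_on X"
    using summable_on_reindex_bij_betw[OF involution_bij[OF assms(1)], of "\<lambda>x. (cmod (f x))\<^sup>2"] ell2_summable[OF assms(2)]
    by simp
  then have "(\<lambda>x. (cmod (permop X \<tau> f x))\<^sup>2) summable_on X"
    by (rule summable_on_cong[THEN iffD1, rotated]) (simp add: permop_def)
  then show ?thesis by (auto simp: ell2_def permop_def)
qed

lemma permop_permop:
  assumes "involution_on X \<tau>" "f \<in> ell2 X" shows "permop X \<tau> (permop X \<tau> f) = f"
  using assms(1) ell2_outside[OF assms(2)] by (auto simp: permop_def involution_on_def fun_eq_iff)

lemma involution_on_tuples:
  assumes \<pi>: "\<And>j. j \<in> J \<Longrightarrow> involution_on W (\<pi> j)" and I: "I \<in> tuples k J"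
  shows "involution_on (tuples k W) (map2 \<pi> I)"
proof -
  have "map2 \<pi> I ws \<in> tuples k W \<and> map2 \<pi> I (map2 \<pi> I ws) = ws" if ws: "ws \<in> tuples k W" for ws
  proof
    note l = tuples_length[OF I] tuples_length[OF ws]
    show "map2 \<pi> I ws \<in> tuples k W"
      by (rule tuplesI) (use l \<pi>[OF tuples_nth[OF I]] tuples_nth[OF ws] in \<open>simp_all add: involution_on_def\<close>)
    show "map2 \<pi> I (map2 \<pi> I ws) = ws"
      by (rule nth_equalityI) (use l \<pi>[OF tuples_nth[OF I]] tuples_nth[OF ws] in \<open>simp_all add: involution_on_def\<close>)
  qed
  then show ?thesis by (simp add: involution_on_def)
qed

text \<open>
  The uniform mixture of the unitaries that permute \<open>W\<close> by the involutions \<open>\<pi> j\<close>.  The point \<open>w\<^sub>0\<close>, whose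
  images under the \<open>\<pi> j\<close> are distinct, makes these unitaries linearly independent: evaluation of
  \<open>X (delta w\<^sub>0)\<close> at \<open>\<pi> j w\<^sub>0\<close> separates them.
\<close>

locale perm_channel = basis_change W H B for W :: "'x set" and H B +
  fixes N :: nat and \<pi> :: "nat \<Rightarrow> 'x \<Rightarrow> 'x" and w\<^sub>0 :: 'x
  assumes N: "0 < N" and inv: "\<And>j. j \<in> {1..N} \<Longrightarrow> involution_on W (\<pi> j)"
    and w\<^sub>0: "w\<^sub>0 \<in> W" and inj: "inj_on (\<lambda>j. \<pi> j w\<^sub>0) {1..N}"
begin

definition c :: complex where "c = of_real (1 / sqrt (real N))"

lemma c_sq: "c * c = 1 / of_nat N" "cnj c = c"
proof -
  have "c * c = of_real ((1 / sqrt (real N)) * (1 / sqrt (real N)))" by (simp only: c_def of_real_mult)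
  also have "(1 / sqrt (real N)) * (1 / sqrt (real N)) = 1 / real N" by simp
  finally show "c * c = 1 / of_nat N" by simp
qed (simp add: c_def)

lemma c_nonzero: "c \<noteq> 0"
  using N by (simp add: c_def)

definition E :: "nat \<Rightarrow> ('x \<Rightarrow> complex) \<Rightarrow> 'x \<Rightarrow> complex" where
  "E j = (\<lambda>f\<in>ell2 W. \<lambda>w. c * permop W (\<pi> j) f w)"

lemma E_apply: "f \<in> ell2 W \<Longrightarrow> E j f = (\<lambda>w. c * permop W (\<pi> j) f w)"
  by (simp add: E_def)

lemma E_bounded: 
  assumes "j \<in> {1..N}" shows "E j \<in> bounded_ops H"
proof (rule H.bounded_opsI[where C = "cmod c"])
  show "E j f \<in> ell2 W" if "f \<in> ell2 W" for f
    unfolding E_apply[OF that] by (intro ell2_scale permop_ell2 inv assms that)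
  show "sqrt (nsq W (E j f)) \<le> cmod c * sqrt (nsq W f)" if "f \<in> ell2 W" for f
    unfolding E_apply[OF that] nsq_scale nsq_permop[OF inv[OF assms]] by (simp add: real_sqrt_mult)
  show "E j (\<lambda>x. f x + g x) = (\<lambda>x. E j f x + E j g x)" if "f \<in> ell2 W" "g \<in> ell2 W" for f g
    using that by (auto simp: E_apply ell2_add permop_def distrib_left)
  show "E j (\<lambda>x. d * f x) = (\<lambda>x. d * E j f x)" if "f \<in> ell2 W" for f d
    using that by (auto simp: E_apply ell2_scale permop_def)
qed (simp add: E_def)

lemma E_ell2: "j \<in> {1..N} \<Longrightarrow> f \<in> ell2 W \<Longrightarrow> E j f \<in> ell2 W"
  by (rule H.bounded_opsD(1)[OF E_bounded])

lemma adjoint_E: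
  assumes j: "j \<in> {1..N}" shows "adjoint_op H (E j) = E j"
proof (rule H.adjoint_op_eqI[OF E_bounded[OF j]])
  fix f g assume f: "f \<in> ell2 W" and g: "g \<in> ell2 W"
  have "ip W (permop W (\<pi> j) f) g = ip W (permop W (\<pi> j) f) (permop W (\<pi> j) (permop W (\<pi> j) g))"
    by (simp only: permop_permop[OF inv[OF j] g])
  also have "\<dots> = ip W f (permop W (\<pi> j) g)" by (rule ip_permop[OF inv[OF j]])
  finally show "ip W (E j f) g = ip W f (E j g)"
    by (simp only: E_apply[OF f] E_apply[OF g] ip_scale_left ip_scale_right c_sq(2))
qed

lemma E_E: 
  assumes j: "j \<in> {1..N}" and f: "f \<in> ell2 W" shows "E j (E j f) = (\<lambda>x. f x / of_nat N)"
proof -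
  have "E j (E j f) = (\<lambda>x. (c * c) * permop W (\<pi> j) (permop W (\<pi> j) f) x)"
    unfolding E_apply[OF E_ell2[OF j f]] unfolding E_apply[OF f] by (auto simp: permop_def mult.assoc)
  then show ?thesis unfolding permop_permop[OF inv[OF j] f] c_sq(1) by simp
qed

lemma E_kraus: "op_sum H (\<lambda>j. op_mult H (adjoint_op H (E j)) (E j)) {1..N} = op_id H"
proof -
  have "op_sum H (\<lambda>j. op_mult H (adjoint_op H (E j)) (E j)) {1..N} = 
    (\<lambda>f\<in>ell2 W. \<lambda>x. \<Sum>j\<in>{1..N}. op_mult H (adjoint_op H (E j)) (E j) f x)"
    by (rule H.op_sum_eq) (simp_all add: adjoint_E H.op_mult_apply E_ell2)
  also have "\<dots> = (\<lambda>f\<in>ell2 W. f)"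
  proof (intro restrict_ext ext)
    fix f x assume f: "f \<in> ell2 W"
    have "(\<Sum>j\<in>{1..N}. op_mult H (adjoint_op H (E j)) (E j) f x) = (\<Sum>j\<in>{1..N}. f x / of_nat N)"
      by (intro sum.cong refl) (simp only: adjoint_E H.op_mult_apply[OF f] E_E[OF _ f])
    then show "(\<Sum>j\<in>{1..N}. op_mult H (adjoint_op H (E j)) (E j) f x) = f x" using N by simp
  qed
  finally show ?thesis by (simp add: op_id_def)
qed

lemma E_kraus_family: "kraus_family H E {1..N}"
  using E_kraus E_bounded by (auto simp: kraus_family_def)

text \<open>
  The tensor product of the Kraus operators \<open>E (J ! s)\<close>, acting on families on tuples of elements of
  \<open>W\<close>; the operator \<open>T\<close> below is the same one in the coordinates of the chosen basis.
\<close>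

definition V :: "nat \<Rightarrow> nat list \<Rightarrow> ('x list \<Rightarrow> complex) \<Rightarrow> 'x list \<Rightarrow> complex" where
  "V k J g = (\<lambda>ws. c ^ k * permop (tuples k W) (map2 \<pi> J) g ws)"

lemma tuple_involution: "J \<in> tuples k {1..N} \<Longrightarrow> involution_on (tuples k W) (map2 \<pi> J)"
  by (rule involution_on_tuples[OF inv])

lemma V_ell2: "J \<in> tuples k {1..N} \<Longrightarrow> g \<in> ell2 (tuples k W) \<Longrightarrow> V k J g \<in> ell2 (tuples k W)"
  unfolding V_def by (intro ell2_scale permop_ell2 tuple_involution)

lemma nsq_V: "J \<in> tuples k {1..N} \<Longrightarrow> nsq (tuples k W) (V k J g) = nsq (tuples k W) g / real N ^ k"
proof -
  assume J: "J \<in> tuples k {1..N}"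
  have "cmod c = 1 / sqrt (real N)" unfolding c_def norm_of_real by simp
  then have "(cmod c)\<^sup>2 = 1 / real N" by (simp add: power_divide)
  then have "(cmod (c ^ k))\<^sup>2 = 1 / real N ^ k"
    by (metis norm_power power_commutes power_mult power_one_over mult.commute)
  then show ?thesis unfolding V_def nsq_scale nsq_permop[OF tuple_involution[OF J]] by simp
qed

definition T :: "nat \<Rightarrow> nat list \<Rightarrow> (('x \<Rightarrow> complex) list \<Rightarrow> complex) \<Rightarrow> (('x \<Rightarrow> complex) list \<Rightarrow> complex)" where
  "T k J = (\<lambda>f\<in>ell2 (tuples k B). \<Theta>' k (V k J (\<Theta> k f)))"

lemma T_apply: "f \<in> ell2 (tuples k B) \<Longrightarrow> T k J f = \<Theta>' k (V k J (\<Theta> k f))"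
  by (simp add: T_def)

lemma T_ell2: "J \<in> tuples k {1..N} \<Longrightarrow> f \<in> ell2 (tuples k B) \<Longrightarrow> T k J f \<in> ell2 (tuples k B)"
  unfolding T_apply by (intro \<Theta>'_ell2 V_ell2 \<Theta>_ell2)

lemma T_bounded:
  assumes J: "J \<in> tuples k {1..N}" shows "T k J \<in> bounded_ops (tensor_space H k)"
proof (rule T.bounded_opsI[where C = 1])
  show "T k J f \<in> ell2 (tuples k B)" if "f \<in> ell2 (tuples k B)" for f
    by (rule T_ell2[OF J that])
  show "sqrt (nsq (tuples k B) (T k J f)) \<le> 1 * sqrt (nsq (tuples k B) f)" if f: "f \<in> ell2 (tuples k B)" for f
  proof -
    have "nsq (tuples k B) (T k J f) = nsq (tuples k B) f / real N ^ k"
      unfolding T_apply[OF f] nsq_\<Theta>'[OF V_ell2[OF J \<Theta>_ell2[OF f]]] nsq_V[OF J] nsq_\<Theta>[OF f] ..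
    also have "\<dots> \<le> nsq (tuples k B) f"
      using N divide_left_mono[of 1 "real N ^ k" "nsq (tuples k B) f"] by (simp add: one_le_power)
    finally show ?thesis by simp
  qed
  show "T k J (\<lambda>x. f x + g x) = (\<lambda>x. T k J f x + T k J g x)" 
    if f: "f \<in> ell2 (tuples k B)" and g: "g \<in> ell2 (tuples k B)" for f g
  proof -
    have "V k J (\<lambda>x. \<Theta> k f x + \<Theta> k g x) = (\<lambda>x. V k J (\<Theta> k f) x + V k J (\<Theta> k g) x)"
      by (auto simp: V_def permop_def distrib_left)
    then show ?thesis
      using f g by (simp add: T_apply ell2_add \<Theta>_add \<Theta>'_add V_ell2[OF J] \<Theta>_ell2)
  qed
  show "T k J (\<lambda>x. d * f x) = (\<lambda>x. d * T k J f x)" if f: "f \<in> ell2 (tuples k B)" for f d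
  proof -
    have "V k J (\<lambda>x. d * \<Theta> k f x) = (\<lambda>x. d * V k J (\<Theta> k f) x)"
      by (auto simp: V_def permop_def)
    then show ?thesis using f by (simp add: T_apply ell2_scale \<Theta>_scale \<Theta>'_scale)
  qed
qed (simp add: T_def)

lemma T_tensor_vec:
  assumes J: "J \<in> tuples k {1..N}" and xs: "xs \<in> tuples k (ell2 W)"
  shows "T k J (tensor_vec H xs) = tensor_vec H (map2 (\<lambda>A x. A x) (map E J) xs)"
proof -
  let ?ys = "map2 (\<lambda>A x. A x) (map E J) xs"
  have nth: "?ys ! i = E (J ! i) (xs ! i)" if "i < k" for i
    using that tuples_length[OF J] tuples_length[OF xs] by simp
  have ys: "?ys \<in> tuples k (ell2 W)"
  proof (rule tuplesI)
    show "length ?ys = k" using tuples_length[OF J] tuples_length[OF xs] by simp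
    show "?ys ! i \<in> ell2 W" if "i < k" for i
      unfolding nth[OF that] by (intro E_ell2 tuples_nth[OF J that] tuples_nth[OF xs that])
  qed
  have "V k J (tprod k W xs) = tprod k W ?ys"
  proof
    fix ws show "V k J (tprod k W xs) ws = tprod k W ?ys ws"
    proof (cases "ws \<in> tuples k W")
      case True
      note l = tuples_length[OF J] tuples_length[OF True]
      have "V k J (tprod k W xs) ws = c ^ k * (\<Prod>i<k. (xs ! i) (\<pi> (J ! i) (ws ! i)))"
        using tuple_involution[OF J] True l by (auto simp: V_def permop_def tprod_def involution_on_def)
      also have "\<dots> = (\<Prod>i<k. c * (xs ! i) (\<pi> (J ! i) (ws ! i)))" by (simp add: prod.distrib)
      also have "\<dots> = (\<Prod>i<k. (?ys ! i) (ws ! i))"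
        by (intro prod.cong refl) 
           (use nth E_apply[OF tuples_nth[OF xs]] tuples_nth[OF True] in \<open>simp add: permop_def\<close>)
      finally show ?thesis using True by (simp add: tprod_def)
    qed (simp add: V_def permop_def tprod_def)
  qed
  then have "T k J (tensor_vec H xs) = \<Theta>' k (\<Theta> k (tensor_vec H ?ys))"
    unfolding T_apply[OF tensor_vec_ell2[OF xs]] \<Theta>_tensor_vec[OF xs] \<Theta>_tensor_vec[OF ys] by simp
  then show ?thesis by (simp only: \<Theta>'_\<Theta>[OF tensor_vec_ell2[OF ys]])
qed

text \<open>
  Multilinearity: expanding every factor of an elementary tensor gives a sum over index tuples.
\<close>

lemma tensor_op_combination:
  fixes M :: nat
  assumes A: "\<And>i. i \<in> {1..M} \<Longrightarrow> A i = (\<lambda>f\<in>ell2 W. \<lambda>w. \<Sum>j\<in>{1..N}. \<phi> i j * E j f w)"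
    and I: "I \<in> tuples k {1..M}"
  shows "tensor_op H (map A I) =
    (\<lambda>f\<in>ell2 (tuples k B). \<lambda>bs. \<Sum>J\<in>tuples k {1..N}. (\<Prod>s<k. \<phi> (I ! s) (J ! s)) * T k J f bs)"
proof (rule tensor_op_eqI)
  show "length (map A I) = k" using tuples_length[OF I] by simp
  show "(\<lambda>f\<in>ell2 (tuples k B). \<lambda>bs. \<Sum>J\<in>tuples k {1..N}. (\<Prod>s<k. \<phi> (I ! s) (J ! s)) * T k J f bs) 
    \<in> bounded_ops (tensor_space H k)"
    by (intro T.bounded_ops_linear_combination finite_tuples T_bounded) auto
  fix xs assume xs: "xs \<in> tuples k (ell2 W)"
  note l = tuples_length[OF I] tuples_length[OF xs]
  have nth: "map2 (\<lambda>A x. A x) (map A I) xs ! s = A (I ! s) (xs ! s)" if "s < k" for s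
    using that l by simp
  show "(\<lambda>f\<in>ell2 (tuples k B). \<lambda>bs. \<Sum>J\<in>tuples k {1..N}. (\<Prod>s<k. \<phi> (I ! s) (J ! s)) * T k J f bs) (tensor_vec H xs) = 
    tensor_vec H (map2 (\<lambda>A x. A x) (map A I) xs)"
  proof
    fix bs
    have tv: "tensor_vec H ys bs = (if bs \<in> tuples k B then \<Prod>s<k. ip W (bs ! s) (ys ! s) else 0)"
      if "length ys = k" for ys using that by (simp add: tensor_vec_def B_def[symmetric])
    have "(\<Sum>J\<in>tuples k {1..N}. (\<Prod>s<k. \<phi> (I ! s) (J ! s)) * T k J (tensor_vec H xs) bs) = 
      tensor_vec H (map2 (\<lambda>A x. A x) (map A I) xs) bs"
    proof (cases "bs \<in> tuples k B")
      case True
      have "(\<Sum>J\<in>tuples k {1..N}. (\<Prod>s<k. \<phi> (I ! s) (J ! s)) * T k J (tensor_vec H xs) bs) = 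
         (\<Sum>J\<in>tuples k {1..N}. \<Prod>s<k. \<phi> (I ! s) (J ! s) * ip W (bs ! s) (E (J ! s) (xs ! s)))"
      proof (intro sum.cong refl)
        fix J assume J: "J \<in> tuples k {1..N}"
        note lJ = tuples_length[OF J]
        have "T k J (tensor_vec H xs) bs = (\<Prod>s<k. ip W (bs ! s) (map2 (\<lambda>A x. A x) (map E J) xs ! s))"
          unfolding T_tensor_vec[OF J xs] using True l lJ by (subst tv) auto
        also have "\<dots> = (\<Prod>s<k. ip W (bs ! s) (E (J ! s) (xs ! s)))"
          by (intro prod.cong refl) (use l lJ in simp)
        finally show "(\<Prod>s<k. \<phi> (I ! s) (J ! s)) * T k J (tensor_vec H xs) bs = 
          (\<Prod>s<k. \<phi> (I ! s) (J ! s) * ip W (bs ! s) (E (J ! s) (xs ! s)))" by (simp add: prod.distrib)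
      qed
      also have "\<dots> = (\<Prod>s<k. \<Sum>j\<in>{1..N}. \<phi> (I ! s) j * ip W (bs ! s) (E j (xs ! s)))"
        by (rule sum_tuples_prod) simp
      also have "\<dots> = (\<Prod>s<k. ip W (bs ! s) (map2 (\<lambda>A x. A x) (map A I) xs ! s))"
      proof (intro prod.cong refl)
        fix s assume "s \<in> {..<k}"
        then have s: "s < k" by simp
        have "ip W (bs ! s) (A (I ! s) (xs ! s)) = ip W (bs ! s) (\<lambda>w. \<Sum>j\<in>{1..N}. \<phi> (I ! s) j * E j (xs ! s) w)"
          using A[OF tuples_nth[OF I s]] tuples_nth[OF xs s] by simp
        also have "\<dots> = (\<Sum>j\<in>{1..N}. ip W (bs ! s) (\<lambda>w. \<phi> (I ! s) j * E j (xs ! s) w))"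
          by (rule ip_sum_right) (use basis_ell2 tuples_nth[OF True s] E_ell2 tuples_nth[OF xs s] in \<open>auto intro!: ell2_scale\<close>)
        finally show "(\<Sum>j\<in>{1..N}. \<phi> (I ! s) j * ip W (bs ! s) (E j (xs ! s))) = 
          ip W (bs ! s) (map2 (\<lambda>A x. A x) (map A I) xs ! s)"
          unfolding nth[OF s] ip_scale_right by simp
      qed
      also have "\<dots> = tensor_vec H (map2 (\<lambda>A x. A x) (map A I) xs) bs"
        using True l by (subst tv) auto
      finally show ?thesis .
    next
      case False
      have "T k J (tensor_vec H xs) bs = 0" if "J \<in> tuples k {1..N}" for J
        using ell2_outside[OF T_ell2[OF that tensor_vec_ell2[OF xs]] False] .
      then show ?thesis using False l by (subst tv) auto
    qed
    then show "(\<lambda>f\<in>ell2 (tuples k B). \<lambda>bs. \<Sum>J\<in>tuples k {1..N}. (\<Prod>s<k. \<phi> (I ! s) (J ! s)) * T k J f bs) (tensor_vec H xs) bs = 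
      tensor_vec H (map2 (\<lambda>A x. A x) (map A I) xs) bs"
      using tensor_vec_ell2[OF xs] by simp
  qed
qed

text \<open>
  Equality of the channels on pure states polarizes to the equality \<open>D = 0\<close> of sesquilinear forms.
  Inserting \<open>delta w\<^sub>0\<close> and the point \<open>\<pi> j w\<^sub>0\<close> in one argument isolates \<open>E j\<close>, which gives the coefficients
  \<open>\<phi>\<close>, the orthonormality of their columns, and \<open>E j\<close> as a combination of the \<open>A i\<close>.  With these, the
  sum over \<open>i\<close> of the squared differences of \<open>A i f u\<close> and its expansion cancels to zero.
\<close>

lemma kraus_freedom:
  fixes M :: nat
  assumes A: "\<And>i. i \<in> {1..M} \<Longrightarrow> A i \<in> bounded_ops H"
    and eq: "\<And>\<rho>. \<rho> \<in> trace_class H \<Longrightarrow> kraus_map H A {1..M} \<rho> = kraus_map H E {1..N} \<rho>"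
  shows "\<exists>\<phi>. (\<forall>i\<in>{1..M}. A i = (\<lambda>f\<in>ell2 W. \<lambda>w. \<Sum>j\<in>{1..N}. \<phi> i j * E j f w)) \<and>
    (\<forall>j\<in>{1..N}. \<forall>l\<in>{1..N}. (\<Sum>i\<in>{1..M}. \<phi> i j * cnj (\<phi> i l)) = (if j = l then 1 else 0))"
proof -
  have A2: "A i f \<in> ell2 W" if "i \<in> {1..M}" "f \<in> ell2 W" for i f
    using H.bounded_opsD(1)[OF A[OF that(1)] that(2)] .
  define D where "D = (\<lambda>f g u v. (\<Sum>i\<in>{1..M}. cnj (A i f v) * A i g u) - (\<Sum>j\<in>{1..N}. cnj (E j f v) * E j g u))"
  have D_pure: "D f f u v = 0" if f: "f \<in> ell2 W" "nsq W f = 1" and u: "u \<in> W" and v: "v \<in> W" for f u v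
  proof -
    have "frame_op W {1..M} (\<lambda>i. A i f) = frame_op W {1..N} (\<lambda>j. E j f)"
    proof -
      have "kraus_map H A {1..M} (pure_state H f) = frame_op W {1..M} (\<lambda>i. A i f)"
        by (rule H.kraus_map_pure_state[OF _ A f(1)]) simp_all
      moreover have "kraus_map H E {1..N} (pure_state H f) = frame_op W {1..N} (\<lambda>j. E j f)"
        by (rule H.kraus_map_pure_state[OF _ E_bounded f(1)]) simp_all
      ultimately show ?thesis using eq[OF H.pure_state_trace_class[OF f]] by simp
    qed
    then have "frame_op W {1..M} (\<lambda>i. A i f) (delta v) u = frame_op W {1..N} (\<lambda>j. E j f) (delta v) u" by simp
    then show ?thesis using v by (simp add: H.frame_op_apply D_def)
  qed
  have D_scale: "D (\<lambda>x. d * f x) (\<lambda>x. e * g x) u v = cnj d * e * D f g u v" if "f \<in> ell2 W" "g \<in> ell2 W" for d e f g u v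
  proof -
    have "(\<Sum>i\<in>{1..M}. cnj (A i (\<lambda>x. d * f x) v) * A i (\<lambda>x. e * g x) u) = cnj d * e * (\<Sum>i\<in>{1..M}. cnj (A i f v) * A i g u)"
      unfolding sum_distrib_left
      by (intro sum.cong refl) (simp add: H.bounded_opsD(4)[OF A] that)
    moreover have "(\<Sum>j\<in>{1..N}. cnj (E j (\<lambda>x. d * f x) v) * E j (\<lambda>x. e * g x) u) = cnj d * e * (\<Sum>j\<in>{1..N}. cnj (E j f v) * E j g u)"
      unfolding sum_distrib_left
      by (intro sum.cong refl) (simp add: H.bounded_opsD(4)[OF E_bounded] that)
    ultimately show ?thesis by (simp add: D_def right_diff_distrib)
  qed
  have D_diag: "D f f u v = 0" if f: "f \<in> ell2 W" and u: "u \<in> W" and v: "v \<in> W" for f u v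
  proof (cases "nsq W f = 0")
    case True
    then have "f = (\<lambda>x. 0 * f x)" using nsq_eq_0[OF f] by simp
    then show ?thesis using D_scale[OF f f, of 0 0 u v] by simp
  next
    case False
    define r where "r = complex_of_real (1 / sqrt (nsq W f))"
    have r: "r \<noteq> 0" using False by (simp add: r_def)
    have "nsq W (\<lambda>x. r * f x) = 1"
      using False nsq_nonneg[of W f] unfolding nsq_scale r_def norm_of_real by (simp add: power_divide)
    then have "cnj r * r * D f f u v = 0"
      using D_pure[OF ell2_scale[OF f] _ u v, of r] D_scale[OF f f] by simp
    then show ?thesis using r by simp
  qed
  have D_add: "D (\<lambda>x. f x + g x) (\<lambda>x. f x + g x) u v = D f f u v + D f g u v + D g f u v + D g g u v"
    if "f \<in> ell2 W" "g \<in> ell2 W" for f g u v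
  proof -
    have "(\<Sum>i\<in>{1..M}. cnj (A i (\<lambda>x. f x + g x) v) * A i (\<lambda>x. f x + g x) u) = 
      (\<Sum>i\<in>{1..M}. cnj (A i f v) * A i f u + cnj (A i f v) * A i g u + cnj (A i g v) * A i f u + cnj (A i g v) * A i g u)"
      by (intro sum.cong refl) (simp add: H.bounded_opsD(3)[OF A] that algebra_simps)
    moreover have "(\<Sum>j\<in>{1..N}. cnj (E j (\<lambda>x. f x + g x) v) * E j (\<lambda>x. f x + g x) u) = 
      (\<Sum>j\<in>{1..N}. cnj (E j f v) * E j f u + cnj (E j f v) * E j g u + cnj (E j g v) * E j f u + cnj (E j g v) * E j g u)"
      by (intro sum.cong refl) (simp add: H.bounded_opsD(3)[OF E_bounded] that algebra_simps)
    ultimately show ?thesis by (simp add: D_def sum.distrib)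
  qed
  \<comment> \<open>Polarization with g and \<i> * g.\<close>
  have D0: "D f g u v = 0" if f: "f \<in> ell2 W" and g: "g \<in> ell2 W" and u: "u \<in> W" and v: "v \<in> W" for f g u v
  proof -
    have "D f g u v + D g f u v = 0"
      using D_add[OF f g, of u v] D_diag[OF _ u v] f g by (simp add: ell2_add)
    moreover have "\<i> * D f g u v - \<i> * D g f u v = 0"
      using D_add[OF f ell2_scale[OF g], of \<i> u v] D_diag[OF _ u v] D_scale[OF f g, of 1 \<i> u v] D_scale[OF g f, of \<i> 1 u v] f g
      by (simp add: ell2_add ell2_scale)
    then have "\<i> * (D f g u v - D g f u v) = 0" by (simp only: right_diff_distrib)
    then have "D f g u v = D g f u v" by simp
    ultimately show ?thesis by simp
  qed
  define x where "x = (delta w\<^sub>0 :: 'x \<Rightarrow> complex)"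
  have x: "x \<in> ell2 W" using w\<^sub>0 by (simp add: x_def)
  define \<phi> where "\<phi> = (\<lambda>i j. A i x (\<pi> j w\<^sub>0) / c)"
  have pw: "\<pi> j w\<^sub>0 \<in> W" if "j \<in> {1..N}" for j using inv[OF that] w\<^sub>0 by (simp add: involution_on_def)
  have Ex: "E l x (\<pi> j w\<^sub>0) = (if j = l then c else 0)" if j: "j \<in> {1..N}" and l: "l \<in> {1..N}" for j l
  proof -
    have "\<pi> l (\<pi> l w\<^sub>0) = w\<^sub>0" "\<pi> l (\<pi> l (\<pi> j w\<^sub>0)) = \<pi> j w\<^sub>0"
      using inv[OF l] pw[OF j] w\<^sub>0 by (simp_all add: involution_on_def)
    then have "\<pi> l (\<pi> j w\<^sub>0) = w\<^sub>0 \<longleftrightarrow> \<pi> j w\<^sub>0 = \<pi> l w\<^sub>0" by metis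
    also have "\<dots> \<longleftrightarrow> j = l" by (rule inj_on_eq_iff[OF inj j l])
    finally show ?thesis unfolding E_apply[OF x] using pw[OF j] by (simp add: permop_def x_def delta_def)
  qed
  \<comment> \<open>The \<phi> i j are dual coefficients: they recover E j from the A i.\<close>
  have dual: "(\<Sum>i\<in>{1..M}. cnj (\<phi> i j) * A i f u) = E j f u" if j: "j \<in> {1..N}" and f: "f \<in> ell2 W" and u: "u \<in> W" for j f u
  proof -
    have "(\<Sum>i\<in>{1..M}. cnj (A i x (\<pi> j w\<^sub>0)) * A i f u) = (\<Sum>l\<in>{1..N}. cnj (E l x (\<pi> j w\<^sub>0)) * E l f u)"
      using D0[OF x f u pw[OF j]] by (simp add: D_def)
    also have "\<dots> = (\<Sum>l\<in>{1..N}. if l = j then cnj c * E j f u else 0)"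
      by (intro sum.cong refl) (use Ex[OF j] in simp)
    also have "\<dots> = cnj c * E j f u" using j by simp
    finally have "(\<Sum>i\<in>{1..M}. cnj (A i x (\<pi> j w\<^sub>0)) * A i f u) / cnj c = E j f u" using c_nonzero by simp
    then show ?thesis by (simp add: \<phi>_def sum_divide_distrib)
  qed
  have iso: "(\<Sum>i\<in>{1..M}. \<phi> i j * cnj (\<phi> i l)) = (if j = l then 1 else 0)" if j: "j \<in> {1..N}" and l: "l \<in> {1..N}" for j l
  proof -
    have "(\<Sum>i\<in>{1..M}. \<phi> i j * cnj (\<phi> i l)) = (\<Sum>i\<in>{1..M}. cnj (\<phi> i l) * A i x (\<pi> j w\<^sub>0)) / c"
      by (simp add: \<phi>_def sum_divide_distrib mult.commute)
    also have "\<dots> = (if j = l then 1 else 0)"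
      unfolding dual[OF l x pw[OF j]] Ex[OF j l] using c_nonzero by simp
    finally show ?thesis .
  qed
  have "A i f u = (\<Sum>j\<in>{1..N}. \<phi> i j * E j f u)" if i: "i \<in> {1..M}" and f: "f \<in> ell2 W" and u: "u \<in> W" for i f u
  proof -
    let ?d = "\<lambda>i. A i f u - (\<Sum>j\<in>{1..N}. \<phi> i j * E j f u)"
    have "(\<Sum>i\<in>{1..M}. cnj (\<Sum>j\<in>{1..N}. \<phi> i j * E j f u) * A i f u) = (\<Sum>j\<in>{1..N}. cnj (E j f u) * E j f u)"
    proof -
      have "(\<Sum>i\<in>{1..M}. cnj (\<Sum>j\<in>{1..N}. \<phi> i j * E j f u) * A i f u) = 
        (\<Sum>i\<in>{1..M}. \<Sum>j\<in>{1..N}. cnj (E j f u) * (cnj (\<phi> i j) * A i f u))"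
        by (simp add: sum_distrib_right sum_distrib_left mult_ac)
      also have "\<dots> = (\<Sum>j\<in>{1..N}. \<Sum>i\<in>{1..M}. cnj (E j f u) * (cnj (\<phi> i j) * A i f u))" by (rule sum.swap)
      also have "\<dots> = (\<Sum>j\<in>{1..N}. cnj (E j f u) * E j f u)"
        unfolding sum_distrib_left[symmetric] by (intro sum.cong refl) (simp only: dual[OF _ f u])
      finally show ?thesis .
    qed
    note cross = this
    have "(\<Sum>i\<in>{1..M}. cnj (A i f u) * (\<Sum>j\<in>{1..N}. \<phi> i j * E j f u)) = cnj (\<Sum>i\<in>{1..M}. cnj (\<Sum>j\<in>{1..N}. \<phi> i j * E j f u) * A i f u)"
      by (simp add: mult.commute)
    also have "\<dots> = (\<Sum>j\<in>{1..N}. cnj (E j f u) * E j f u)" unfolding cross by (simp add: mult.commute)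
    finally have cross': "(\<Sum>i\<in>{1..M}. cnj (A i f u) * (\<Sum>j\<in>{1..N}. \<phi> i j * E j f u)) = (\<Sum>j\<in>{1..N}. cnj (E j f u) * E j f u)" .
    have "(\<Sum>i\<in>{1..M}. (\<Sum>j\<in>{1..N}. cnj (\<phi> i j) * cnj (E j f u)) * (\<Sum>j\<in>{1..N}. \<phi> i j * E j f u)) = 
       (\<Sum>j\<in>{1..N}. cnj (E j f u) * E j f u)"
      by (rule isometry_sum[where U = "\<lambda>j i. \<phi> i j"]) (simp, rule iso)
    then have sq: "(\<Sum>i\<in>{1..M}. cnj (\<Sum>j\<in>{1..N}. \<phi> i j * E j f u) * (\<Sum>j\<in>{1..N}. \<phi> i j * E j f u)) = 
       (\<Sum>j\<in>{1..N}. cnj (E j f u) * E j f u)" by simp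
    have aa: "(\<Sum>i\<in>{1..M}. cnj (A i f u) * A i f u) = (\<Sum>j\<in>{1..N}. cnj (E j f u) * E j f u)"
      using D0[OF f f u u] by (simp add: D_def)
    have "(\<Sum>i\<in>{1..M}. cnj (?d i) * ?d i) = 
      (\<Sum>i\<in>{1..M}. cnj (A i f u) * A i f u) - (\<Sum>i\<in>{1..M}. cnj (A i f u) * (\<Sum>j\<in>{1..N}. \<phi> i j * E j f u)) 
      - (\<Sum>i\<in>{1..M}. cnj (\<Sum>j\<in>{1..N}. \<phi> i j * E j f u) * A i f u)
      + (\<Sum>i\<in>{1..M}. cnj (\<Sum>j\<in>{1..N}. \<phi> i j * E j f u) * (\<Sum>j\<in>{1..N}. \<phi> i j * E j f u))"
      unfolding sum_subtractf[symmetric] sum.distrib[symmetric]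
      by (intro sum.cong refl) (simp add: left_diff_distrib right_diff_distrib)
    then have "(\<Sum>i\<in>{1..M}. cnj (?d i) * ?d i) = 0" unfolding cross cross' sq aa by simp
    moreover have "cnj z * z = of_real ((cmod z)\<^sup>2)" for z
      by (metis complex_norm_square mult.commute of_real_power)
    ultimately have "complex_of_real (\<Sum>i\<in>{1..M}. (cmod (?d i))\<^sup>2) = of_real 0"
      by (simp only: of_real_sum of_real_0)
    then have "(\<Sum>i\<in>{1..M}. (cmod (?d i))\<^sup>2) = 0" by (simp only: of_real_eq_iff)
    from sum_nonneg_0[OF _ _ this i] have "(cmod (?d i))\<^sup>2 = 0" by simp
    then show ?thesis by simp
  qed
  note A_eq = this
  have "A i = (\<lambda>f\<in>ell2 W. \<lambda>w. \<Sum>j\<in>{1..N}. \<phi> i j * E j f w)" if i: "i \<in> {1..M}" for i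
  proof (intro extensionalityI[OF H.bounded_opsD(2)[OF A[OF i]]])
    fix f assume f: "f \<in> ell2 W"
    have "A i f = (\<lambda>w. \<Sum>j\<in>{1..N}. \<phi> i j * E j f w)"
    proof (rule ell2_eqI[of _ W])
      show "(\<lambda>w. \<Sum>j\<in>{1..N}. \<phi> i j * E j f w) \<in> ell2 W" by (intro ell2_frame_sum E_ell2 f)
      show "A i f w = (\<Sum>j\<in>{1..N}. \<phi> i j * E j f w)" if "w \<in> W" for w
        by (rule A_eq[OF i f that])
    qed (rule A2[OF i f])
    then show "A i f = (\<lambda>f\<in>ell2 W. \<lambda>w. \<Sum>j\<in>{1..N}. \<phi> i j * E j f w) f" using f by simp
  qed auto
  note A_op = this
  show ?thesis by (intro exI[of _ \<phi>] conjI ballI A_op iso)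
qed

lemma tensor_power_pure_state:
  assumes \<Phi>: "\<And>\<rho>. \<rho> \<in> trace_class H \<Longrightarrow> \<Phi> \<rho> = kraus_map H E {1..N} \<rho>" and \<xi>: "\<xi> \<in> ell2 (tuples k B)"
  shows "tensor_power H k \<Phi> (pure_state (tensor_space H k) \<xi>) = frame_op (tuples k B) (tuples k {1..N}) (\<lambda>J. T k J \<xi>)"
proof -
  have "is_tensor_power H k \<Phi> (kraus_map (tensor_space H k) (\<lambda>is. tensor_op H (map E is)) (tuples k {1..N}))"
    unfolding is_tensor_power_def by (rule exI[of _ N], rule exI[of _ E]) (intro conjI ballI E_kraus_family \<Phi> refl)
  then have "\<exists>\<Psi>. is_tensor_power H k \<Phi> \<Psi>" by (rule exI[where P = "is_tensor_power H k \<Phi>"])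
  then have "is_tensor_power H k \<Phi> (tensor_power H k \<Phi>)" unfolding tensor_power_def by (rule someI_ex)
  then obtain M :: nat and A where A: "kraus_family H A {1..M}" "\<forall>\<rho>\<in>trace_class H. \<Phi> \<rho> = kraus_map H A {1..M} \<rho>"
    and \<Psi>: "tensor_power H k \<Phi> = kraus_map (tensor_space H k) (\<lambda>is. tensor_op H (map A is)) (tuples k {1..M})"
    unfolding is_tensor_power_def by (elim exE conjE) (rule that; assumption)
  have "A i \<in> bounded_ops H" if "i \<in> {1..M}" for i using A(1) that by (auto simp: kraus_family_def)
  moreover have "kraus_map H A {1..M} \<rho> = kraus_map H E {1..N} \<rho>" if "\<rho> \<in> trace_class H" for \<rho>
    using A(2) \<Phi> that by simp
  ultimately have "\<exists>\<phi>. (\<forall>i\<in>{1..M}. A i = (\<lambda>f\<in>ell2 W. \<lambda>w. \<Sum>j\<in>{1..N}. \<phi> i j * E j f w)) \<and>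
    (\<forall>j\<in>{1..N}. \<forall>l\<in>{1..N}. (\<Sum>i\<in>{1..M}. \<phi> i j * cnj (\<phi> i l)) = (if j = l then 1 else 0))"
    by (rule kraus_freedom)
  then obtain \<phi> where \<phi>: "\<forall>i\<in>{1..M}. A i = (\<lambda>f\<in>ell2 W. \<lambda>w. \<Sum>j\<in>{1..N}. \<phi> i j * E j f w)"
    and iso: "\<forall>j\<in>{1..N}. \<forall>l\<in>{1..N}. (\<Sum>i\<in>{1..M}. \<phi> i j * cnj (\<phi> i l)) = (if j = l then 1 else 0)"
    by (elim exE conjE) (rule that; assumption)
  let ?U = "\<lambda>J I. \<Prod>s<k. \<phi> (I ! s) (J ! s)"
  have top: "tensor_op H (map A I) = (\<lambda>f\<in>ell2 (tuples k B). \<lambda>bs. \<Sum>J\<in>tuples k {1..N}. ?U J I * T k J f bs)"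
    if "I \<in> tuples k {1..M}" for I by (rule tensor_op_combination[OF \<phi>[rule_format] that])
  have "tensor_power H k \<Phi> (pure_state (tensor_space H k) \<xi>) = 
    frame_op (tuples k B) (tuples k {1..M}) (\<lambda>I. tensor_op H (map A I) \<xi>)"
    unfolding \<Psi> 
    by (rule T.kraus_map_pure_state) 
       (auto simp: finite_tuples \<xi> top intro!: T.bounded_ops_linear_combination T_bounded)
  also have "\<dots> = frame_op (tuples k B) (tuples k {1..M}) (\<lambda>I bs. \<Sum>J\<in>tuples k {1..N}. ?U J I * T k J \<xi> bs)"
    unfolding frame_op_def by (intro restrict_ext ext sum.cong refl) (simp add: top \<xi>)
  also have "\<dots> = frame_op (tuples k B) (tuples k {1..N}) (\<lambda>J. T k J \<xi>)"
  proof (rule frame_op_isometry[OF finite_tuples T_ell2[OF _ \<xi>]])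
    fix J L assume J: "J \<in> tuples k {1..N}" and L: "L \<in> tuples k {1..N}"
    have "(\<Sum>I\<in>tuples k {1..M}. ?U J I * cnj (?U L I)) = 
       (\<Sum>I\<in>tuples k {1..M}. \<Prod>s<k. \<phi> (I ! s) (J ! s) * cnj (\<phi> (I ! s) (L ! s)))"
      by (simp add: prod.distrib)
    also have "\<dots> = (\<Prod>s<k. \<Sum>i\<in>{1..M}. \<phi> i (J ! s) * cnj (\<phi> i (L ! s)))"
      by (rule sum_tuples_prod) simp
    also have "\<dots> = (\<Prod>s<k. if J ! s = L ! s then 1 else 0)"
      by (intro prod.cong refl iso[rule_format] tuples_nth[OF J] tuples_nth[OF L]) auto
    also have "\<dots> = (if J = L then 1 else 0)"
    proof (cases "J = L")
      case False
      then obtain s where "s < k" "J ! s \<noteq> L ! s" using tuples_eqI[OF J L] by blast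
      then show ?thesis using False by (auto intro!: prod_zero)
    qed simp
    finally show "(\<Sum>I\<in>tuples k {1..M}. ?U J I * cnj (?U L I)) = (if J = L then 1 else 0)" .
  qed simp
  finally show ?thesis .
qed

text \<open>
  The entropy of the output of the \<open>k\<close>-th tensor power at the input \<open>g\<close>, in the coordinates of \<open>W\<close>.
\<close>

definition out_entropy :: "nat \<Rightarrow> ('x list \<Rightarrow> complex) \<Rightarrow> real" where
  "out_entropy k g = matrix_entropy (tuples k {1..N}) (gram (tuples k W) (\<lambda>J. V k J g))"

lemma entropy_tensor_power:
  assumes \<Phi>: "\<And>\<rho>. \<rho> \<in> trace_class H \<Longrightarrow> \<Phi> \<rho> = kraus_map H E {1..N} \<rho>" and \<xi>: "\<xi> \<in> ell2 (tuples k B)"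
  shows "entropy (tensor_space H k) (tensor_power H k \<Phi> (pure_state (tensor_space H k) \<xi>)) = ereal (out_entropy k (\<Theta> k \<xi>))"
proof -
  have "entropy (tensor_space H k) (tensor_power H k \<Phi> (pure_state (tensor_space H k) \<xi>)) = 
    ereal (matrix_entropy (tuples k {1..N}) (gram (tuples k B) (\<lambda>J. T k J \<xi>)))"
  proof (subst tensor_power_pure_state[OF _ \<xi>])
    show "entropy (tensor_space H k) (frame_op (tuples k B) (tuples k {1..N}) (\<lambda>J. T k J \<xi>)) = 
      ereal (matrix_entropy (tuples k {1..N}) (gram (tuples k B) (\<lambda>J. T k J \<xi>)))"
      by (rule entropy_frame_op[OF finite_tuples T_ell2[OF _ \<xi>] T.ell2_model_axioms]) simp_all
  qed (rule \<Phi>)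
  also have "matrix_entropy (tuples k {1..N}) (gram (tuples k B) (\<lambda>J. T k J \<xi>)) = out_entropy k (\<Theta> k \<xi>)"
    unfolding out_entropy_def
    by (rule matrix_entropy_cong) (simp add: gram_def T_apply[OF \<xi>] ip_\<Theta>' V_ell2 \<Theta>_ell2[OF \<xi>])
  finally show ?thesis .
qed

lemma min_output_entropy_tensor_power:
  assumes \<Phi>: "\<And>\<rho>. \<rho> \<in> trace_class H \<Longrightarrow> \<Phi> \<rho> = kraus_map H E {1..N} \<rho>"
  shows "min_output_entropy (tensor_space H k) (tensor_power H k \<Phi>) = 
    (INF g \<in> {g \<in> ell2 (tuples k W). nsq (tuples k W) g = 1}. ereal (out_entropy k g))"
proof -
  have "min_output_entropy (tensor_space H k) (tensor_power H k \<Phi>) = 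
    (INF \<xi> \<in> {\<xi> \<in> ell2 (tuples k B). nsq (tuples k B) \<xi> = 1}. ereal (out_entropy k (\<Theta> k \<xi>)))"
    unfolding min_output_entropy_def T.carrier_eq T.cnorm_eq
    by (rule INF_cong) (auto simp: entropy_tensor_power[OF \<Phi>])
  also have "\<dots> = (INF g \<in> \<Theta> k ` {\<xi> \<in> ell2 (tuples k B). nsq (tuples k B) \<xi> = 1}. ereal (out_entropy k g))"
    by (simp add: image_image)
  also have "\<Theta> k ` {\<xi> \<in> ell2 (tuples k B). nsq (tuples k B) \<xi> = 1} = {g \<in> ell2 (tuples k W). nsq (tuples k W) g = 1}"
  proof (intro equalityI subsetI)
    fix g assume g: "g \<in> {g \<in> ell2 (tuples k W). nsq (tuples k W) g = 1}"
    then have "g = \<Theta> k (\<Theta>' k g)" "\<Theta>' k g \<in> {\<xi> \<in> ell2 (tuples k B). nsq (tuples k B) \<xi> = 1}"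
      by (simp_all add: \<Theta>_\<Theta>' \<Theta>'_ell2 nsq_\<Theta>')
    then show "g \<in> \<Theta> k ` {\<xi> \<in> ell2 (tuples k B). nsq (tuples k B) \<xi> = 1}" by (rule image_eqI)
  qed (auto simp: \<Theta>_ell2 nsq_\<Theta>)
  finally show ?thesis .
qed

end

section \<open>A Haagerup inequality\<close>

definition cutoff :: "('x \<Rightarrow> bool) \<Rightarrow> ('x \<Rightarrow> complex) \<Rightarrow> 'x \<Rightarrow> complex" where
  "cutoff P f = (\<lambda>x. if P x then f x else 0)"

lemma cutoff_ell2: "f \<in> ell2 X \<Longrightarrow> cutoff P f \<in> ell2 X"
  by (rule ell2_comparison) (auto simp: cutoff_def ell2_outside)

lemma nsq_cutoff_le: "f \<in> ell2 X \<Longrightarrow> nsq X (cutoff P f) \<le> nsq X f"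
  by (intro nsq_mono_on cutoff_ell2) (auto simp: cutoff_def)

lemma sum_nsq_cutoff_le:
  assumes f: "f \<in> ell2 X" and I: "finite I" 
    and disj: "\<And>i j x. i \<in> I \<Longrightarrow> j \<in> I \<Longrightarrow> x \<in> X \<Longrightarrow> P i x \<Longrightarrow> P j x \<Longrightarrow> i = j"
  shows "(\<Sum>i\<in>I. nsq X (cutoff (P i) f)) \<le> nsq X f"
proof -
  have "(\<Sum>i\<in>J. nsq X (cutoff (P i) f)) = nsq X (cutoff (\<lambda>x. \<exists>i\<in>J. P i x) f)" if "J \<subseteq> I" for J
    using finite_subset[OF that I] that
  proof (induction J rule: finite_induct)
    case empty
    then show ?case by (simp add: cutoff_def)
  next
    case (insert i J)
    have "nsq X (cutoff (\<lambda>x. \<exists>i\<in>insert i J. P i x) f) = 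
      (\<Sum>\<^sub>\<infinity>x\<in>X. (cmod (cutoff (P i) f x))\<^sup>2 + (cmod (cutoff (\<lambda>x. \<exists>i\<in>J. P i x) f x))\<^sup>2)"
      unfolding nsq_def
    proof (rule infsum_cong)
      fix x assume x: "x \<in> X"
      have "\<not> (P i x \<and> (\<exists>j\<in>J. P j x))"
      proof
        assume "P i x \<and> (\<exists>j\<in>J. P j x)"
        then obtain j where "j \<in> J" "P i x" "P j x" by auto
        then show False using disj[of i j x] insert x by auto
      qed
      then show "(cmod (cutoff (\<lambda>x. \<exists>i\<in>insert i J. P i x) f x))\<^sup>2 = 
        (cmod (cutoff (P i) f x))\<^sup>2 + (cmod (cutoff (\<lambda>x. \<exists>i\<in>J. P i x) f x))\<^sup>2"
        by (auto simp: cutoff_def)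
    qed
    also have "\<dots> = nsq X (cutoff (P i) f) + nsq X (cutoff (\<lambda>x. \<exists>i\<in>J. P i x) f)"
      unfolding nsq_def by (intro infsum_add ell2_summable cutoff_ell2 f)
    finally show ?case using insert by simp
  qed
  from this[OF order_refl] show ?thesis using nsq_cutoff_le[OF f] by simp
qed

lemma ip_disjoint:
  assumes "\<And>x. x \<in> X \<Longrightarrow> f x = 0 \<or> g x = 0" shows "ip X f g = 0"
  unfolding ip_def by (rule infsum_0) (use assms in auto)

lemma permop_adjoint:
  assumes "involution_on X \<tau>" "g \<in> ell2 X"
  shows "ip X (permop X \<tau> f) g = ip X f (permop X \<tau> g)"
  using ip_permop[OF assms(1), of f "permop X \<tau> g"] permop_permop[OF assms] by simp

lemma permop_add: "permop X \<tau> (\<lambda>x. f x + g x) = (\<lambda>x. permop X \<tau> f x + permop X \<tau> g x)"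
  by (auto simp: permop_def)

lemma norm_sum3_squared: "(cmod (x + y + z))\<^sup>2 \<le> 3 * ((cmod x)\<^sup>2 + (cmod y)\<^sup>2 + (cmod z)\<^sup>2)"
proof -
  have "(cmod (x + y + z))\<^sup>2 \<le> (cmod x + cmod y + cmod z)\<^sup>2"
    by (intro power_mono order_trans[OF norm_triangle_ineq] add_right_mono norm_triangle_ineq) auto
  also have "\<dots> \<le> 3 * ((cmod x)\<^sup>2 + (cmod y)\<^sup>2 + (cmod z)\<^sup>2)"
    using zero_le_power2[of "cmod x - cmod y"] zero_le_power2[of "cmod y - cmod z"] zero_le_power2[of "cmod x - cmod z"]
    by (simp add: power2_eq_square algebra_simps)
  finally show ?thesis .
qed

text \<open>
  The \<open>u i\<close> act in one tensor position and the \<open>\<tau> a\<close> in positions that were treated before.  The set \<open>P i\<close>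
  plays the role of the words beginning with the letter \<open>i\<close>.  With \<open>U\<^sub>i\<close> the unitary of \<open>u i\<close> and \<open>p\<^sub>i\<close> the
  projection to \<open>P i\<close>, the flip condition says that \<open>U\<^sub>i = p\<^sub>iU\<^sub>i + U\<^sub>ip\<^sub>i\<close>, where the first summand creates the
  letter and the second one annihilates it.  Of the four terms of \<open>\<langle>U\<^sub>if, U\<^sub>jg\<rangle>\<close> for \<open>i \<noteq> j\<close>, the product of
  two creations vanishes by orthogonality.  In the two mixed terms the creation moves to the other side,
  where it becomes a second annihilation.  In all three remaining terms only annihilations are left,
  and since \<open>\<Sum>\<^sub>i |p\<^sub>if|\<^sup>2 \<le> |f|\<^sup>2\<close>, each of them contributes at most \<open>C |f|\<^sup>2|g|\<^sup>2\<close> to the sum of squares.  The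
  constant 9 comes from \<open>|x + y + z|\<^sup>2 \<le> 3 (|x|\<^sup>2 + |y|\<^sup>2 + |z|\<^sup>2)\<close>.
\<close>

lemma Haagerup_step:
  fixes X :: "'x set" and A :: "'a set" and \<tau> :: "'a \<Rightarrow> 'x \<Rightarrow> 'x" and u :: "'i \<Rightarrow> 'x \<Rightarrow> 'x"
  assumes A: "finite A" and I: "finite I"
    and \<tau>: "\<And>a. a \<in> A \<Longrightarrow> involution_on X (\<tau> a)" and u: "\<And>i. i \<in> I \<Longrightarrow> involution_on X (u i)"
    and comm: "\<And>a i x. a \<in> A \<Longrightarrow> i \<in> I \<Longrightarrow> x \<in> X \<Longrightarrow> \<tau> a (u i x) = u i (\<tau> a x)"
    and disj: "\<And>i j x. i \<in> I \<Longrightarrow> j \<in> I \<Longrightarrow> x \<in> X \<Longrightarrow> P i x \<Longrightarrow> P j x \<Longrightarrow> i = j"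
    and flip: "\<And>i x. i \<in> I \<Longrightarrow> x \<in> X \<Longrightarrow> P i (u i x) \<longleftrightarrow> \<not> P i x"
    and P\<tau>: "\<And>a i x. a \<in> A \<Longrightarrow> i \<in> I \<Longrightarrow> x \<in> X \<Longrightarrow> P i (\<tau> a x) \<longleftrightarrow> P i x"
    and bound: "\<And>f g. f \<in> ell2 X \<Longrightarrow> g \<in> ell2 X \<Longrightarrow> 
      (\<Sum>a\<in>A. \<Sum>b\<in>A. (cmod (ip X (permop X (\<tau> a) f) (permop X (\<tau> b) g)))\<^sup>2) \<le> C * (nsq X f * nsq X g)"
    and C: "0 \<le> C" and f: "f \<in> ell2 X" and g: "g \<in> ell2 X"
  shows "(\<Sum>i\<in>I. \<Sum>j\<in>I. \<Sum>a\<in>A. \<Sum>b\<in>A. (cmod (ip X (permop X (\<tau> a) (permop X (u i) f)) (permop X (\<tau> b) (permop X (u j) g))))\<^sup>2)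
    \<le> (real (card I) + 9) * C * (nsq X f * nsq X g)"
proof -
  let ?U = "\<lambda>i. permop X (u i)" and ?T = "\<lambda>a. permop X (\<tau> a)" and ?p = "\<lambda>i. cutoff (P i)"
  let ?\<zeta> = "\<lambda>i j h. ?U i (?p i (?U j (?p j h)))"
  define F where "F = (\<lambda>f g. \<Sum>a\<in>A. \<Sum>b\<in>A. (cmod (ip X (?T a f) (?T b g)))\<^sup>2)"
  have F: "F f g \<le> C * (nsq X f * nsq X g)" if "f \<in> ell2 X" "g \<in> ell2 X" for f g
    unfolding F_def by (rule bound[OF that])
  note mem = permop_ell2[OF \<tau>] permop_ell2[OF u] cutoff_ell2
  have TU: "?T a (?U i h) = ?U i (?T a h)" if "a \<in> A" "i \<in> I" for a i h
    using comm[OF that] \<tau>[OF that(1)] u[OF that(2)] by (auto simp: permop_def involution_on_def fun_eq_iff)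
  have Tp: "?T a (?p i h) = ?p i (?T a h)" if "a \<in> A" "i \<in> I" for a i h
    using P\<tau>[OF that] by (auto simp: permop_def cutoff_def fun_eq_iff)
  \<comment> \<open>Creation of the letter i plus its annihilation.\<close>
  have split: "?U i h = (\<lambda>x. ?p i (?U i h) x + ?U i (?p i h) x)" if "i \<in> I" for i h
    using flip[OF that] by (auto simp: permop_def cutoff_def fun_eq_iff)
  have p_sym: "ip X (?p i h) k = ip X h (?p i k)" for i h k
    unfolding ip_def by (intro infsum_cong) (simp add: cutoff_def)
  have nz: "nsq X (?\<zeta> i j h) = nsq X (?p i (?U j (?p j h)))" if "i \<in> I" for i j h
    by (rule nsq_permop[OF u[OF that]])
  have \<zeta>: "?\<zeta> i j h \<in> ell2 X" if "i \<in> I" "j \<in> I" "h \<in> ell2 X" for i j h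
    using that by (intro mem)
  have sum_p: "(\<Sum>i\<in>I. nsq X (?p i h)) \<le> nsq X h" if "h \<in> ell2 X" for h
    by (rule sum_nsq_cutoff_le[OF that I disj])
  \<comment> \<open>Two successive annihilations.\<close>
  have sum_\<zeta>: "(\<Sum>i\<in>I. \<Sum>j\<in>I. nsq X (?\<zeta> i j h)) \<le> nsq X h" if h: "h \<in> ell2 X" for h
  proof -
    have "(\<Sum>i\<in>I. \<Sum>j\<in>I. nsq X (?\<zeta> i j h)) = (\<Sum>j\<in>I. \<Sum>i\<in>I. nsq X (?p i (?U j (?p j h))))"
      by (subst sum.swap) (intro sum.cong refl nz)
    also have "\<dots> \<le> (\<Sum>j\<in>I. nsq X (?U j (?p j h)))"
      by (intro sum_mono sum_p mem h)
    also have "\<dots> = (\<Sum>j\<in>I. nsq X (?p j h))" by (intro sum.cong refl nsq_permop u)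
    also have "\<dots> \<le> nsq X h" by (rule sum_p[OF h])
    finally show ?thesis .
  qed
  have off: "F (?U i f) (?U j g) \<le> 3 * C * (nsq X f * nsq X (?\<zeta> i j g) + nsq X (?\<zeta> j i f) * nsq X g + nsq X (?p i f) * nsq X (?p j g))"
    if i: "i \<in> I" and j: "j \<in> I" and ne: "i \<noteq> j" for i j
  proof -
    have expand: "ip X (?T a (?U i f)) (?T b (?U j g)) = 
        ip X (?T a f) (?T b (?\<zeta> i j g)) + ip X (?T a (?\<zeta> j i f)) (?T b g) + ip X (?T a (?U i (?p i f))) (?T b (?U j (?p j g)))"
      if a: "a \<in> A" and b: "b \<in> A" for a b
    proof -
      let ?l = "?T a (?p i (?U i f))" and ?l' = "?T a (?U i (?p i f))"
      let ?r = "?T b (?p j (?U j g))" and ?r' = "?T b (?U j (?p j g))"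
      have m: "?l \<in> ell2 X" "?l' \<in> ell2 X" "?r \<in> ell2 X" "?r' \<in> ell2 X"
        using i j a b f g by (auto intro!: mem)
      have L: "?T a (?U i f) = (\<lambda>x. ?l x + ?l' x)" by (subst split[OF i]) (rule permop_add)
      have R: "?T b (?U j g) = (\<lambda>x. ?r x + ?r' x)" by (subst split[OF j]) (rule permop_add)
      have "ip X (?T a (?U i f)) (?T b (?U j g)) = ip X ?l ?r + ip X ?l ?r' + (ip X ?l' ?r + ip X ?l' ?r')"
        unfolding L R by (simp only: ip_add_left ip_add_right ell2_add m)
      moreover have "ip X ?l ?r = 0"
        unfolding Tp[OF a i] Tp[OF b j]
        by (rule ip_disjoint) (use disj[OF i j] ne in \<open>auto simp: cutoff_def\<close>)
      moreover have "ip X ?l ?r' = ip X (?T a f) (?T b (?\<zeta> i j g))"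
      proof -
        have "ip X ?l ?r' = ip X (?U i (?T a f)) (?p i ?r')"
          unfolding Tp[OF a i] p_sym TU[OF a i] ..
        also have "\<dots> = ip X (?T a f) (?U i (?p i ?r'))"
          by (rule permop_adjoint[OF u[OF i]]) (intro mem m)
        also have "?U i (?p i ?r') = ?T b (?\<zeta> i j g)"
          by (simp only: TU[OF b i] Tp[OF b i])
        finally show ?thesis .
      qed
      moreover have "ip X ?l' ?r = ip X (?T a (?\<zeta> j i f)) (?T b g)"
      proof -
        have "ip X ?l' ?r = ip X (?p j ?l') (?U j (?T b g))"
          unfolding Tp[OF b j] p_sym[symmetric] TU[OF b j] ..
        also have "\<dots> = ip X (?U j (?p j ?l')) (?T b g)"
          by (rule permop_adjoint[OF u[OF j], symmetric]) (intro mem g b)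
        also have "?U j (?p j ?l') = ?T a (?\<zeta> j i f)"
          by (simp only: TU[OF a j] Tp[OF a j])
        finally show ?thesis .
      qed
      ultimately show ?thesis by simp
    qed
    have "F (?U i f) (?U j g) \<le> (\<Sum>a\<in>A. \<Sum>b\<in>A. 3 * ((cmod (ip X (?T a f) (?T b (?\<zeta> i j g))))\<^sup>2 + 
       (cmod (ip X (?T a (?\<zeta> j i f)) (?T b g)))\<^sup>2 + (cmod (ip X (?T a (?U i (?p i f))) (?T b (?U j (?p j g)))))\<^sup>2))"
      unfolding F_def by (intro sum_mono) (simp only: expand norm_sum3_squared)
    also have "\<dots> = 3 * (F f (?\<zeta> i j g) + F (?\<zeta> j i f) g + F (?U i (?p i f)) (?U j (?p j g)))"
      unfolding F_def by (simp only: sum.distrib sum_distrib_left distrib_left)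
    also have "\<dots> \<le> 3 * (C * (nsq X f * nsq X (?\<zeta> i j g)) + C * (nsq X (?\<zeta> j i f) * nsq X g) + 
        C * (nsq X (?U i (?p i f)) * nsq X (?U j (?p j g))))"
      by (intro mult_left_mono add_mono F mem f g i j) simp_all
    also have "\<dots> = 3 * C * (nsq X f * nsq X (?\<zeta> i j g) + nsq X (?\<zeta> j i f) * nsq X g + nsq X (?p i f) * nsq X (?p j g))"
      unfolding nsq_permop[OF u[OF i]] nsq_permop[OF u[OF j]] by (simp add: algebra_simps)
    finally show ?thesis .
  qed
  have diag: "F (?U i f) (?U i g) \<le> C * (nsq X f * nsq X g)" if "i \<in> I" for i
    using F[OF mem(2)[OF that f] mem(2)[OF that g]] unfolding nsq_permop[OF u[OF that]] .
  let ?b = "\<lambda>i j. 3 * C * (nsq X f * nsq X (?\<zeta> i j g) + nsq X (?\<zeta> j i f) * nsq X g + nsq X (?p i f) * nsq X (?p j g))"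
  have b0: "0 \<le> ?b i j" for i j using C by simp
  have "(\<Sum>i\<in>I. \<Sum>j\<in>I. F (?U i f) (?U j g)) \<le> (\<Sum>i\<in>I. \<Sum>j\<in>I. (if j = i then C * (nsq X f * nsq X g) else 0) + ?b i j)"
  proof (intro sum_mono)
    fix i j assume ij: "i \<in> I" "j \<in> I"
    show "F (?U i f) (?U j g) \<le> (if j = i then C * (nsq X f * nsq X g) else 0) + ?b i j"
    proof (cases "j = i")
      case True
      then show ?thesis using diag[OF ij(1)] b0[of i i] by simp
    qed (use off[OF ij] in simp)
  qed
  also have "\<dots> = real (card I) * (C * (nsq X f * nsq X g)) + (\<Sum>i\<in>I. \<Sum>j\<in>I. ?b i j)"
    using I by (simp add: sum.distrib)
  also have "(\<Sum>i\<in>I. \<Sum>j\<in>I. ?b i j) = 3 * C * (nsq X f * (\<Sum>i\<in>I. \<Sum>j\<in>I. nsq X (?\<zeta> i j g)) + 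
      (\<Sum>i\<in>I. \<Sum>j\<in>I. nsq X (?\<zeta> j i f)) * nsq X g + (\<Sum>i\<in>I. nsq X (?p i f)) * (\<Sum>j\<in>I. nsq X (?p j g)))"
    unfolding sum_product by (simp only: sum.distrib sum_distrib_left[symmetric] sum_distrib_right[symmetric])
  also have "\<dots> \<le> 3 * C * (nsq X f * nsq X g + nsq X f * nsq X g + nsq X f * nsq X g)"
  proof (intro mult_left_mono add_mono mult_right_mono mult_mono sum_\<zeta> sum_p f g)
    have "(\<Sum>i\<in>I. \<Sum>j\<in>I. nsq X (?\<zeta> j i f)) = (\<Sum>j\<in>I. \<Sum>i\<in>I. nsq X (?\<zeta> j i f))" by (rule sum.swap)
    then show "(\<Sum>i\<in>I. \<Sum>j\<in>I. nsq X (?\<zeta> j i f)) \<le> nsq X f" using sum_\<zeta>[OF f] by simp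
  qed (use C in \<open>auto intro: sum_nonneg\<close>)
  finally show ?thesis unfolding F_def by (simp add: algebra_simps)
qed

text \<open>
  The action of an index tuple on the first positions only, so that the bound can be proved by
  induction on the number of positions that are acted on.
\<close>

definition act_prefix :: "(nat \<Rightarrow> 'x \<Rightarrow> 'x) \<Rightarrow> nat list \<Rightarrow> 'x list \<Rightarrow> 'x list" where
  "act_prefix \<pi> I ws = map (\<lambda>s. if s < length I then \<pi> (I ! s) (ws ! s) else ws ! s) [0..<length ws]"

lemma length_act_prefix [simp]: "length (act_prefix \<pi> I ws) = length ws"
  by (simp add: act_prefix_def)

lemma nth_act_prefix: "s < length ws \<Longrightarrow> act_prefix \<pi> I ws ! s = (if s < length I then \<pi> (I ! s) (ws ! s) else ws ! s)"
  by (simp add: act_prefix_def)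

lemma bij_betw_snoc: "bij_betw (\<lambda>(I, i). I @ [i]) (tuples m J \<times> J) (tuples (Suc m) J)"
proof (rule bij_betwI[where g = "\<lambda>I. (butlast I, last I)"])
  show "(\<lambda>(I, i). I @ [i]) \<in> tuples m J \<times> J \<rightarrow> tuples (Suc m) J" by (auto simp: tuples_def)
  show "(\<lambda>I. (butlast I, last I)) \<in> tuples (Suc m) J \<rightarrow> tuples m J \<times> J"
  proof
    fix I assume I: "I \<in> tuples (Suc m) J"
    then have ne: "I \<noteq> []" by (auto simp: tuples_def)
    show "(butlast I, last I) \<in> tuples m J \<times> J"
      using I last_in_set[OF ne] by (auto simp: tuples_def dest: in_set_butlastD)
  qed
  show "(\<lambda>(I, i). I @ [i]) (butlast I, last I) = I" if "I \<in> tuples (Suc m) J" for I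
  proof -
    have "I \<noteq> []" using that by (auto simp: tuples_def)
    then show ?thesis by simp
  qed
qed auto

text \<open>
  The \<open>m\<close>-th induction step is \<open>Haagerup_step\<close> for the action in position \<open>m\<close>; without any action the
  bound is the Cauchy-Schwarz inequality.
\<close>

lemma Haagerup_tuples:
  fixes W :: "'x set"
  assumes \<pi>: "\<And>i. i \<in> {1..n} \<Longrightarrow> involution_on W (\<pi> i)"
    and disj: "\<And>i j x. i \<in> {1..n} \<Longrightarrow> j \<in> {1..n} \<Longrightarrow> x \<in> W \<Longrightarrow> P i x \<Longrightarrow> P j x \<Longrightarrow> i = j"
    and flip: "\<And>i x. i \<in> {1..n} \<Longrightarrow> x \<in> W \<Longrightarrow> P i (\<pi> i x) \<longleftrightarrow> \<not> P i x"
    and f: "f \<in> ell2 (tuples k W)" and g: "g \<in> ell2 (tuples k W)"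
  shows "(\<Sum>I\<in>tuples k {1..n}. \<Sum>J\<in>tuples k {1..n}. 
      (cmod (ip (tuples k W) (permop (tuples k W) (map2 \<pi> I) f) (permop (tuples k W) (map2 \<pi> J) g)))\<^sup>2)
    \<le> (real n + 9) ^ k * (nsq (tuples k W) f * nsq (tuples k W) g)"
proof -
  let ?X = "tuples k W"
  have inv: "involution_on ?X (act_prefix \<pi> I)" if I: "I \<in> tuples m {1..n}" for I m
  proof -
    have "act_prefix \<pi> I ws \<in> ?X \<and> act_prefix \<pi> I (act_prefix \<pi> I ws) = ws" if ws: "ws \<in> ?X" for ws
    proof
      have *: "involution_on W (\<pi> (I ! s))" if "s < length I" for s
        using that I by (intro \<pi>) (simp add: tuples_nth[OF I, simplified] tuples_length[OF I] tuples_def)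
      show "act_prefix \<pi> I ws \<in> ?X"
        by (rule tuplesI) (use * tuples_length[OF ws] tuples_nth[OF ws] in \<open>auto simp: nth_act_prefix involution_on_def\<close>)
      show "act_prefix \<pi> I (act_prefix \<pi> I ws) = ws"
        by (rule nth_equalityI) (use * tuples_length[OF ws] tuples_nth[OF ws] in \<open>auto simp: nth_act_prefix involution_on_def\<close>)
    qed
    then show ?thesis by (simp add: involution_on_def)
  qed
  have "(\<Sum>I\<in>tuples m {1..n}. \<Sum>J\<in>tuples m {1..n}. (cmod (ip ?X (permop ?X (act_prefix \<pi> I) f) (permop ?X (act_prefix \<pi> J) g)))\<^sup>2)
    \<le> (real n + 9) ^ m * (nsq ?X f * nsq ?X g)" 
    if "m \<le> k" "f \<in> ell2 ?X" "g \<in> ell2 ?X" for m f g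
    using that
  proof (induction m arbitrary: f g)
    case 0
    have id: "permop ?X (act_prefix \<pi> []) h = h" if h: "h \<in> ell2 ?X" for h
    proof
      fix ws
      have "act_prefix \<pi> [] ws = ws" by (rule nth_equalityI) (auto simp: nth_act_prefix)
      then show "permop ?X (act_prefix \<pi> []) h ws = h ws" using ell2_outside[OF h] by (simp add: permop_def)
    qed
    show ?case using ip_Cauchy_Schwarz[of f ?X g] 0 by (simp add: id)
  next
    case (Suc m)
    define u where "u = (\<lambda>i ws. ws[m := \<pi> i (ws ! m)])"
    have m: "m < k" using Suc.prems by simp
    have u_inv: "involution_on ?X (u i)" if "i \<in> {1..n}" for i
    proof -
      have "u i ws \<in> ?X \<and> u i (u i ws) = ws" if ws: "ws \<in> ?X" for ws
        using \<pi>[OF \<open>i \<in> {1..n}\<close>] tuples_nth[OF ws m] tuples_length[OF ws] m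
        by (auto simp: u_def involution_on_def nth_list_update tuples_nth[OF ws] intro!: tuplesI)
      then show ?thesis by (simp add: involution_on_def)
    qed
    have snoc: "act_prefix \<pi> (I @ [i]) ws = u i (act_prefix \<pi> I ws)" if "I \<in> tuples m {1..n}" "ws \<in> ?X" for I i ws
      using tuples_length[OF that(1)] tuples_length[OF that(2)] m
      by (intro nth_equalityI) (auto simp: u_def nth_act_prefix nth_append nth_list_update)
    have comp: "permop ?X (act_prefix \<pi> (I @ [i])) h = permop ?X (act_prefix \<pi> I) (permop ?X (u i) h)"
      if I: "I \<in> tuples m {1..n}" for I i h
      using snoc[OF I] inv[OF I] by (auto simp: permop_def involution_on_def)
    have "(\<Sum>I\<in>tuples (Suc m) {1..n}. \<Sum>J\<in>tuples (Suc m) {1..n}. (cmod (ip ?X (permop ?X (act_prefix \<pi> I) f) (permop ?X (act_prefix \<pi> J) g)))\<^sup>2)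
      = (\<Sum>p\<in>tuples m {1..n} \<times> {1..n}. \<Sum>q\<in>tuples m {1..n} \<times> {1..n}. 
          (cmod (ip ?X (permop ?X (act_prefix \<pi> ((\<lambda>(I, i). I @ [i]) p)) f) (permop ?X (act_prefix \<pi> ((\<lambda>(I, i). I @ [i]) q)) g)))\<^sup>2)"
      by (simp only: sum.reindex_bij_betw[OF bij_betw_snoc, symmetric])
    also have "\<dots> = (\<Sum>I\<in>tuples m {1..n}. \<Sum>i\<in>{1..n}. \<Sum>J\<in>tuples m {1..n}. \<Sum>j\<in>{1..n}. 
       (cmod (ip ?X (permop ?X (act_prefix \<pi> I) (permop ?X (u i) f)) (permop ?X (act_prefix \<pi> J) (permop ?X (u j) g))))\<^sup>2)"
      unfolding sum.cartesian_product' by (intro sum.cong refl) (simp add: comp)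
    also have "\<dots> = (\<Sum>i\<in>{1..n}. \<Sum>I\<in>tuples m {1..n}. \<Sum>J\<in>tuples m {1..n}. \<Sum>j\<in>{1..n}. 
       (cmod (ip ?X (permop ?X (act_prefix \<pi> I) (permop ?X (u i) f)) (permop ?X (act_prefix \<pi> J) (permop ?X (u j) g))))\<^sup>2)"
      by (rule sum.swap)
    also have "\<dots> = (\<Sum>i\<in>{1..n}. \<Sum>I\<in>tuples m {1..n}. \<Sum>j\<in>{1..n}. \<Sum>J\<in>tuples m {1..n}. 
       (cmod (ip ?X (permop ?X (act_prefix \<pi> I) (permop ?X (u i) f)) (permop ?X (act_prefix \<pi> J) (permop ?X (u j) g))))\<^sup>2)"
      by (rule sum.cong[OF refl], rule sum.cong[OF refl], rule sum.swap)
    also have "\<dots> = (\<Sum>i\<in>{1..n}. \<Sum>j\<in>{1..n}. \<Sum>I\<in>tuples m {1..n}. \<Sum>J\<in>tuples m {1..n}. 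
       (cmod (ip ?X (permop ?X (act_prefix \<pi> I) (permop ?X (u i) f)) (permop ?X (act_prefix \<pi> J) (permop ?X (u j) g))))\<^sup>2)"
      by (rule sum.cong[OF refl], rule sum.swap)
    also have "\<dots> \<le> (real (card {1..n}) + 9) * (real n + 9) ^ m * (nsq ?X f * nsq ?X g)"
    proof (rule Haagerup_step[where P = "\<lambda>i ws. P i (ws ! m)"])
      show "act_prefix \<pi> I (u i ws) = u i (act_prefix \<pi> I ws)" if "I \<in> tuples m {1..n}" "ws \<in> ?X" for I i ws
        using tuples_length[OF that(1)] tuples_length[OF that(2)] m
        by (intro nth_equalityI) (auto simp: u_def nth_act_prefix nth_list_update)
      show "P i (act_prefix \<pi> I ws ! m) \<longleftrightarrow> P i (ws ! m)" if "I \<in> tuples m {1..n}" "ws \<in> ?X" for I i ws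
        using tuples_length[OF that(1)] tuples_length[OF that(2)] m by (simp add: nth_act_prefix)
      show "P i (u i ws ! m) \<longleftrightarrow> \<not> P i (ws ! m)" if "i \<in> {1..n}" "ws \<in> ?X" for i ws
        using flip[OF that(1) tuples_nth[OF that(2) m]] tuples_length[OF that(2)] m by (simp add: u_def)
      show "i = j" if "i \<in> {1..n}" "j \<in> {1..n}" "ws \<in> ?X" "P i (ws ! m)" "P j (ws ! m)" for i j ws
        by (rule disj[OF that(1,2) tuples_nth[OF that(3) m] that(4,5)])
      show "(\<Sum>I\<in>tuples m {1..n}. \<Sum>J\<in>tuples m {1..n}. (cmod (ip ?X (permop ?X (act_prefix \<pi> I) f) (permop ?X (act_prefix \<pi> J) g)))\<^sup>2)
        \<le> (real n + 9) ^ m * (nsq ?X f * nsq ?X g)" if "f \<in> ell2 ?X" "g \<in> ell2 ?X" for f g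
        by (rule Suc.IH[OF _ that]) (use m in simp)
    qed (use u_inv inv Suc.prems in \<open>simp_all add: finite_tuples\<close>)
    finally show ?case by simp
  qed
  note prefix = this[OF order_refl f g]
  have act: "permop ?X (act_prefix \<pi> I) h = permop ?X (map2 \<pi> I) h" if "I \<in> tuples k {1..n}" for I h
  proof
    fix ws show "permop ?X (act_prefix \<pi> I) h ws = permop ?X (map2 \<pi> I) h ws"
    proof (cases "ws \<in> ?X")
      case True
      have "act_prefix \<pi> I ws = map2 \<pi> I ws"
        using tuples_length[OF that] tuples_length[OF True] by (intro nth_equalityI) (auto simp: nth_act_prefix)
      then show ?thesis by (simp add: permop_def)
    qed (simp add: permop_def)
  qed
  show ?thesis using prefix by (simp add: act cong: sum.cong)
qed

section \<open>Subadditive sequences\<close>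

lemma subadditive_multiple:
  fixes a :: "nat \<Rightarrow> real"
  assumes "\<And>m n. a (m + n) \<le> a m + a n"
  shows "a (q * m + r) \<le> real q * a m + a r"
proof (induction q)
  case (Suc q)
  have "a (m + (q * m + r)) \<le> a m + a (q * m + r)" by (rule assms)
  then show ?case using Suc by (simp add: algebra_simps)
qed simp

text \<open>
  Division of \<open>n\<close> by an \<open>m\<close> with \<open>a m / m\<close> close to the infimum gives \<open>a n \<le> (n/m) a m + c\<close>, where \<open>c\<close> bounds
  the values at the finitely many remainders.
\<close>

lemma Fekete_subadditive:
  fixes a :: "nat \<Rightarrow> real"
  assumes sub: "\<And>m n. a (m + n) \<le> a m + a n" and nonneg: "\<And>n. 0 \<le> a n"
  obtains L where "(\<lambda>n. a n / real n) \<longlonglongrightarrow> L" "L \<le> a 1"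
proof -
  define L where "L = (INF n\<in>{1..}. a n / real n)"
  have bdd: "bdd_below ((\<lambda>n. a n / real n) ` {1..})"
    by (rule bdd_belowI2[of _ 0]) (simp add: nonneg)
  have L_le: "L \<le> a n / real n" if "1 \<le> n" for n
    unfolding L_def by (rule cINF_lower[OF bdd]) (use that in simp)
  have "(\<lambda>n. a n / real n) \<longlonglongrightarrow> L"
  proof (rule LIMSEQ_I)
    fix \<epsilon> :: real assume \<epsilon>: "0 < \<epsilon>"
    have "\<exists>m\<in>{1..}. a m / real m < L + \<epsilon> / 2"
    proof (rule ccontr)
      assume "\<not> (\<exists>m\<in>{1..}. a m / real m < L + \<epsilon> / 2)"
      then have "L + \<epsilon> / 2 \<le> L" unfolding L_def[symmetric]
        by (subst (2) L_def) (rule cINF_greatest, auto simp: not_less)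
      then show False using \<epsilon> by simp
    qed
    then obtain m where m: "1 \<le> m" "a m / real m < L + \<epsilon> / 2" by auto
    define c where "c = (\<Sum>r<m. a r)"
    have c: "a r \<le> c" if "r < m" for r
      unfolding c_def using that by (intro member_le_sum) (auto simp: nonneg)
    have upper: "a n / real n \<le> a m / real m + c / real n" if n: "1 \<le> n" for n
    proof -
      have "a n \<le> real (n div m) * a m + a (n mod m)"
        using subadditive_multiple[of a "n div m" m "n mod m", OF sub] by simp
      also have "\<dots> \<le> real (n div m) * a m + c" using m by (simp add: c)
      also have "real (n div m) * a m \<le> (real n / real m) * a m"
      proof (intro mult_right_mono nonneg)
        have "real (n div m * m) \<le> real n" by (simp only: of_nat_le_iff div_times_less_eq_dividend)
        then show "real (n div m) \<le> real n / real m" using m by (simp add: pos_le_divide_eq)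
      qed
      finally have "a n / real n \<le> ((real n / real m) * a m + c) / real n"
        using n by (intro divide_right_mono) auto
      also have "\<dots> = a m / real m + c / real n" using n by (simp add: add_divide_distrib)
      finally show ?thesis .
    qed
    have "(\<lambda>n. c / real n) \<longlonglongrightarrow> 0" by (rule lim_const_over_n)
    then obtain n\<^sub>0 where n\<^sub>0: "\<forall>n\<ge>n\<^sub>0. norm (c / real n - 0) < \<epsilon> / 2"
      using LIMSEQ_D[of "\<lambda>n. c / real n" 0 "\<epsilon> / 2"] \<epsilon> by auto
    have "norm (a n / real n - L) < \<epsilon>" if "max 1 n\<^sub>0 \<le> n" for n
    proof -
      have "1 \<le> n" "n\<^sub>0 \<le> n" using that by auto
      have "c / real n < \<epsilon> / 2" using n\<^sub>0[rule_format, OF \<open>n\<^sub>0 \<le> n\<close>] abs_ge_self[of "c / real n"]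
        unfolding diff_0_right real_norm_def by linarith
      then show ?thesis using upper[OF \<open>1 \<le> n\<close>] L_le[OF \<open>1 \<le> n\<close>] m(2) unfolding real_norm_def by linarith
    qed
    then show "\<exists>n\<^sub>0. \<forall>n\<ge>n\<^sub>0. norm (a n / real n - L) < \<epsilon>" by blast
  qed
  moreover have "L \<le> a 1" using L_le[of 1] by simp
  ultimately show ?thesis by (rule that)
qed

section \<open>Subadditivity of the minimum output entropy\<close>

text \<open>
  The tensor product of vectors from tensor powers of order \<open>k\<close> and \<open>l\<close>.
\<close>

definition tens :: "nat \<Rightarrow> ('x list \<Rightarrow> complex) \<Rightarrow> ('x list \<Rightarrow> complex) \<Rightarrow> 'x list \<Rightarrow> complex" where
  "tens k f g = (\<lambda>ws. f (take k ws) * g (drop k ws))"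

lemma bij_betw_take_drop: "bij_betw (\<lambda>ws. (take k ws, drop k ws)) (tuples (k + l) S) (tuples k S \<times> tuples l S)"
proof (rule bij_betwI[where g = "\<lambda>(xs, ys). xs @ ys"])
  show "(\<lambda>ws. (take k ws, drop k ws)) \<in> tuples (k + l) S \<rightarrow> tuples k S \<times> tuples l S"
    by (auto simp: tuples_def dest: in_set_takeD in_set_dropD)
  show "(\<lambda>(xs, ys). xs @ ys) \<in> tuples k S \<times> tuples l S \<rightarrow> tuples (k + l) S"
    by (auto simp: tuples_def)
qed (auto simp: tuples_def)

lemma take_drop_tuples: "ws \<in> tuples (k + l) S \<Longrightarrow> take k ws \<in> tuples k S" "ws \<in> tuples (k + l) S \<Longrightarrow> drop k ws \<in> tuples l S"
  by (auto simp: tuples_def dest: in_set_takeD in_set_dropD)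

lemma tens_ell2:
  assumes f: "f \<in> ell2 (tuples k W)" and g: "g \<in> ell2 (tuples l W)"
  shows "tens k f g \<in> ell2 (tuples (k + l) W)"
proof (rule ell2_bounded_sums(1)[where C = "nsq (tuples k W) f * nsq (tuples l W) g"])
  let ?td = "\<lambda>ws. (take k ws, drop k ws)"
  fix ws :: "'a list" assume ws: "ws \<notin> tuples (k + l) W"
  show "tens k f g ws = 0"
  proof (rule ccontr)
    assume "tens k f g ws \<noteq> 0"
    then have "take k ws \<in> tuples k W" "drop k ws \<in> tuples l W"
      using ell2_outside[OF f] ell2_outside[OF g] by (auto simp: tens_def)
    then have "take k ws @ drop k ws \<in> tuples (k + l) W" by (simp only: tuples_def mem_Collect_eq length_append set_append) auto
    then show False using ws by simp
  qed
next
  let ?td = "\<lambda>ws. (take k ws, drop k ws)"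
  fix F assume F: "finite F" "F \<subseteq> tuples (k + l) W"
  let ?G = "take k ` F" and ?G' = "drop k ` F"
  have inj: "inj_on ?td F" by (rule inj_onI) (metis append_take_drop_id prod.inject)
  have G: "?G \<subseteq> tuples k W" "?G' \<subseteq> tuples l W" using F take_drop_tuples by blast+
  have "(\<Sum>ws\<in>F. (cmod (tens k f g ws))\<^sup>2) = (\<Sum>ws\<in>F. (\<lambda>(x, y). (cmod (f x))\<^sup>2 * (cmod (g y))\<^sup>2) (?td ws))"
    by (simp add: tens_def norm_mult power_mult_distrib)
  also have "\<dots> = (\<Sum>p\<in>?td ` F. (\<lambda>(x, y). (cmod (f x))\<^sup>2 * (cmod (g y))\<^sup>2) p)"
    by (simp only: sum.reindex[OF inj] o_def)
  also have "\<dots> \<le> (\<Sum>p\<in>?G \<times> ?G'. (\<lambda>(x, y). (cmod (f x))\<^sup>2 * (cmod (g y))\<^sup>2) p)"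
    using F by (intro sum_mono2) auto
  also have "\<dots> = (\<Sum>x\<in>?G. (cmod (f x))\<^sup>2) * (\<Sum>y\<in>?G'. (cmod (g y))\<^sup>2)"
    unfolding sum_product sum.cartesian_product' by simp
  also have "\<dots> \<le> nsq (tuples k W) f * nsq (tuples l W) g"
    using F G by (intro mult_mono finite_sum_le_nsq f g) (auto intro: sum_nonneg)
  finally show "(\<Sum>ws\<in>F. (cmod (tens k f g ws))\<^sup>2) \<le> nsq (tuples k W) f * nsq (tuples l W) g" .
qed

lemma ip_tens:
  assumes f: "f \<in> ell2 (tuples k W)" and g: "g \<in> ell2 (tuples l W)" 
    and f': "f' \<in> ell2 (tuples k W)" and g': "g' \<in> ell2 (tuples l W)"
  shows "ip (tuples (k + l) W) (tens k f g) (tens k f' g') = ip (tuples k W) f f' * ip (tuples l W) g g'"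
proof -
  let ?td = "\<lambda>ws. (take k ws, drop k ws)"
  let ?h = "\<lambda>x y. (cnj (f x) * f' x) * (cnj (g y) * g' y)"
  have eq: "cnj (tens k f g ws) * tens k f' g' ws = (\<lambda>(x, y). ?h x y) (?td ws)" for ws
    by (simp add: tens_def mult_ac)
  have "(\<lambda>ws. (\<lambda>(x, y). ?h x y) (?td ws)) summable_on tuples (k + l) W"
    using ip_summable[OF tens_ell2[OF f g] tens_ell2[OF f' g']] unfolding eq .
  then have "(\<lambda>(x, y). ?h x y) summable_on tuples k W \<times> tuples l W"
    by (subst (asm) summable_on_reindex_bij_betw[OF bij_betw_take_drop])
  then have sig: "(\<Sum>\<^sub>\<infinity>x\<in>tuples k W. \<Sum>\<^sub>\<infinity>y\<in>tuples l W. ?h x y) = infsum (\<lambda>(x, y). ?h x y) (tuples k W \<times> tuples l W)"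
    by (rule infsum_Sigma'_banach)
  have "ip (tuples (k + l) W) (tens k f g) (tens k f' g') = infsum (\<lambda>(x, y). ?h x y) (tuples k W \<times> tuples l W)"
    unfolding ip_def eq by (rule infsum_reindex_bij_betw[OF bij_betw_take_drop])
  also have "\<dots> = (\<Sum>\<^sub>\<infinity>x\<in>tuples k W. (cnj (f x) * f' x) * ip (tuples l W) g g')"
    unfolding sig[symmetric] ip_def by (simp only: infsum_cmult_right')
  also have "\<dots> = ip (tuples k W) f f' * ip (tuples l W) g g'"
    unfolding ip_def[of "tuples k W"] by (rule infsum_cmult_left')
  finally show ?thesis .
qed

lemma nsq_tens:
  assumes f: "f \<in> ell2 (tuples k W)" and g: "g \<in> ell2 (tuples l W)"
  shows "nsq (tuples (k + l) W) (tens k f g) = nsq (tuples k W) f * nsq (tuples l W) g"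
  using ip_tens[OF f g f g] unfolding ip_self of_real_mult[symmetric] of_real_eq_iff .

lemma card_tuples: "finite S \<Longrightarrow> card (tuples k S) = card S ^ k"
  using card_lists_length_eq[of S k] by (simp add: tuples_def conj_commute)

context perm_channel
begin

definition unit_vectors :: "nat \<Rightarrow> ('x list \<Rightarrow> complex) set" where
  "unit_vectors k = {g \<in> ell2 (tuples k W). nsq (tuples k W) g = 1}"

lemma V_trace: "(\<Sum>J\<in>tuples k {1..N}. nsq (tuples k W) (V k J g)) = nsq (tuples k W) g"
proof -
  have "(\<Sum>J\<in>tuples k {1..N}. nsq (tuples k W) (V k J g)) = (\<Sum>J\<in>tuples k {1..N}. nsq (tuples k W) g / real N ^ k)"
    by (intro sum.cong refl nsq_V)
  then show ?thesis using N by (simp add: card_tuples)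
qed

lemma out_entropy_nonneg: "g \<in> unit_vectors k \<Longrightarrow> 0 \<le> out_entropy k g"
  unfolding out_entropy_def 
  by (rule matrix_entropy_nonneg[OF finite_tuples V_ell2]) (simp_all add: unit_vectors_def V_trace del: One_nat_def)

lemma V_tens:
  assumes "I \<in> tuples (k + l) {1..N}"
  shows "V (k + l) I (tens k f g) = tens k (V k (take k I) f) (V l (drop k I) g)"
proof
  fix ws
  have mem: "ws \<in> tuples (k + l) W \<longleftrightarrow> take k ws \<in> tuples k W \<and> drop k ws \<in> tuples l W"
  proof
    assume "take k ws \<in> tuples k W \<and> drop k ws \<in> tuples l W"
    then have "take k ws @ drop k ws \<in> tuples (k + l) W" by (simp only: tuples_def mem_Collect_eq length_append set_append) auto
    then show "ws \<in> tuples (k + l) W" by simp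
  qed (simp add: take_drop_tuples)
  show "V (k + l) I (tens k f g) ws = tens k (V k (take k I) f) (V l (drop k I) g) ws"
    by (simp add: V_def tens_def permop_def mem take_map drop_map take_zip drop_zip power_add mult_ac)
qed

lemma tens_unit: "f \<in> unit_vectors k \<Longrightarrow> g \<in> unit_vectors l \<Longrightarrow> tens k f g \<in> unit_vectors (k + l)"
  by (simp add: unit_vectors_def tens_ell2 nsq_tens)

lemma out_entropy_tens:
  assumes f: "f \<in> unit_vectors k" and g: "g \<in> unit_vectors l"
  shows "out_entropy (k + l) (tens k f g) = out_entropy k f + out_entropy l g"
  unfolding out_entropy_def
proof (rule matrix_entropy_product[where g = "take k" and g' = "drop k"])
  have f2: "f \<in> ell2 (tuples k W)" and g2: "g \<in> ell2 (tuples l W)" using f g by (auto simp: unit_vectors_def)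
  show "bij_betw (\<lambda>J. (take k J, drop k J)) (tuples (k + l) {1..N}) (tuples k {1..N} \<times> tuples l {1..N})"
    by (rule bij_betw_take_drop)
  show "V k J f \<in> ell2 (tuples k W)" if "J \<in> tuples k {1..N}" for J by (rule V_ell2[OF that f2])
  show "V l J g \<in> ell2 (tuples l W)" if "J \<in> tuples l {1..N}" for J by (rule V_ell2[OF that g2])
  show "V (k + l) J (tens k f g) \<in> ell2 (tuples (k + l) W)" if "J \<in> tuples (k + l) {1..N}" for J
    by (rule V_ell2[OF that tens_ell2[OF f2 g2]])
  show "gram (tuples (k + l) W) (\<lambda>J. V (k + l) J (tens k f g)) I J = 
    gram (tuples k W) (\<lambda>J. V k J f) (take k I) (take k J) * gram (tuples l W) (\<lambda>J. V l J g) (drop k I) (drop k J)"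
    if I: "I \<in> tuples (k + l) {1..N}" and J: "J \<in> tuples (k + l) {1..N}" for I J
    unfolding gram_def V_tens[OF I] V_tens[OF J]
    by (rule ip_tens) (intro V_ell2 take_drop_tuples[OF I] take_drop_tuples[OF J] f2 g2)+
qed (use f g in \<open>simp_all add: finite_tuples V_trace unit_vectors_def del: One_nat_def\<close>)

lemma unit_vectors_nonempty: "unit_vectors k \<noteq> {}"
proof -
  have "replicate k w\<^sub>0 \<in> tuples k W" using w\<^sub>0 by (auto simp: tuples_def)
  then have "delta (replicate k w\<^sub>0) \<in> unit_vectors k" by (simp add: unit_vectors_def)
  then show ?thesis by auto
qed

text \<open>
  The limit is reached from the infima over the unit vectors; it is at most the first term because
  \<open>a k \<le> k a 1\<close>, and at least every lower bound of the terms \<open>a k / k\<close>.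
\<close>

lemma regularized_moe_eq:
  assumes \<Phi>: "\<And>\<rho>. \<rho> \<in> trace_class H \<Longrightarrow> \<Phi> \<rho> = kraus_map H E {1..N} \<rho>"
  obtains L where "regularized_moe H \<Phi> = ereal L"
    and "\<And>g. g \<in> unit_vectors 1 \<Longrightarrow> L \<le> out_entropy 1 g"
    and "\<And>\<kappa>. (\<And>k g. g \<in> unit_vectors k \<Longrightarrow> real k * \<kappa> \<le> out_entropy k g) \<Longrightarrow> \<kappa> \<le> L"
proof -
  define a where "a = (\<lambda>k. Inf (out_entropy k ` unit_vectors k))"
  have bdd: "bdd_below (out_entropy k ` unit_vectors k)" for k
    by (rule bdd_belowI2[of _ 0]) (rule out_entropy_nonneg)
  have a_le: "a k \<le> out_entropy k g" if "g \<in> unit_vectors k" for k g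
    unfolding a_def by (rule cINF_lower[OF bdd that])
  have a_greatest: "z \<le> a k" if "\<And>g. g \<in> unit_vectors k \<Longrightarrow> z \<le> out_entropy k g" for z k
    unfolding a_def by (rule cINF_greatest[OF unit_vectors_nonempty that])
  have sub: "a (k + l) \<le> a k + a l" for k l
  proof -
    have "a (k + l) - a l \<le> a k"
    proof (rule a_greatest)
      fix f assume f: "f \<in> unit_vectors k"
      have "a (k + l) - out_entropy k f \<le> a l"
      proof (rule a_greatest)
        fix g assume g: "g \<in> unit_vectors l"
        show "a (k + l) - out_entropy k f \<le> out_entropy l g"
          using a_le[OF tens_unit[OF f g]] out_entropy_tens[OF f g] by simp
      qed
      then show "a (k + l) - a l \<le> out_entropy k f" by simp
    qed
    then show ?thesis by simp
  qed
  have nonneg: "0 \<le> a k" for k by (rule a_greatest) (rule out_entropy_nonneg)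
  obtain L where L: "(\<lambda>k. a k / real k) \<longlonglongrightarrow> L" "L \<le> a 1"
    using Fekete_subadditive[of a, OF sub nonneg] .
  have moe: "min_output_entropy (tensor_space H k) (tensor_power H k \<Phi>) = ereal (a k)" for k
  proof -
    have "min_output_entropy (tensor_space H k) (tensor_power H k \<Phi>) = (INF g\<in>unit_vectors k. ereal (out_entropy k g))"
      unfolding unit_vectors_def by (rule min_output_entropy_tensor_power[OF \<Phi>])
    also have "\<dots> = (INF s\<in>out_entropy k ` unit_vectors k. ereal s)" by (simp add: image_image)
    also have "\<dots> = ereal (a k)"
      unfolding a_def by (rule ereal_Inf'[symmetric, OF bdd]) (use unit_vectors_nonempty in simp)
    finally show ?thesis .
  qed
  have "(\<lambda>k. ereal (1 / real k) * min_output_entropy (tensor_space H k) (tensor_power H k \<Phi>)) \<longlonglongrightarrow> ereal L"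
    unfolding moe using L(1) by simp
  then have "regularized_moe H \<Phi> = ereal L" unfolding regularized_moe_def by (rule limI)
  moreover have "L \<le> out_entropy 1 g" if "g \<in> unit_vectors 1" for g
    using L(2) a_le[OF that] by simp
  moreover have "\<kappa> \<le> L" if \<kappa>: "\<And>k g. g \<in> unit_vectors k \<Longrightarrow> real k * \<kappa> \<le> out_entropy k g" for \<kappa>
  proof (rule LIMSEQ_le_const[OF L(1)])
    have "\<kappa> \<le> a k / real k" if "1 \<le> k" for k
    proof -
      have "real k * \<kappa> \<le> a k" by (rule a_greatest) (rule \<kappa>)
      then show ?thesis using that by (simp add: pos_le_divide_eq mult.commute)
    qed
    then show "\<exists>K. \<forall>k\<ge>K. \<kappa> \<le> a k / real k" by blast
  qed
  ultimately show ?thesis by (rule that)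
qed

text \<open>
  For the normalized vectors \<open>V k J g\<close> the Haagerup inequality bounds the trace of the square of the
  output by \<open>((N + 9) / N\<^sup>2)\<^sup>k\<close>.
\<close>

lemma out_entropy_lower_bound:
  assumes disj: "\<And>i j x. i \<in> {1..N} \<Longrightarrow> j \<in> {1..N} \<Longrightarrow> x \<in> W \<Longrightarrow> P i x \<Longrightarrow> P j x \<Longrightarrow> i = j"
    and flip: "\<And>i x. i \<in> {1..N} \<Longrightarrow> x \<in> W \<Longrightarrow> P i (\<pi> i x) \<longleftrightarrow> \<not> P i x"
    and g: "g \<in> unit_vectors k"
  shows "real k * ln ((real N)\<^sup>2 / (real N + 9)) \<le> out_entropy k g"
proof -
  let ?X = "tuples k W"
  let ?s = "((real N + 9) / (real N)\<^sup>2) ^ k"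
  have g2: "g \<in> ell2 ?X" "nsq ?X g = 1" using g by (auto simp: unit_vectors_def)
  have "cmod c = 1 / sqrt (real N)" unfolding c_def norm_of_real by simp
  then have "cmod c * cmod c = 1 / real N" by simp
  then have cc: "cmod (cnj (c ^ k) * c ^ k) = 1 / real N ^ k"
    by (simp add: norm_mult norm_power power_mult_distrib[symmetric] power_one_over)
  have gr: "(cmod (gram ?X (\<lambda>J. V k J g) I J))\<^sup>2 = 
      (cmod (ip ?X (permop ?X (map2 \<pi> I) g) (permop ?X (map2 \<pi> J) g)))\<^sup>2 / (real N ^ k)\<^sup>2" for I J
    unfolding gram_def V_def ip_scale_left ip_scale_right mult.assoc[symmetric] norm_mult[of "cnj (c ^ k) * c ^ k"] cc
    by (simp add: power_mult_distrib power_divide)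
  have "(\<Sum>I\<in>tuples k {1..N}. \<Sum>J\<in>tuples k {1..N}. (cmod (gram ?X (\<lambda>J. V k J g) I J))\<^sup>2) = 
    (\<Sum>I\<in>tuples k {1..N}. \<Sum>J\<in>tuples k {1..N}. (cmod (ip ?X (permop ?X (map2 \<pi> I) g) (permop ?X (map2 \<pi> J) g)))\<^sup>2) / (real N ^ k)\<^sup>2"
    unfolding gr sum_divide_distrib ..
  also have "\<dots> \<le> (real N + 9) ^ k / (real N ^ k)\<^sup>2"
  proof (rule divide_right_mono)
    show "(\<Sum>I\<in>tuples k {1..N}. \<Sum>J\<in>tuples k {1..N}. (cmod (ip ?X (permop ?X (map2 \<pi> I) g) (permop ?X (map2 \<pi> J) g)))\<^sup>2) \<le> (real N + 9) ^ k"
      using Haagerup_tuples[of N W \<pi> P, OF inv disj flip g2(1) g2(1)] g2(2) by simp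
  qed simp
  also have "\<dots> = ?s" by (simp add: power_divide power_mult[symmetric] mult.commute)
  finally have le: "(\<Sum>I\<in>tuples k {1..N}. \<Sum>J\<in>tuples k {1..N}. (cmod (gram ?X (\<lambda>J. V k J g) I J))\<^sup>2) \<le> ?s" .
  have pos: "0 < (real N + 9) / (real N)\<^sup>2" using N by simp
  have "- ln ?s \<le> out_entropy k g"
    unfolding out_entropy_def
  proof (rule matrix_entropy_lower_bound[OF finite_tuples V_ell2])
    show "0 < ?s" using pos by simp
  qed (use g2 le in \<open>simp_all add: V_trace del: One_nat_def\<close>)
  moreover have "- ln ?s = real k * ln ((real N)\<^sup>2 / (real N + 9))"
    using N pos by (simp add: ln_realpow ln_div algebra_simps)
  ultimately show ?thesis by simp
qed

text \<open>
  The output at \<open>delta [x]\<close> is diagonal: a point \<open>y\<close> has the weight \<open>m y / N\<close>, where \<open>m y\<close> counts the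
  indices that send \<open>x\<close> to \<open>y\<close>.  The sum over points becomes a sum over indices, in which each point is
  counted \<open>m y\<close> times.
\<close>

lemma out_entropy_delta:
  assumes x: "x \<in> W"
  shows "delta [x] \<in> unit_vectors 1"
    and "out_entropy 1 (delta [x]) = (\<Sum>j\<in>{1..N}. - ln (real (card {i \<in> {1..N}. \<pi> i x = \<pi> j x}) / real N)) / real N"
proof -
  let ?X = "tuples 1 W"
  have x1: "[x] \<in> ?X" using x by (simp add: tuples_def)
  show "delta [x] \<in> unit_vectors 1" using x1 by (simp add: unit_vectors_def)
  interpret l2: ell2_model "l2_space ?X" ?X by (rule l2.ell2_model_axioms)
  define Y where "Y = (\<lambda>j. \<pi> j x) ` {1..N}"
  define m where "m = (\<lambda>y. card {i \<in> {1..N}. \<pi> i x = y})"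
  define w where "w = (\<lambda>y xs. of_real (sqrt (real (m y) / real N)) * delta [y] xs)"
  have YW: "Y \<subseteq> W" using inv x by (auto simp: Y_def involution_on_def)
  have y1: "[y] \<in> ?X" if "y \<in> Y" for y using YW that by (auto simp: tuples_def)
  have w2: "w y \<in> ell2 ?X" if "y \<in> Y" for y
    unfolding w_def by (intro ell2_scale delta_ell2 y1 that)
  have V1: "V 1 [j] (delta [x]) = (\<lambda>xs. c * delta [\<pi> j x] xs)" if j: "j \<in> {1..N}" for j
  proof
    fix xs :: "'x list"
    show "V 1 [j] (delta [x]) xs = c * delta [\<pi> j x] xs"
    proof (cases "xs \<in> ?X")
      case True
      then obtain y where y: "xs = [y]" "y \<in> W" by (auto simp: tuples_def length_Suc_conv)
      have "\<pi> j (\<pi> j x) = x" "\<pi> j (\<pi> j y) = y" using inv[OF j] x y by (simp_all add: involution_on_def)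
      then have "\<pi> j y = x \<longleftrightarrow> y = \<pi> j x" by metis
      then show ?thesis using True y by (simp add: V_def permop_def delta_def)
    next
      case False
      have "[\<pi> j x] \<in> ?X" using inv[OF j] x by (simp add: tuples_def involution_on_def)
      then have "xs \<noteq> [\<pi> j x]" using False by auto
      then show ?thesis using False by (simp add: V_def permop_def delta_def)
    qed
  qed
  have bij: "bij_betw (\<lambda>j. [j]) {1..N} (tuples 1 {1..N})"
    by (rule bij_betwI[where g = hd]) (auto simp: tuples_def length_Suc_conv)
  have "frame_op ?X (tuples 1 {1..N}) (\<lambda>J. V 1 J (delta [x])) = frame_op ?X Y w"
    unfolding frame_op_def
  proof (intro restrict_ext ext)
    fix f xs assume f: "f \<in> ell2 ?X"
    have "(\<Sum>J\<in>tuples 1 {1..N}. ip ?X (V 1 J (delta [x])) f * V 1 J (delta [x]) xs) = 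
      (\<Sum>j\<in>{1..N}. ip ?X (V 1 [j] (delta [x])) f * V 1 [j] (delta [x]) xs)"
      by (rule sum.reindex_bij_betw[OF bij, symmetric])
    also have "\<dots> = (\<Sum>j\<in>{1..N}. (\<lambda>y. f [y] * delta [y] xs / of_nat N) (\<pi> j x))"
    proof (intro sum.cong refl)
      fix j assume j: "j \<in> {1..N}"
      then have "[\<pi> j x] \<in> ?X" using inv[OF j] x by (simp add: tuples_def involution_on_def)
      then have "ip ?X (V 1 [j] (delta [x])) f * V 1 [j] (delta [x]) xs = (c * c) * (f [\<pi> j x] * delta [\<pi> j x] xs)"
        unfolding V1[OF j] ip_scale_left c_sq(2) by (simp add: mult_ac)
      then show "ip ?X (V 1 [j] (delta [x])) f * V 1 [j] (delta [x]) xs = (\<lambda>y. f [y] * delta [y] xs / of_nat N) (\<pi> j x)"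
        unfolding c_sq(1) by simp
    qed
    also have "\<dots> = (\<Sum>y\<in>Y. of_nat (m y) * (f [y] * delta [y] xs / of_nat N))"
      unfolding m_def by (rule sum_fun_comp) (auto simp: Y_def)
    also have "\<dots> = (\<Sum>y\<in>Y. ip ?X (w y) f * w y xs)"
    proof (intro sum.cong refl)
      fix y assume y: "y \<in> Y"
      have "complex_of_real (sqrt (real (m y) / real N)) * of_real (sqrt (real (m y) / real N)) = of_real (real (m y) / real N)"
        unfolding of_real_mult[symmetric] by simp
      then have "ip ?X (w y) f * w y xs = of_real (real (m y) / real N) * (f [y] * delta [y] xs)"
        unfolding w_def ip_scale_left ip_delta_left[OF y1[OF y]] complex_cnj_complex_of_real by (metis mult.assoc mult.left_commute)
      then show "of_nat (m y) * (f [y] * delta [y] xs / of_nat N) = ip ?X (w y) f * w y xs" by simp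
    qed
    finally show "(\<Sum>J\<in>tuples 1 {1..N}. ip ?X (V 1 J (delta [x])) f * V 1 J (delta [x]) xs) = (\<Sum>y\<in>Y. ip ?X (w y) f * w y xs)" .
  qed
  moreover have "entropy (l2_space ?X) (frame_op ?X (tuples 1 {1..N}) (\<lambda>J. V 1 J (delta [x]))) = ereal (out_entropy 1 (delta [x]))"
    unfolding out_entropy_def
    by (rule entropy_frame_op[OF finite_tuples V_ell2 l2.ell2_model_axioms]) (use x1 in simp_all)
  moreover have "entropy (l2_space ?X) (frame_op ?X Y w) = ereal (\<Sum>y\<in>Y. - (nsq ?X (w y) * ln (nsq ?X (w y))))"
  proof (rule l2.entropy_frame_op_orthogonal[OF _ w2])
    show "finite Y" by (simp add: Y_def)
    fix y z assume "y \<in> Y" "z \<in> Y" "y \<noteq> z"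
    then show "ip ?X (w y) (w z) = 0"
      unfolding w_def ip_scale_left ip_scale_right using y1[of y] by (simp add: delta_def[of "[z]"])
  qed
  ultimately have "out_entropy 1 (delta [x]) = (\<Sum>y\<in>Y. - (nsq ?X (w y) * ln (nsq ?X (w y))))" by simp
  also have "\<dots> = (\<Sum>y\<in>Y. real (m y) * (- ln (real (m y) / real N) / real N))"
  proof (intro sum.cong refl)
    fix y assume y: "y \<in> Y"
    have "nsq ?X (w y) = real (m y) / real N"
      unfolding w_def nsq_scale nsq_delta[OF y1[OF y]] norm_of_real by simp
    then show "- (nsq ?X (w y) * ln (nsq ?X (w y))) = real (m y) * (- ln (real (m y) / real N) / real N)" by simp
  qed
  also have "\<dots> = (\<Sum>j\<in>{1..N}. - ln (real (m (\<pi> j x)) / real N) / real N)"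
    unfolding m_def by (rule sum_fun_comp[symmetric]) (auto simp: Y_def)
  finally show "out_entropy 1 (delta [x]) = (\<Sum>j\<in>{1..N}. - ln (real (card {i \<in> {1..N}. \<pi> i x = \<pi> j x}) / real N)) / real N"
    unfolding m_def sum_divide_distrib .
qed

end

section \<open>Words over involutive letters\<close>

text \<open>
  Multiplication by a letter cancels an equal letter at the same end of the word.
\<close>

definition mult_left :: "nat \<Rightarrow> nat list \<Rightarrow> nat list" where
  "mult_left i w = (if w \<noteq> [] \<and> hd w = i then tl w else i # w)"

definition mult_right :: "nat \<Rightarrow> nat list \<Rightarrow> nat list" where
  "mult_right j w = (if w \<noteq> [] \<and> last w = j then butlast w else w @ [j])"

lemma distinct_adj_mult_left: "distinct_adj w \<Longrightarrow> distinct_adj (mult_left i w)"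
  by (cases w) (auto simp: mult_left_def distinct_adj_Cons)

lemma mult_left_involution: "distinct_adj w \<Longrightarrow> mult_left i (mult_left i w) = w"
  by (cases w) (auto simp: mult_left_def distinct_adj_Cons)

lemma mult_right_rev: "mult_right j w = rev (mult_left j (rev w))"
  by (cases w rule: rev_cases) (auto simp: mult_left_def mult_right_def)

lemma distinct_adj_mult_right: "distinct_adj w \<Longrightarrow> distinct_adj (mult_right j w)"
  by (simp add: mult_right_rev distinct_adj_mult_left)

lemma mult_right_involution: "distinct_adj w \<Longrightarrow> mult_right j (mult_right j w) = w"
  by (simp add: mult_right_rev mult_left_involution)

text \<open>
  The two multiplications act on different ends of the word, except for words of length at most one.
\<close>

lemma mult_left_right: "mult_left i (mult_right j w) = mult_right j (mult_left i w)"
proof (cases w)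
  case (Cons a v)
  then show ?thesis
    by (cases v rule: rev_cases) (auto simp: mult_left_def mult_right_def)
qed (simp add: mult_left_def mult_right_def)

lemma mult_left_flip: "distinct_adj w \<Longrightarrow> (mult_left i w \<noteq> [] \<and> hd (mult_left i w) = i) \<longleftrightarrow> \<not> (w \<noteq> [] \<and> hd w = i)"
  by (cases w) (auto simp: mult_left_def distinct_adj_Cons)

lemma mult_right_flip: "distinct_adj w \<Longrightarrow> (mult_right i w \<noteq> [] \<and> last (mult_right i w) = i) \<longleftrightarrow> \<not> (w \<noteq> [] \<and> last w = i)"
  using mult_left_flip[of "rev w" i] by (simp add: mult_right_rev hd_rev last_rev)

text \<open>
  Words are encoded as numbers, so that the families on them have the type \<open>nat \<Rightarrow> complex\<close>.
\<close>

definition Words :: "nat set" where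
  "Words = to_nat ` {w :: nat list. distinct_adj w}"

definition on_code :: "(nat list \<Rightarrow> nat list) \<Rightarrow> nat \<Rightarrow> nat" where
  "on_code \<sigma> x = to_nat (\<sigma> (from_nat x))"

lemma on_code_to_nat [simp]: "on_code \<sigma> (to_nat w) = to_nat (\<sigma> w)"
  by (simp add: on_code_def)

lemma involution_on_Words:
  assumes "\<And>w. distinct_adj w \<Longrightarrow> distinct_adj (\<sigma> w) \<and> \<sigma> (\<sigma> w) = w"
  shows "involution_on Words (on_code \<sigma>)"
  unfolding involution_on_def
proof
  fix x assume "x \<in> Words"
  then obtain w :: "nat list" where w: "distinct_adj w" "x = to_nat w" by (auto simp: Words_def)
  then show "on_code \<sigma> x \<in> Words \<and> on_code \<sigma> (on_code \<sigma> x) = x"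
    using assms[OF w(1)] by (simp add: Words_def)
qed

lemma to_nat_Words: "to_nat w \<in> Words \<longleftrightarrow> distinct_adj w" for w :: "nat list"
  unfolding Words_def by (simp add: inj_image_mem_iff)

section \<open>The additivity violation\<close>

text \<open>
  The word \<open>v p\<close> is the value of the product of two letters: the \<open>n\<close> pairs of equal letters share the empty
  word, and the other \<open>n\<^sup>2 - n\<close> pairs give distinct words.
\<close>

lemma average_log_multiplicity:
  assumes n: "0 < n" and h: "bij_betw h {1..n * n} ({1..n} \<times> {1..n})"
    and val: "\<And>p. p \<in> {1..n * n} \<Longrightarrow> v p = (if fst (h p) = snd (h p) then [] else [fst (h p), snd (h p)])"
  shows "(\<Sum>p\<in>{1..n * n}. - ln (real (card {q \<in> {1..n * n}. v q = v p}) / real (n * n))) / real (n * n)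
    = 2 * ln (real n) - ln (real n) / real n"
proof -
  let ?g = "\<lambda>(i, j). if i = j then ln (real n) else 2 * ln (real n)"
  have hp: "fst (h p) \<in> {1..n} \<and> snd (h p) \<in> {1..n}" if "p \<in> {1..n * n}" for p
    using bspec[OF bij_betwE[OF h] that] unfolding mem_Times_iff .
  have card_eq: "card {q \<in> {1..n * n}. R (h q)} = card {r \<in> {1..n} \<times> {1..n}. R r}" for R
  proof (rule bij_betw_same_card[of h])
    show "bij_betw h {q \<in> {1..n * n}. R (h q)} {r \<in> {1..n} \<times> {1..n}. R r}"
      unfolding bij_betw_def
    proof
      show "inj_on h {q \<in> {1..n * n}. R (h q)}"
        by (rule inj_on_subset[OF bij_betw_imp_inj_on[OF h]]) auto
      have "h ` {q \<in> {1..n * n}. R (h q)} = {r \<in> h ` {1..n * n}. R r}" by blast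
      then show "h ` {q \<in> {1..n * n}. R (h q)} = {r \<in> {1..n} \<times> {1..n}. R r}"
        unfolding bij_betw_imp_surj_on[OF h] .
    qed
  qed
  have "- ln (real (card {q \<in> {1..n * n}. v q = v p}) / real (n * n)) = ?g (h p)" if p: "p \<in> {1..n * n}" for p
  proof (cases "fst (h p) = snd (h p)")
    case True
    have "v q = v p \<longleftrightarrow> fst (h q) = snd (h q)" if "q \<in> {1..n * n}" for q
      using val[OF that] val[OF p] True by simp
    then have "{q \<in> {1..n * n}. v q = v p} = {q \<in> {1..n * n}. fst (h q) = snd (h q)}"
      by (intro Collect_cong conj_cong refl)
    moreover have "{r \<in> {1..n} \<times> {1..n}. fst r = snd r} = (\<lambda>i. (i, i)) ` {1..n}" by auto
    moreover have "card ((\<lambda>i. (i, i)) ` {1..n}) = n" by (subst card_image) (auto simp: inj_on_def)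
    ultimately have "card {q \<in> {1..n * n}. v q = v p} = n" using card_eq[of "\<lambda>r. fst r = snd r"] by simp
    then show ?thesis using n True by (simp add: split_def ln_div)
  next
    case False
    have "v q = v p \<longleftrightarrow> h q = h p" if "q \<in> {1..n * n}" for q
      using val[OF that] val[OF p] False by (auto simp: prod_eq_iff)
    then have "{q \<in> {1..n * n}. v q = v p} = {q \<in> {1..n * n}. h q = h p}"
      by (intro Collect_cong conj_cong refl)
    moreover have "{r \<in> {1..n} \<times> {1..n}. r = h p} = {h p}" using hp[OF p] by (auto simp: mem_Times_iff)
    ultimately have "card {q \<in> {1..n * n}. v q = v p} = 1" using card_eq[of "\<lambda>r. r = h p"] by simp
    then show ?thesis using n False by (simp add: split_def ln_div ln_mult)
  qed
  then have "(\<Sum>p\<in>{1..n * n}. - ln (real (card {q \<in> {1..n * n}. v q = v p}) / real (n * n))) = (\<Sum>p\<in>{1..n * n}. ?g (h p))"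
    by (intro sum.cong refl)
  also have "\<dots> = (\<Sum>r\<in>{1..n} \<times> {1..n}. ?g r)" by (rule sum.reindex_bij_betw[OF h])
  also have "\<dots> = (\<Sum>i\<in>{1..n}. \<Sum>j\<in>{1..n}. 2 * ln (real n) - (if j = i then ln (real n) else 0))"
    unfolding sum.cartesian_product' by (intro sum.cong refl) auto
  also have "\<dots> = real n * (real n * (2 * ln (real n)) - ln (real n))"
    by (simp add: sum_subtractf algebra_simps)
  finally have "(\<Sum>p\<in>{1..n * n}. - ln (real (card {q \<in> {1..n * n}. v q = v p}) / real (n * n))) / real (n * n) =
    real n * (real n * (2 * ln (real n)) - ln (real n)) / real (n * n)" by simp
  also have "\<dots> = 2 * ln (real n) - ln (real n) / real n" using n by (simp add: field_simps)
  finally show ?thesis .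
qed

lemma entropy_gap:
  fixes n :: real
  assumes n: "0 < n" and large: "18 < ln n"
  shows "2 * ln n - ln n / n < 2 * ln (n\<^sup>2 / (n + 9))"
proof -
  have "n + 9 = n * (1 + 9 / n)" using n by (simp add: field_simps)
  then have "ln (n + 9) = ln (n * (1 + 9 / n))" by (rule arg_cong)
  also have "\<dots> = ln n + ln (1 + 9 / n)"
  proof -
    have "0 < 1 + 9 / n" using n by (simp add: add_pos_pos)
    then show ?thesis using n by (intro ln_mult_pos)
  qed
  also have "ln (1 + 9 / n) \<le> 9 / n" using n by (intro ln_add_one_self_le_self) simp
  finally have "2 * ln (n + 9) \<le> 2 * ln n + 18 / n" by simp
  also have "18 / n < ln n / n" using n large by (simp add: divide_strict_right_mono)
  finally have "2 * ln (n + 9) < 2 * ln n + ln n / n" by simp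
  moreover have "ln (n\<^sup>2 / (n + 9)) = 2 * ln n - ln (n + 9)"
    using n by (simp add: ln_div ln_realpow)
  ultimately show ?thesis by simp
qed

theorem theorem1p1:
  shows "\<exists>(H :: (nat \<Rightarrow> complex) cinner_space) (m::nat) (n::nat) E F \<Phi>\<^sub>1 \<Phi>\<^sub>2.
    complex_hilbert_space H \<and> 0 < m \<and> 0 < n \<and>
    (\<forall>i\<in>{1..m}. E i \<in> bounded_ops H) \<and> (\<forall>j\<in>{1..n}. F j \<in> bounded_ops H) \<and>
    (\<forall>i\<in>{1..m}. \<forall>j\<in>{1..n}. op_mult H (E i) (F j) = op_mult H (F j) (E i)) \<and>
    op_sum H (\<lambda>i. op_mult H (adjoint_op H (E i)) (E i)) {1..m} = op_id H \<and>
    op_sum H (\<lambda>j. op_mult H (adjoint_op H (F j)) (F j)) {1..n} = op_id H \<and>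
    \<Phi>\<^sub>1 = kraus_map H E {1..m} \<and> \<Phi>\<^sub>2 = kraus_map H F {1..n} \<and>
    regularized_moe H (\<Phi>\<^sub>1 \<circ> \<Phi>\<^sub>2) < regularized_moe H \<Phi>\<^sub>1 + regularized_moe H \<Phi>\<^sub>2"
proof -
  define n where "n = nat \<lceil>exp (19 :: real)\<rceil>"
  have n_ge: "exp 19 \<le> real n" unfolding n_def by (rule real_nat_ceiling_ge)
  have n: "0 < n" using less_le_trans[OF exp_gt_zero n_ge] by simp
  \<comment> \<open>Any n with ln n > 18 will do.\<close>
  have "ln (exp 19) \<le> ln (real n)" using n_ge n by (subst ln_le_cancel_iff) auto
  then have large: "18 < ln (real n)" by simp
  let ?H = "l2_space Words" and ?w\<^sub>0 = "to_nat [0 :: nat]"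
  let ?l = "\<lambda>i. on_code (mult_left i)" and ?r = "\<lambda>j. on_code (mult_right j)"
  have card: "card {1..n * n} = card ({1..n} \<times> {1..n})" by (simp add: card_cartesian_product)
  obtain h where h: "bij_betw h {1..n * n} ({1..n} \<times> {1..n})"
    using finite_same_card_bij[OF _ _ card] by auto
  let ?lr = "\<lambda>p. on_code (\<lambda>w. mult_right (snd (h p)) (mult_left (fst (h p)) w))"
  have hp: "fst (h p) \<in> {1..n}" "snd (h p) \<in> {1..n}" if "p \<in> {1..n * n}" for p
    using bspec[OF bij_betwE[OF h] that] unfolding mem_Times_iff by simp_all
  have w0: "?w\<^sub>0 \<in> Words" by (simp add: to_nat_Words)
  \<comment> \<open>The letter 0 is not among the generators 1, ..., n, so that multiplications never cancel it.\<close>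
  interpret L: perm_channel Words ?H "some_onb ?H" n ?l ?w\<^sub>0
  proof unfold_locales
    show "involution_on Words (?l i)" for i
      by (rule involution_on_Words) (simp add: distinct_adj_mult_left mult_left_involution)
    show "inj_on (\<lambda>i. ?l i ?w\<^sub>0) {1..n}"
      by (rule inj_onI) (simp add: mult_left_def)
  qed (use n w0 in simp_all)
  interpret R: perm_channel Words ?H "some_onb ?H" n ?r ?w\<^sub>0
  proof unfold_locales
    show "involution_on Words (?r i)" for i
      by (rule involution_on_Words) (simp add: distinct_adj_mult_right mult_right_involution)
    show "inj_on (\<lambda>i. ?r i ?w\<^sub>0) {1..n}"
      by (rule inj_onI) (simp add: mult_right_def)
  qed (use n w0 in simp_all)
  interpret LR: perm_channel Words ?H "some_onb ?H" "n * n" ?lr ?w\<^sub>0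
  proof unfold_locales
    show "involution_on Words (?lr p)" for p
      by (rule involution_on_Words)
         (simp add: distinct_adj_mult_right distinct_adj_mult_left mult_left_right mult_left_involution mult_right_involution)
    show "inj_on (\<lambda>p. ?lr p ?w\<^sub>0) {1..n * n}"
    proof (rule inj_onI)
      fix p q assume p: "p \<in> {1..n * n}" and q: "q \<in> {1..n * n}" and eq: "?lr p ?w\<^sub>0 = ?lr q ?w\<^sub>0"
      have "?lr p ?w\<^sub>0 = to_nat [fst (h p), 0, snd (h p)]" if "p \<in> {1..n * n}" for p
        using hp[OF that] by (simp add: mult_left_def mult_right_def)
      then have "h p = h q" using eq p q by (simp add: prod_eq_iff)
      then show "p = q" using inj_onD[OF bij_betw_imp_inj_on[OF h]] p q by blast
    qed
  qed (use n w0 in simp_all)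
  have comp: "op_mult ?H (L.E (fst (h p))) (R.E (snd (h p))) = LR.E p" if p: "p \<in> {1..n * n}" for p
  proof (rule extensionalityI[where A = "ell2 Words"])
    have bd: "L.E (fst (h p)) \<in> bounded_ops ?H" "R.E (snd (h p)) \<in> bounded_ops ?H"
      using L.E_bounded R.E_bounded hp[OF p] by auto
    show "op_mult ?H (L.E (fst (h p))) (R.E (snd (h p))) \<in> extensional (ell2 Words)"
      by (rule l2.bounded_opsD(2)[OF l2.bounded_ops_mult[OF bd]])
    show "LR.E p \<in> extensional (ell2 Words)" by (rule l2.bounded_opsD(2)[OF LR.E_bounded[OF p]])
    fix f :: "nat \<Rightarrow> complex" assume f: "f \<in> ell2 Words"
    have "L.c * R.c = LR.c" unfolding L.c_def R.c_def LR.c_def of_real_mult[symmetric] by (simp add: real_sqrt_mult)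
    moreover have "?l (fst (h p)) x \<in> Words" if "x \<in> Words" for x
      using L.inv[OF hp(1)[OF p]] that by (simp add: involution_on_def)
    ultimately show "op_mult ?H (L.E (fst (h p))) (R.E (snd (h p))) f = LR.E p f"
      unfolding l2.op_mult_apply[OF f] LR.E_apply[OF f] L.E_apply[OF l2.bounded_opsD(1)[OF bd(2) f]]
      unfolding R.E_apply[OF f] by (auto simp: permop_def on_code_def fun_eq_iff)
  qed
  have commute: "op_mult ?H (L.E i) (R.E j) = op_mult ?H (R.E j) (L.E i)" if i: "i \<in> {1..n}" and j: "j \<in> {1..n}" for i j
  proof (rule extensionalityI[where A = "ell2 Words"])
    have bd: "L.E i \<in> bounded_ops ?H" "R.E j \<in> bounded_ops ?H" using L.E_bounded R.E_bounded i j by auto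
    show "op_mult ?H (L.E i) (R.E j) \<in> extensional (ell2 Words)" "op_mult ?H (R.E j) (L.E i) \<in> extensional (ell2 Words)"
      by (rule l2.bounded_opsD(2)[OF l2.bounded_ops_mult], rule bd, rule bd)+
    fix f :: "nat \<Rightarrow> complex" assume f: "f \<in> ell2 Words"
    have "?l i x \<in> Words" "?r j x \<in> Words" if "x \<in> Words" for x
      using L.inv[OF i] R.inv[OF j] that by (simp_all add: involution_on_def)
    then show "op_mult ?H (L.E i) (R.E j) f = op_mult ?H (R.E j) (L.E i) f"
      unfolding l2.op_mult_apply[OF f] L.E_apply[OF l2.bounded_opsD(1)[OF bd(2) f]] R.E_apply[OF l2.bounded_opsD(1)[OF bd(1) f]]
      unfolding L.E_apply[OF f] R.E_apply[OF f] by (auto simp: permop_def on_code_def mult_left_right fun_eq_iff)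
  qed
  let ?\<Phi> = "kraus_map ?H L.E {1..n}" and ?\<Psi> = "kraus_map ?H R.E {1..n}"
  have composite: "(?\<Phi> \<circ> ?\<Psi>) \<rho> = kraus_map ?H LR.E {1..n * n} \<rho>" if "\<rho> \<in> trace_class ?H" for \<rho>
  proof -
    have \<rho>: "\<rho> f \<in> ell2 Words" if "f \<in> ell2 Words" for f
      using \<open>\<rho> \<in> trace_class ?H\<close> l2.bounded_opsD(1)[OF _ that] by (auto simp: trace_class_def)
    let ?C = "\<lambda>(i, j). op_mult ?H (L.E i) (R.E j)"
    have C: "?C q \<in> bounded_ops ?H" if "q \<in> {1..n} \<times> {1..n}" for q
      using that by (auto intro!: l2.bounded_ops_mult L.E_bounded R.E_bounded)
    have "(?\<Phi> \<circ> ?\<Psi>) \<rho> = kraus_map ?H ?C ({1..n} \<times> {1..n}) \<rho>"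
      unfolding o_def by (rule l2.kraus_map_compose[OF _ _ L.E_bounded R.E_bounded \<rho>]) simp_all
    also have "\<dots> = kraus_map ?H (\<lambda>p. ?C (h p)) {1..n * n} \<rho>"
      by (rule l2.kraus_map_reindex[OF h _ C \<rho>, symmetric]) simp_all
    also have "\<dots> = (\<lambda>f\<in>ell2 Words. \<lambda>x. \<Sum>p\<in>{1..n * n}. ?C (h p) (\<rho> (adjoint_op ?H (?C (h p)) f)) x)"
      by (rule l2.kraus_map_eq[OF _ C \<rho>]) (use bij_betwE[OF h] in auto)
    also have "\<dots> = (\<lambda>f\<in>ell2 Words. \<lambda>x. \<Sum>p\<in>{1..n * n}. LR.E p (\<rho> (adjoint_op ?H (LR.E p) f)) x)"
      by (intro restrict_ext ext sum.cong refl) (simp only: split_def comp)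
    also have "\<dots> = kraus_map ?H LR.E {1..n * n} \<rho>"
      by (rule l2.kraus_map_eq[OF _ LR.E_bounded \<rho>, symmetric]) simp_all
    finally show ?thesis .
  qed
  let ?\<kappa> = "ln ((real n)\<^sup>2 / (real n + 9))"
  have words: "\<exists>w :: nat list. distinct_adj w \<and> x = to_nat w" if "x \<in> Words" for x using that by (auto simp: Words_def)
  obtain L1 where L1: "regularized_moe ?H ?\<Phi> = ereal L1" "?\<kappa> \<le> L1"
  proof (rule L.regularized_moe_eq[of ?\<Phi>])
    fix L1 assume *: "regularized_moe ?H ?\<Phi> = ereal L1" and low: "\<And>\<kappa>. (\<And>k g. g \<in> L.unit_vectors k \<Longrightarrow> real k * \<kappa> \<le> L.out_entropy k g) \<Longrightarrow> \<kappa> \<le> L1"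
    have "real k * ?\<kappa> \<le> L.out_entropy k g" if "g \<in> L.unit_vectors k" for k g
    proof (rule L.out_entropy_lower_bound[OF _ _ that, where P = "\<lambda>i x. from_nat x \<noteq> ([] :: nat list) \<and> hd (from_nat x) = i"])
      show "(from_nat (?l i x) \<noteq> ([] :: nat list) \<and> hd (from_nat (?l i x)) = i) \<longleftrightarrow> \<not> (from_nat x \<noteq> ([] :: nat list) \<and> hd (from_nat x) = i)" if "x \<in> Words" for i x
      proof -
        from words[OF that] obtain w :: "nat list" where "distinct_adj w \<and> x = to_nat w" ..
        then show ?thesis using mult_left_flip[of w i] by simp
      qed
    qed simp
    then have "?\<kappa> \<le> L1" by (rule low)
    with * show thesis by (rule that)
  qed simp
  obtain L2 where L2: "regularized_moe ?H ?\<Psi> = ereal L2" "?\<kappa> \<le> L2"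
  proof (rule R.regularized_moe_eq[of ?\<Psi>])
    fix L2 assume *: "regularized_moe ?H ?\<Psi> = ereal L2" and low: "\<And>\<kappa>. (\<And>k g. g \<in> R.unit_vectors k \<Longrightarrow> real k * \<kappa> \<le> R.out_entropy k g) \<Longrightarrow> \<kappa> \<le> L2"
    have "real k * ?\<kappa> \<le> R.out_entropy k g" if "g \<in> R.unit_vectors k" for k g
    proof (rule R.out_entropy_lower_bound[OF _ _ that, where P = "\<lambda>i x. from_nat x \<noteq> ([] :: nat list) \<and> last (from_nat x) = i"])
      show "(from_nat (?r i x) \<noteq> ([] :: nat list) \<and> last (from_nat (?r i x)) = i) \<longleftrightarrow> \<not> (from_nat x \<noteq> ([] :: nat list) \<and> last (from_nat x) = i)" if "x \<in> Words" for i x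
      proof -
        from words[OF that] obtain w :: "nat list" where "distinct_adj w \<and> x = to_nat w" ..
        then show ?thesis using mult_right_flip[of w i] by simp
      qed
    qed simp
    then have "?\<kappa> \<le> L2" by (rule low)
    with * show thesis by (rule that)
  qed simp
  have e: "to_nat ([] :: nat list) \<in> Words" by (simp add: to_nat_Words)
  let ?v = "\<lambda>p. if fst (h p) = snd (h p) then [] else [fst (h p), snd (h p)]"
  have lr_e: "?lr p (to_nat ([] :: nat list)) = to_nat (?v p)" for p
    by (simp add: mult_left_def mult_right_def)
  have "LR.out_entropy 1 (delta [to_nat ([] :: nat list)]) = 
    (\<Sum>p\<in>{1..n * n}. - ln (real (card {q \<in> {1..n * n}. ?v q = ?v p}) / real (n * n))) / real (n * n)"
    unfolding LR.out_entropy_delta(2)[OF e] lr_e by simp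
  also have "\<dots> = 2 * ln (real n) - ln (real n) / real n"
    by (rule average_log_multiplicity[OF n h]) simp
  finally have low: "LR.out_entropy 1 (delta [to_nat ([] :: nat list)]) = 2 * ln (real n) - ln (real n) / real n" .
  obtain L3 where L3: "regularized_moe ?H (?\<Phi> \<circ> ?\<Psi>) = ereal L3" "L3 \<le> 2 * ln (real n) - ln (real n) / real n"
  proof (rule LR.regularized_moe_eq[of "?\<Phi> \<circ> ?\<Psi>", OF composite])
    fix L3 assume *: "regularized_moe ?H (?\<Phi> \<circ> ?\<Psi>) = ereal L3" 
      and upper: "\<And>g. g \<in> LR.unit_vectors 1 \<Longrightarrow> L3 \<le> LR.out_entropy 1 g"
    have "L3 \<le> 2 * ln (real n) - ln (real n) / real n"
      using upper[OF LR.out_entropy_delta(1)[OF e]] unfolding low .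
    with * show thesis by (rule that)
  qed
  have "L3 < L1 + L2"
    using L1(2) L2(2) L3(2) entropy_gap[of "real n"] n large by simp
  then have "regularized_moe ?H (?\<Phi> \<circ> ?\<Psi>) < regularized_moe ?H ?\<Phi> + regularized_moe ?H ?\<Psi>"
    unfolding L1(1) L2(1) L3(1) by simp
  then show ?thesis
    by (intro exI[of _ ?H] exI[of _ n] exI[of _ L.E] exI[of _ R.E] exI[of _ ?\<Phi>] exI[of _ ?\<Psi>] conjI ballI refl
        complex_hilbert_space_l2_space n L.E_bounded R.E_bounded commute L.E_kraus R.E_kraus)
qed

end
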